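(* Let $k\geq 1$ be an integer and let $\alpha\in[\frac{k}{k+1},1]$ be rational. Let $\ell$ be the smallest positive integer such that $\frac{\ell}{2k}$ and $\frac{\alpha\ell}{2k}$ are integers. There exist integers $s_0,q_0$ such that for every integer $s\geq s_0$ and every prime power $q\geq q_0$ there exists a bipartite graph $G$ with parts $M,N$, $|M|=q^{\alpha\ell}$, $|N|=q^{\ell}$, such that $G$ is $\Theta_{s,2k}$-free and \[e(G)\geq \frac12 |M|^{\frac12+\frac{1}{2k}}|N|^{\frac12}.\]
   Context: The theta graph $\Theta_{s,k}$ is the graph consisting of $s$ paths of length $k$ with the same two endpoints that are otherwise pairwise vertex-disjoint. *)

theory Defs
  imports Complex_Main "HOL-Number_Theory.Prime_Powers"
begin

text \<open>Undirected graphs as pairs of a vertex set and a set of two-element edges.\<close>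

type_synonym 'a ugraph = "'a set \<times> 'a set set"

abbreviation verts :: "'a ugraph \<Rightarrow> 'a set" where
  "verts G \<equiv> fst G"

abbreviation edges :: "'a ugraph \<Rightarrow> 'a set set" where
  "edges G \<equiv> snd G"

definition simple_graph :: "'a ugraph \<Rightarrow> bool" where
  "simple_graph G \<longleftrightarrow> finite (verts G) \<and> (\<forall>e\<in>edges G. e \<subseteq> verts G \<and> card e = 2)"

definition bipartite_with_parts :: "'a ugraph \<Rightarrow> 'a set \<Rightarrow> 'a set \<Rightarrow> bool" where
  "bipartite_with_parts G M N \<longleftrightarrow>
     simple_graph G \<and> verts G = M \<union> N \<and> M \<inter> N = {} \<and>
     (\<forall>e\<in>edges G. \<exists>x\<in>M. \<exists>y\<in>N. e = {x, y})"

text \<open>Containment is as a not necessarily induced subgraph.\<close>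

definition contains_copy :: "'a ugraph \<Rightarrow> 'b ugraph \<Rightarrow> bool" where
  "contains_copy G H \<longleftrightarrow>
     (\<exists>f. inj_on f (verts H) \<and> f ` verts H \<subseteq> verts G \<and> (\<forall>e\<in>edges H. f ` e \<in> edges G))"

definition free_of :: "'a ugraph \<Rightarrow> 'b ugraph \<Rightarrow> bool" where
  "free_of G H \<longleftrightarrow> \<not> contains_copy G H"

text \<open>\<open>Inner i j\<close> is the vertex at distance \<open>j\<close> from \<open>Source\<close> on the \<open>i\<close>-th path.\<close>

datatype theta_vertex = Source | Target | Inner nat nat

definition theta_path_vertex :: "nat \<Rightarrow> nat \<Rightarrow> nat \<Rightarrow> theta_vertex" where
  "theta_path_vertex k i j = (if j = 0 then Source else if j = k then Target else Inner i j)"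

text \<open>The parameter \<open>k\<close> counts the edges of each path. For \<open>k = 1\<close> the \<open>s\<close> paths would be
  parallel edges, which collapse to a single edge here; the definition is meant for \<open>k \<ge> 2\<close>.\<close>

definition theta_graph :: "nat \<Rightarrow> nat \<Rightarrow> theta_vertex ugraph" where
  "theta_graph s k =
     ({Source, Target} \<union> {Inner i j | i j. i < s \<and> 0 < j \<and> j < k},
      {{theta_path_vertex k i j, theta_path_vertex k i (Suc j)} | i j. i < s \<and> j < k})"

end

theory Submission
  imports Defs "Jordan_Normal_Form.Char_Poly"
begin

text \<open>
  Let \<open>\<alpha> = a / b\<close>, \<open>l = 2 k b\<close>, \<open>A = 2 k a\<close>, \<open>t = k b + (k - 1) a\<close> and \<open>\<beta> = 2 k b - t\<close>. Over the field
  \<open>F\<close> with \<open>q\<close> elements take \<open>M = F^A\<close>, \<open>N = F^(\<beta> + t)\<close> and join \<open>x\<close> to \<open>(\<nu>, \<eta>)\<close> iff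
  \<open>\<eta> = P (x, \<nu>)\<close>, where \<open>P\<close> consists of \<open>t\<close> random polynomials of bounded degree with \<open>D\<close> coefficients
  in total. There are exactly \<open>q^(A + \<beta>)\<close> edges.

  By quantifier elimination over the algebraic closure \<open>K\<close> of \<open>F\<close>, each coordinate of the first inner vertex
  of the paths between two given vertices takes boundedly many or all but boundedly many values. Hence a theta
  graph with many paths yields, for any constant \<open>L\<close>, paths over \<open>K\<close> with \<open>L\<close> prescribed values of
  a coordinate. Each of them has more new edges than new vertices, so together they impose
  conditions of codimension at least \<open>L\<close> on the coefficients: by Lagrange interpolation, these are rational
  functions of \<open>D - L\<close> parameters in \<open>K\<close>. As every function on a subset of \<open>F^D\<close> is a polynomial of
  degree \<open>O(q)\<close>, the number of such coefficient vectors is bounded by the number \<open>O(q^(D - L))\<close> of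
  monomials of degree \<open>O(q)\<close> in \<open>D - L\<close> variables. This replaces the Lang-Weil bound, and a union bound
  over the endpoints concludes.

  To have one type for all characteristics, \<open>K\<close> is the ring of algebraic integers modulo a maximal ideal \<open>I\<close>,
  and equations in \<open>K\<close> are congruences modulo \<open>I\<close>.
\<close>

section \<open>Polynomials modulo a maximal ideal\<close>

text \<open>The dichotomy for coordinates serves the union bound. Prescribing \<open>L\<close>
  values of a coordinate saves a factor q^L, but letting these values range over F would cost the
  same factor. As all but boundedly many values occur once more than boundedly many do, the values
  can be taken from a set \<open>U\<close> whose size does not depend on q. The price is that the
  paths found have coordinates in K; what is counted are the coefficient vectors in F^D for which
  such paths exist. What remains to pay for are the endpoints: with n = A + \<beta> + t there are
  O(q^(2n)) choices, hence \<open>L\<close> = 2n + 1. The exponents come from a balance. The 2k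
  edges of a path give 2kt equations, and its 2k - 1 inner vertices have dimension at most 2kt, with
  equality for endpoints in M. As t \<le> A, which is the lower bound on \<alpha>, every set S of
  inner positions then has dimension at most t (|S| + 1). So paths that overlap partially also have
  enough new edges for their new vertices.\<close>

lemma prod_list_dvd_prod_list:
  fixes f g :: "'b \<Rightarrow> 'c::comm_semiring_1"
  shows "(\<And>x. x \<in> set xs \<Longrightarrow> f x dvd g x) \<Longrightarrow> (\<Prod>x\<leftarrow>xs. f x) dvd (\<Prod>x\<leftarrow>xs. g x)"
  by (induction xs) (auto intro: mult_dvd_mono)

lemma dvd_prod_list_map:
  fixes f :: "'b \<Rightarrow> 'c::comm_semiring_1"
  shows "x \<in> set xs \<Longrightarrow> f x dvd (\<Prod>x\<leftarrow>xs. f x)"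
  by (induction xs) auto

text \<open>The quotient by \<open>I\<close> is an algebraically closed field.
  \<open>monic_root\<close> asks for an exact root, not a root modulo \<open>I\<close>, so that
  monic polynomials split exactly; the ring of algebraic integers has this property.\<close>

locale acf_ideal =
  fixes I :: "'a::idom set"
  assumes zero_mem: "0 \<in> I"
    and add_mem: "x \<in> I \<Longrightarrow> y \<in> I \<Longrightarrow> x + y \<in> I"
    and mult_mem: "x \<in> I \<Longrightarrow> y * x \<in> I"
    and one_notin: "1 \<notin> I"
    and inverse_mod: "x \<notin> I \<Longrightarrow> \<exists>y. x * y - 1 \<in> I"
    and monic_root: "lead_coeff (f :: 'a poly) = 1 \<Longrightarrow> degree f > 0 \<Longrightarrow> \<exists>x. poly f x = 0"
begin

lemma mult_mem_right: "x \<in> I \<Longrightarrow> x * y \<in> I"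
  using mult_mem[of x y] by (simp add: mult.commute)

lemma uminus_mem: "x \<in> I \<Longrightarrow> - x \<in> I"
  using mult_mem[of x "-1"] by simp

lemma diff_mem: "x \<in> I \<Longrightarrow> y \<in> I \<Longrightarrow> x - y \<in> I"
  using add_mem[of x "-y"] uminus_mem[of y] by simp

lemma diff_mem_commute: "x - y \<in> I \<longleftrightarrow> y - x \<in> I"
  using uminus_mem[of "x - y"] uminus_mem[of "y - x"] by auto

lemma diff_mem_trans: "x - y \<in> I \<Longrightarrow> y - z \<in> I \<Longrightarrow> x - z \<in> I"
  using add_mem[of "x - y" "y - z"] by simp

lemma sum_mem: "(\<And>i. i \<in> S \<Longrightarrow> f i \<in> I) \<Longrightarrow> sum f S \<in> I"
  by (induction S rule: infinite_finite_induct) (auto intro: zero_mem add_mem)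

lemma mult_mem_iff: "x * y \<in> I \<longleftrightarrow> x \<in> I \<or> y \<in> I"
proof
  assume xy: "x * y \<in> I"
  show "x \<in> I \<or> y \<in> I"
  proof (rule disjCI)
    assume "y \<notin> I"
    then obtain z where z: "y * z - 1 \<in> I" using inverse_mod by blast
    have "x = x * y * z - x * (y * z - 1)" by (simp add: algebra_simps)
    also have "\<dots> \<in> I" by (intro diff_mem mult_mem_right[OF xy] mult_mem[OF z])
    finally show "x \<in> I" .
  qed
qed (auto intro: mult_mem mult_mem_right)

lemma power_mem: "x ^ n \<in> I \<Longrightarrow> x \<in> I"
  by (induction n) (auto simp: mult_mem_iff one_notin)

lemma prod_mem_iff: "finite S \<Longrightarrow> prod f S \<in> I \<longleftrightarrow> (\<exists>i\<in>S. f i \<in> I)"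
  by (induction S rule: finite_induct) (auto simp: mult_mem_iff one_notin)

lemma mem_cong: "x - y \<in> I \<Longrightarrow> x \<in> I \<longleftrightarrow> y \<in> I"
  using add_mem[of "x - y" y] diff_mem[of x "x - y"] by auto

lemma cong_add: "x - x' \<in> I \<Longrightarrow> y - y' \<in> I \<Longrightarrow> (x + y) - (x' + y') \<in> I"
  using add_mem[of "x - x'" "y - y'"] by (simp add: algebra_simps)

lemma cong_mult: "x - x' \<in> I \<Longrightarrow> y - y' \<in> I \<Longrightarrow> x * y - x' * y' \<in> I"
  using add_mem[of "(x - x') * y" "x' * (y - y')"] mult_mem_right[of "x - x'" y]
    mult_mem[of "y - y'" x'] by (simp add: algebra_simps)

lemma cong_power: "x - x' \<in> I \<Longrightarrow> x ^ n - x' ^ n \<in> I"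
  by (induction n) (auto intro: cong_mult zero_mem)

lemma cong_sum: "(\<And>i. i \<in> S \<Longrightarrow> f i - g i \<in> I) \<Longrightarrow> sum f S - sum g S \<in> I"
  using sum_mem[of S "\<lambda>i. f i - g i"] by (simp add: sum_subtractf)

lemma poly_mem: "(\<And>j. coeff p j \<in> I) \<Longrightarrow> poly p x \<in> I"
  by (auto simp: poly_altdef intro!: sum_mem mult_mem_right)

lemma coeff_mult_mem: "(\<And>j. coeff q j \<in> I) \<Longrightarrow> coeff (p * q) j \<in> I"
  by (auto simp: coeff_mult intro!: sum_mem mult_mem)

text \<open>Dividing by X - r for a root r modulo \<open>I\<close> leaves the remainder
  \<open>poly f r\<close> in \<open>I\<close>. So the quotient keeps a coefficient outside
  \<open>I\<close>, and since \<open>I\<close> is prime, every root class of \<open>f\<close> other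
  than that of r is one of the quotient.\<close>

lemma root_classes:
  assumes "degree f \<le> n" "coeff f j \<notin> I"
  shows "\<exists>E. finite E \<and> card E \<le> n \<and> (\<forall>x. poly f x \<in> I \<longrightarrow> (\<exists>e\<in>E. x - e \<in> I))"
  using assms
proof (induction n arbitrary: f j)
  case 0
  then have "f = [:coeff f 0:]" by (metis degree_0_id le_zero_eq)
  moreover from 0 have "coeff f 0 \<notin> I"
    by (metis coeff_eq_0 le_zero_eq neq0_conv zero_mem)
  ultimately have "poly f x \<notin> I" for x
    by (metis add_cancel_right_right mult_zero_right poly_0 poly_pCons)
  then show ?case by (intro exI[of _ "{}"]) auto
next
  case (Suc n)
  show ?case
  proof (cases "\<exists>r. poly f r \<in> I")
    case False
    then show ?thesis by (intro exI[of _ "{}"]) auto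
  next
    case True
    then obtain r where r: "poly f r \<in> I" by blast
    define h where "h = synthetic_div f r"
    have f: "f = [:-r, 1:] * h + [:poly f r:]"
      unfolding h_def by (rule synthetic_div_correct'[symmetric])
    have "\<exists>i. coeff h i \<notin> I"
    proof (rule ccontr)
      assume "\<not> (\<exists>i. coeff h i \<notin> I)"
      then have "coeff ([:-r, 1:] * h + [:poly f r:]) j \<in> I"
        using r zero_mem by (auto simp: coeff_pCons intro!: diff_mem mult_mem split: nat.split)
      with f Suc.prems show False by simp
    qed
    moreover have "degree h \<le> n"
      using Suc.prems by (simp add: h_def degree_synthetic_div)
    ultimately obtain E where E: "finite E" "card E \<le> n"
        "\<And>x. poly h x \<in> I \<Longrightarrow> (\<exists>e\<in>E. x - e \<in> I)"
      using Suc.IH by blast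
    have "\<exists>e\<in>insert r E. x - e \<in> I" if "poly f x \<in> I" for x
    proof -
      have "poly f x = (x - r) * poly h x + poly f r"
        by (subst f) (simp add: algebra_simps)
      with that r have "(x - r) * poly h x \<in> I"
        using diff_mem[of "poly f x" "poly f r"] by simp
      then show ?thesis using E(3) by (auto simp: mult_mem_iff)
    qed
    then show ?thesis using E by (intro exI[of _ "insert r E"]) (auto simp: card_insert_if)
  qed
qed

lemma card_le_of_cover:
  assumes "finite E" and cover: "\<And>x. x \<in> S \<Longrightarrow> \<exists>e\<in>E. x - e \<in> I"
    and incong: "\<And>x y. x \<in> S \<Longrightarrow> y \<in> S \<Longrightarrow> x - y \<in> I \<Longrightarrow> x = y"
  shows "finite S \<and> card S \<le> card E"
proof -
  obtain g where g: "\<And>x. x \<in> S \<Longrightarrow> g x \<in> E \<and> x - g x \<in> I"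
    using cover by metis
  have "inj_on g S"
    by (rule inj_onI) (metis g incong diff_mem_commute diff_mem_trans)
  moreover have "g ` S \<subseteq> E" using g by auto
  ultimately show ?thesis using \<open>finite E\<close>
    by (metis card_inj_on_le finite_subset inj_on_finite)
qed

lemma coeffs_mem_of_roots:
  assumes "degree f < card S" and "\<And>x. x \<in> S \<Longrightarrow> poly f x \<in> I"
    and "\<And>x y. x \<in> S \<Longrightarrow> y \<in> S \<Longrightarrow> x - y \<in> I \<Longrightarrow> x = y"
  shows "coeff f j \<in> I"
proof (rule ccontr)
  assume "coeff f j \<notin> I"
  from root_classes[OF order_refl this] obtain E where
    "finite E" "card E \<le> degree f" "\<And>x. poly f x \<in> I \<Longrightarrow> (\<exists>e\<in>E. x - e \<in> I)" by blast
  with card_le_of_cover[of E S] assms show False by force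
qed

text \<open>The residue field is infinite: at a root x of 1 plus the product of the X - e, the
  product of the x - e is -1, which is not in \<open>I\<close>.\<close>

lemma incongruent_element:
  assumes "finite E" shows "\<exists>x. \<forall>e\<in>E. x - e \<notin> I"
proof (cases "E = {}")
  case False
  define f where "f = (\<Prod>e\<in>E. [:-e, 1:]) + 1"
  have deg: "degree (\<Prod>e\<in>E. [:-e, 1:]) = card E"
    by (subst degree_prod_eq_sum_degree) auto
  have pos: "card E > 0" using False assms by (simp add: card_gt_0_iff)
  have "lead_coeff (\<Prod>e\<in>E. [:-e, 1:]) = 1" by (simp add: lead_coeff_prod)
  then have "lead_coeff f = 1" "degree f > 0"
    using deg pos unfolding f_def by (simp_all add: degree_add_eq_left lead_coeff_add_le)
  then obtain x where "poly f x = 0" using monic_root by blast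
  then have "(\<Prod>e\<in>E. x - e) = -1"
    by (simp add: f_def poly_prod eq_neg_iff_add_eq_0)
  then have "(\<Prod>e\<in>E. x - e) \<notin> I"
    using uminus_mem[of "-1"] one_notin by auto
  then show ?thesis using prod_mem_iff[OF assms, of "\<lambda>e. x - e"] by auto
qed auto

lemma monic_splits:
  "lead_coeff (f :: 'a poly) = 1 \<Longrightarrow> \<exists>rs. length rs = degree f \<and> f = (\<Prod>r\<leftarrow>rs. [:-r, 1:])"
proof (induction "degree f" arbitrary: f)
  case 0
  then show ?case by (metis degree_0_id lead_coeff_1 length_0_conv list.map(1) one_pCons prod_list.Nil)
next
  case (Suc n)
  then obtain r where "poly f r = 0" using monic_root[of f] by auto
  then obtain h where h: "f = [:-r, 1:] * h" by (auto simp: poly_eq_0_iff_dvd)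
  have "h \<noteq> 0" using h Suc by auto
  then have deg: "degree f = Suc (degree h)" unfolding h by (subst degree_mult_eq) auto
  moreover have "lead_coeff h = 1" using Suc.prems unfolding h by (subst (asm) lead_coeff_mult) auto
  moreover have "n = degree h" using deg Suc.hyps(2) by simp
  ultimately obtain rs where "length rs = degree h" "h = (\<Prod>r\<leftarrow>rs. [:-r, 1:])"
    using Suc.hyps(1)[of h] by blast
  then show ?case using h deg by (intro exI[of _ "r # rs"]) auto
qed

text \<open>Modulo \<open>I\<close>, a multiple of a monic polynomial of degree n is zero or has
  degree at least n.\<close>

lemma monic_mult_small_degree:
  assumes F: "coeff F n = 1" "degree F \<le> n" and S: "\<And>j. j \<ge> n \<Longrightarrow> coeff S j = 0"
    and diff: "\<And>j. coeff (F * W) j - coeff S j \<in> I"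
  shows "coeff S j \<in> I"
proof -
  have W: "coeff W k \<in> I" for k
  proof (rule ccontr)
    assume k: "coeff W k \<notin> I"
    \<comment> \<open>\<open>K\<close> is the degree of \<open>W\<close> modulo \<open>I\<close>;
      the coefficient n + K of \<open>F * W\<close> is then congruent to
      \<open>coeff W K\<close>.\<close>
    define K where "K = Max {k. coeff W k \<notin> I}"
    have fin: "finite {k. coeff W k \<notin> I}"
      by (rule finite_subset[of _ "{..degree W}"]) (use zero_mem in \<open>auto intro: le_degree\<close>)
    then have K: "coeff W K \<notin> I" using Max_in[OF fin] k by (auto simp: K_def)
    have big: "coeff W k \<in> I" if "k > K" for k
      using Max_ge[OF fin, of k] that by (auto simp: K_def)
    have "coeff (F * W) (n + K) = (\<Sum>i\<le>n + K. coeff F i * coeff W (n + K - i))"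
      by (simp add: coeff_mult)
    also have "\<dots> = coeff W K + (\<Sum>i\<in>{..n + K} - {n}. coeff F i * coeff W (n + K - i))"
      by (subst sum.remove[of _ n]) (auto simp: F)
    finally have "coeff (F * W) (n + K) - coeff W K = (\<Sum>i\<in>{..n + K} - {n}. coeff F i * coeff W (n + K - i))"
      by simp
    also have "\<dots> \<in> I"
    proof (rule sum_mem)
      fix i assume "i \<in> {..n + K} - {n}"
      then consider "i < n" | "i > n" by force
      then show "coeff F i * coeff W (n + K - i) \<in> I"
        by cases (use F in \<open>auto intro!: mult_mem big simp: coeff_eq_0 zero_mem\<close>)
    qed
    finally have "coeff (F * W) (n + K) \<notin> I" using K mem_cong by blast
    with diff[of "n + K"] S[of "n + K"] show False by simp
  qed
  have "coeff (F * W) j \<in> I" by (rule coeff_mult_mem[OF W])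
  with diff[of j] show ?thesis using mem_cong by blast
qed

text \<open>This replaces a power of \<open>g\<close> by a product in which each factor can be made
  exactly divisible by one linear factor of a monic polynomial.\<close>

lemma power_prod_list_diff:
  assumes "\<And>r. r \<in> set rs \<Longrightarrow> c r \<in> I"
  shows "coeff (g ^ length rs - (\<Prod>r\<leftarrow>rs. g - [:c r:])) j \<in> I"
  using assms
proof (induction rs arbitrary: j)
  case (Cons r rs)
  have "g ^ length (r # rs) - (\<Prod>r\<leftarrow>r # rs. g - [:c r:]) =
     g * (g ^ length rs - (\<Prod>r\<leftarrow>rs. g - [:c r:])) + (\<Prod>r\<leftarrow>rs. g - [:c r:]) * [:c r:]"
    by (simp add: algebra_simps)
  moreover have "coeff [:c r:] i \<in> I" for i
    using Cons.prems by (auto simp: coeff_pCons zero_mem split: nat.split)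
  ultimately show ?case
    using Cons by (auto simp only: coeff_add intro!: add_mem coeff_mult_mem) auto
qed (simp add: zero_mem)

text \<open>As \<open>f\<close> has degree n modulo \<open>I\<close>, its roots have multiplicity at
  most n. So \<open>g\<close> vanishes at all roots of \<open>f\<close> iff \<open>f\<close> divides
  \<open>g ^ n\<close> modulo \<open>I\<close>, that is, iff the pseudo-remainder \<open>R\<close>
  vanishes modulo \<open>I\<close>.\<close>

lemma exists_root_nonroot_iff:
  assumes f: "degree f \<le> n" "coeff f n \<notin> I" "n > 0"
    and R: "Polynomial.smult (coeff f n ^ e) (g ^ n) = f * Q + R" "degree R < n"
  shows "(\<exists>x. poly f x \<in> I \<and> poly g x \<notin> I) \<longleftrightarrow> (\<exists>j. coeff R j \<notin> I)"
proof
  assume "\<exists>x. poly f x \<in> I \<and> poly g x \<notin> I"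
  then obtain x where x: "poly f x \<in> I" "poly g x \<notin> I" by blast
  have eq: "coeff f n ^ e * poly g x ^ n = poly f x * poly Q x + poly R x"
    using arg_cong[OF R(1), of "\<lambda>p. poly p x"] by simp
  show "\<exists>j. coeff R j \<notin> I"
  proof (rule ccontr)
    assume "\<not> (\<exists>j. coeff R j \<notin> I)"
    then have "coeff f n ^ e * poly g x ^ n \<in> I"
      unfolding eq by (intro add_mem mult_mem_right x poly_mem) auto
    then show False using x f by (auto simp: mult_mem_iff dest: power_mem)
  qed
next
  assume ex: "\<exists>j. coeff R j \<notin> I"
  show "\<exists>x. poly f x \<in> I \<and> poly g x \<notin> I"
  proof (rule ccontr)
    assume "\<not> (\<exists>x. poly f x \<in> I \<and> poly g x \<notin> I)"
    then have roots: "poly f x \<in> I \<Longrightarrow> poly g x \<in> I" for x by blast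
    obtain y where y: "coeff f n * y - 1 \<in> I" using inverse_mod f by blast
    have y_notin: "y \<notin> I"
      using y diff_mem[of "coeff f n * y" "coeff f n * y - 1"] one_notin by (auto intro: mult_mem)
    \<comment> \<open>Since \<open>y\<close> inverts the leading coefficient, \<open>F\<close> is
      congruent to \<open>y\<close> times \<open>f\<close>; being monic, it splits exactly.\<close>
    define F where "F = Polynomial.smult y f + monom (1 - y * coeff f n) n"
    have F: "coeff F n = 1" "degree F \<le> n"
      using f by (auto simp: F_def intro!: degree_add_le degree_smult_le[THEN order_trans] degree_monom_le)
    then have degF: "degree F = n" by (metis le_antisym le_degree zero_neq_one)
    then obtain rs where rs: "length rs = n" "F = (\<Prod>r\<leftarrow>rs. [:-r, 1:])"
      using monic_splits[of F] F by auto
    have c: "1 - y * coeff f n \<in> I" using y by (metis diff_mem_commute mult.commute)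
    have g_rs: "poly g r \<in> I" if "r \<in> set rs" for r
    proof -
      have "[:-r, 1:] dvd F" unfolding rs(2) using that by (rule dvd_prod_list_map)
      then have "poly F r = 0" by (simp add: poly_eq_0_iff_dvd)
      then have "y * poly f r = - ((1 - y * coeff f n) * r ^ n)"
        by (simp add: F_def poly_monom eq_neg_iff_add_eq_0)
      also have "\<dots> \<in> I" using c by (intro uminus_mem mult_mem_right)
      finally show ?thesis using y_notin roots by (auto simp: mult_mem_iff)
    qed
    \<comment> \<open>X - r divides g - g(r), so this divisibility is exact, while modulo
      \<open>I\<close> the product is \<open>g ^ n\<close>.\<close>
    have "F dvd (\<Prod>r\<leftarrow>rs. g - [:poly g r:])"
      unfolding rs(2) by (rule prod_list_dvd_prod_list) (simp add: poly_eq_0_iff_dvd[symmetric])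
    then obtain H where H: "(\<Prod>r\<leftarrow>rs. g - [:poly g r:]) = F * H"
      unfolding dvd_def by (elim exE)
    define l where "l = coeff f n ^ e"
    have "F * (Polynomial.smult (l * y) H - Q) - Polynomial.smult y R =
      (- Polynomial.smult (l * y) (g ^ length rs - (\<Prod>r\<leftarrow>rs. g - [:poly g r:]))) - Q * monom (1 - y * coeff f n) n
      + Polynomial.smult y (Polynomial.smult l (g ^ n) - f * Q - R)"
      unfolding H by (simp add: rs(1) F_def algebra_simps smult_add_right smult_diff_right)
    also have "\<dots> = (- Polynomial.smult (l * y) (g ^ length rs - (\<Prod>r\<leftarrow>rs. g - [:poly g r:]))) - Q * monom (1 - y * coeff f n) n"
      using R(1) by (simp add: l_def)
    finally have eq: "F * (Polynomial.smult (l * y) H - Q) - Polynomial.smult y R = \<dots>" .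
    have "coeff (F * (Polynomial.smult (l * y) H - Q)) j - coeff (Polynomial.smult y R) j \<in> I" for j
    proof -
      have "coeff (g ^ length rs - (\<Prod>r\<leftarrow>rs. g - [:poly g r:])) j \<in> I"
        by (rule power_prod_list_diff) (rule g_rs)
      moreover have "coeff (Q * monom (1 - y * coeff f n) n) j \<in> I"
        by (rule coeff_mult_mem) (auto simp: c zero_mem)
      ultimately have "- (l * y * coeff (g ^ length rs - (\<Prod>r\<leftarrow>rs. g - [:poly g r:])) j) -
          coeff (Q * monom (1 - y * coeff f n) n) j \<in> I"
        by (intro diff_mem uminus_mem mult_mem)
      then show ?thesis
        unfolding coeff_diff[symmetric] eq by (simp only: coeff_diff coeff_minus coeff_smult)
    qed
    from monic_mult_small_degree[OF F _ this] have "coeff (Polynomial.smult y R) j \<in> I" for j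
      using R(2) by (simp add: coeff_eq_0)
    then show False using ex y_notin by (auto simp: mult_mem_iff)
  qed
qed

end

section \<open>Quantifier elimination\<close>

inductive integral_term :: "(('i \<Rightarrow> 'a::idom) \<Rightarrow> 'a) \<Rightarrow> bool" where
  term_var: "integral_term (\<lambda>e. e i)"
| term_zero: "integral_term (\<lambda>e. 0)"
| term_one: "integral_term (\<lambda>e. 1)"
| term_add: "integral_term s \<Longrightarrow> integral_term t \<Longrightarrow> integral_term (\<lambda>e. s e + t e)"
| term_mult: "integral_term s \<Longrightarrow> integral_term t \<Longrightarrow> integral_term (\<lambda>e. s e * t e)"
| term_uminus: "integral_term s \<Longrightarrow> integral_term (\<lambda>e. - s e)"

lemma term_diff: "integral_term s \<Longrightarrow> integral_term t \<Longrightarrow> integral_term (\<lambda>e. s e - t e)"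
  using term_add[OF _ term_uminus, of s t] by simp

lemma term_sum: "(\<And>i. i \<in> S \<Longrightarrow> integral_term (t i)) \<Longrightarrow> integral_term (\<lambda>e. \<Sum>i\<in>S. t i e)"
  by (induction S rule: infinite_finite_induct) (auto intro: term_zero term_add)

lemma term_power: "integral_term t \<Longrightarrow> integral_term (\<lambda>e. t e ^ n)"
  by (induction n) (auto intro: term_one term_mult)

text \<open>The bound \<open>n\<close> is a formal degree, valid for all assignments; the true
  degree may drop with the assignment, and further modulo \<open>I\<close>.\<close>

definition poly_term :: "nat \<Rightarrow> (('i \<Rightarrow> 'a::idom) \<Rightarrow> 'a poly) \<Rightarrow> bool" where
  "poly_term n p \<longleftrightarrow> (\<forall>e. degree (p e) \<le> n) \<and> (\<forall>j. integral_term (\<lambda>e. coeff (p e) j))"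

lemma poly_term_mono: "poly_term n p \<Longrightarrow> n \<le> m \<Longrightarrow> poly_term m p"
  unfolding poly_term_def using order_trans by blast

lemma poly_poly_term_0:
  assumes "poly_term 0 f" shows "poly (f e) x = coeff (f e) 0"
proof -
  have "f e = [:coeff (f e) 0:]" using assms by (metis degree_0_id le_zero_eq poly_term_def)
  then show ?thesis by (metis add_cancel_right_right mult_zero_right poly_0 poly_pCons)
qed

lemma poly_term_const: "integral_term t \<Longrightarrow> poly_term 0 (\<lambda>e. [:t e:])"
  unfolding poly_term_def
proof (intro conjI allI)
  show "integral_term (\<lambda>e. coeff [:t e:] j)" if "integral_term t" for j
    using that by (cases j) (auto intro: term_zero)
qed auto

lemma poly_term_X: "poly_term 1 (\<lambda>e. [:0, 1:])"
  unfolding poly_term_def by (auto simp: coeff_pCons intro: term_zero term_one split: nat.split)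

lemma poly_term_add: "poly_term n p \<Longrightarrow> poly_term n q \<Longrightarrow> poly_term n (\<lambda>e. p e + q e)"
  unfolding poly_term_def by (auto intro: degree_add_le term_add)

lemma poly_term_uminus: "poly_term n p \<Longrightarrow> poly_term n (\<lambda>e. - p e)"
  unfolding poly_term_def by (auto intro: term_uminus)

lemma poly_term_mult: "poly_term n p \<Longrightarrow> poly_term m q \<Longrightarrow> poly_term (n + m) (\<lambda>e. p e * q e)"
  unfolding poly_term_def
  by (auto simp: coeff_mult intro!: term_sum term_mult order_trans[OF degree_mult_le] add_mono)

lemma poly_term_power: "poly_term n p \<Longrightarrow> poly_term (m * n) (\<lambda>e. p e ^ m)"
  by (induction m) (auto intro!: poly_term_mult poly_term_const[OF term_one, unfolded one_pCons[symmetric]])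

lemma poly_term_prod:
  assumes "finite S" "\<And>i. i \<in> S \<Longrightarrow> \<exists>n. poly_term n (p i)"
  shows "\<exists>n. poly_term n (\<lambda>e. \<Prod>i\<in>S. p i e)"
  using assms
proof (induction S rule: finite_induct)
  case empty
  then show ?case using poly_term_const[OF term_one] by (auto simp: one_pCons)
next
  case (insert i S)
  obtain n where "poly_term n (p i)" using insert.prems by blast
  moreover obtain m where "poly_term m (\<lambda>e. \<Prod>i\<in>S. p i e)" using insert.IH insert.prems by blast
  ultimately show ?case using poly_term_mult insert.hyps by fastforce
qed

lemma integral_term_as_poly_term:
  assumes "integral_term t"
  shows "\<exists>n p. poly_term n p \<and> (\<forall>e x. t (e(i := x)) = poly (p e) x)"
  using assms
proof induction
  case (term_var j)
  show ?case
  proof (cases "j = i")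
    case True
    then show ?thesis using poly_term_X by (intro exI[of _ 1] exI[of _ "\<lambda>e. [:0, 1:]"]) auto
  next
    case False
    then show ?thesis using poly_term_const[OF integral_term.term_var[of j]]
      by (intro exI[of _ 0] exI[of _ "\<lambda>e. [:e j:]"]) auto
  qed
next
  case term_zero
  then show ?case using poly_term_const[OF integral_term.term_zero]
    by (intro exI[of _ 0] exI[of _ "\<lambda>e. [:0:]"]) auto
next
  case term_one
  then show ?case using poly_term_const[OF integral_term.term_one]
    by (intro exI[of _ 0] exI[of _ "\<lambda>e. [:1:]"]) auto
next
  case (term_add s t)
  then obtain n p m q where "poly_term n p" "poly_term m q" and
    eq: "\<And>e x. s (e(i := x)) = poly (p e) x" "\<And>e x. t (e(i := x)) = poly (q e) x" by blast
  then have "poly_term (max n m) (\<lambda>e. p e + q e)"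
    by (intro poly_term_add) (auto elim: poly_term_mono)
  then show ?case using eq by (metis (no_types, lifting) poly_add)
next
  case (term_mult s t)
  then obtain n p m q where "poly_term n p" "poly_term m q" and
    eq: "\<And>e x. s (e(i := x)) = poly (p e) x" "\<And>e x. t (e(i := x)) = poly (q e) x" by blast
  then have "poly_term (n + m) (\<lambda>e. p e * q e)"
    by (intro poly_term_mult)
  then show ?case using eq by (metis (no_types, lifting) poly_mult)
next
  case (term_uminus s)
  then show ?case by (metis (no_types, lifting) poly_minus poly_term_uminus)
qed

lemma integral_terms_as_poly_terms:
  assumes "\<forall>t\<in>T. integral_term t"
  shows "\<exists>p d. (\<forall>t\<in>T. \<forall>e x. t (e(i := x)) = poly (p t e) x) \<and> (\<forall>t\<in>T. poly_term (d t) (p t))"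
proof -
  have "\<forall>t\<in>T. \<exists>pd. poly_term (snd pd) (fst pd) \<and> (\<forall>e x. t (e(i := x)) = poly (fst pd e) x)"
    using integral_term_as_poly_term assms by fastforce
  from bchoice[OF this] obtain pd where
    "\<forall>t\<in>T. poly_term (snd (pd t)) (fst (pd t)) \<and> (\<forall>e x. t (e(i := x)) = poly (fst (pd t) e) x)"
    by blast
  then show ?thesis by (intro exI[of _ "\<lambda>t. fst (pd t)"] exI[of _ "\<lambda>t. snd (pd t)"]) auto
qed

text \<open>A Boolean combination of conditions \<open>t e \<in> I\<close>, given as a predicate on
  the set of vanishing terms. \<open>T\<close> and \<open>P\<close> are fixed before
  \<open>I\<close> and \<open>e\<close>, so bounds derived from them depend neither on the
  characteristic nor on q.\<close>

definition qf_definable :: "('a::idom set \<Rightarrow> ('i \<Rightarrow> 'a) \<Rightarrow> bool) \<Rightarrow> bool" where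
  "qf_definable R \<longleftrightarrow> (\<exists>T P. finite T \<and> (\<forall>t\<in>T. integral_term t) \<and>
     (\<forall>I e. acf_ideal I \<longrightarrow> R I e = P {t \<in> T. t e \<in> I}))"

lemma qf_definableE:
  assumes "qf_definable R"
  obtains T P where "finite T" "\<And>t. t \<in> T \<Longrightarrow> integral_term t"
    "\<And>I e. acf_ideal I \<Longrightarrow> R I e = P {t \<in> T. t e \<in> I}"
proof -
  from assms obtain T P where "finite T" "\<forall>t\<in>T. integral_term t"
    "\<forall>I e. acf_ideal I \<longrightarrow> R I e = P {t \<in> T. t e \<in> I}"
    unfolding qf_definable_def by blast
  with that[of T P] show ?thesis by simp
qed

lemma qf_cong:
  assumes "qf_definable R" "\<And>I e. acf_ideal I \<Longrightarrow> R' I e \<longleftrightarrow> R I e"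
  shows "qf_definable R'"
proof -
  obtain T P where "finite T" "\<And>t. t \<in> T \<Longrightarrow> integral_term t"
    "\<And>I e. acf_ideal I \<Longrightarrow> R I e = P {t \<in> T. t e \<in> I}"
    using assms(1) by (rule qf_definableE) blast
  with assms(2) show ?thesis
    unfolding qf_definable_def by (intro exI[of _ T] exI[of _ P]) simp
qed

lemma qf_term: "integral_term t \<Longrightarrow> qf_definable (\<lambda>I e. t e \<in> I)"
  unfolding qf_definable_def
  by (intro exI[of _ "{t}"] exI[of _ "\<lambda>S. t \<in> S"]) auto

lemma qf_const: "qf_definable (\<lambda>I e. b)"
  unfolding qf_definable_def by (intro exI[of _ "{}"] exI[of _ "\<lambda>S. b"]) auto

lemma qf_not: "qf_definable R \<Longrightarrow> qf_definable (\<lambda>I e. \<not> R I e)"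
  unfolding qf_definable_def by (elim exE, rule_tac x = T in exI, rule_tac x = "\<lambda>S. \<not> P S" in exI) auto

lemma qf_conj:
  assumes "qf_definable R" "qf_definable R'"
  shows "qf_definable (\<lambda>I e. R I e \<and> R' I e)"
proof -
  obtain T P where
    1: "finite T" "\<And>t. t \<in> T \<Longrightarrow> integral_term t" "\<And>I e. acf_ideal I \<Longrightarrow> R I e = P {t \<in> T. t e \<in> I}"
    using assms(1) by (rule qf_definableE) blast
  obtain T' P' where
    2: "finite T'" "\<And>t. t \<in> T' \<Longrightarrow> integral_term t" "\<And>I e. acf_ideal I \<Longrightarrow> R' I e = P' {t \<in> T'. t e \<in> I}"
    using assms(2) by (rule qf_definableE) blast
  have eq: "{t \<in> T \<union> T'. t e \<in> I} \<inter> T = {t \<in> T. t e \<in> I}"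
           "{t \<in> T \<union> T'. t e \<in> I} \<inter> T' = {t \<in> T'. t e \<in> I}" for e I by auto
  show ?thesis unfolding qf_definable_def
  proof (intro exI[of _ "T \<union> T'"] exI[of _ "\<lambda>S. P (S \<inter> T) \<and> P' (S \<inter> T')"] conjI allI impI)
    show "(R I e \<and> R' I e) = (P ({t \<in> T \<union> T'. t e \<in> I} \<inter> T) \<and> P' ({t \<in> T \<union> T'. t e \<in> I} \<inter> T'))"
      if "acf_ideal I" for I e unfolding eq using 1(3)[OF that] 2(3)[OF that] by simp
  qed (use 1 2 in auto)
qed

lemma qf_disj: "qf_definable R \<Longrightarrow> qf_definable R' \<Longrightarrow> qf_definable (\<lambda>I e. R I e \<or> R' I e)"
  using qf_not[OF qf_conj[OF qf_not qf_not], of R R'] by simp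

lemma qf_Ball:
  "finite S \<Longrightarrow> (\<And>i. i \<in> S \<Longrightarrow> qf_definable (R i)) \<Longrightarrow> qf_definable (\<lambda>I e. \<forall>i\<in>S. R i I e)"
  by (induction S rule: finite_induct) (auto intro: qf_const qf_conj)

lemma qf_Bex:
  "finite S \<Longrightarrow> (\<And>i. i \<in> S \<Longrightarrow> qf_definable (R i)) \<Longrightarrow> qf_definable (\<lambda>I e. \<exists>i\<in>S. R i I e)"
  by (induction S rule: finite_induct) (auto intro: qf_const qf_disj)

lemma qf_if:
  assumes "qf_definable P" "qf_definable Q" "qf_definable R"
    and "\<And>I e. acf_ideal I \<Longrightarrow> P I e \<Longrightarrow> S I e \<longleftrightarrow> Q I e"
    and "\<And>I e. acf_ideal I \<Longrightarrow> \<not> P I e \<Longrightarrow> S I e \<longleftrightarrow> R I e"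
  shows "qf_definable S"
  by (rule qf_cong[OF qf_disj[OF qf_conj[OF assms(1,2)] qf_conj[OF qf_not[OF assms(1)] assms(3)]]])
     (use assms(4,5) in blast)

lemma qf_coeffs:
  assumes "poly_term n p"
  shows "qf_definable (\<lambda>I e. \<exists>j. coeff (p e) j \<notin> I)"
proof (rule qf_cong[OF qf_Bex[of "{..n}" "\<lambda>j I e. coeff (p e) j \<notin> I"]])
  show "qf_definable (\<lambda>I e. coeff (p e) i \<notin> I)" for i
    using assms by (auto simp: poly_term_def intro!: qf_not qf_term)
  show "(\<exists>j. coeff (p e) j \<notin> I) \<longleftrightarrow> (\<exists>j\<in>{..n}. coeff (p e) j \<notin> I)" if "acf_ideal I" for I e
  proof -
    have "coeff (p e) j \<in> I" if "j > n" for j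
      using assms that acf_ideal.zero_mem[OF \<open>acf_ideal I\<close>]
      by (metis coeff_eq_0 le_less_trans poly_term_def)
    then show ?thesis by (metis atMost_iff not_le)
  qed
qed auto

text \<open>One step of pseudo-division of \<open>h\<close>, of formal degree \<open>N\<close>, by \<open>f\<close>, of formal degree \<open>n\<close>.\<close>

definition pseudo_step :: "nat \<Rightarrow> 'a::idom poly \<Rightarrow> nat \<Rightarrow> 'a poly \<Rightarrow> 'a poly" where
  "pseudo_step n f N h = Polynomial.smult (coeff f n) h - monom (coeff h N) (N - n) * f"

lemma poly_term_pseudo_step:
  assumes f: "poly_term n f" and h: "poly_term N h" and "n \<le> N" "N > 0"
  shows "poly_term (N - 1) (\<lambda>e. pseudo_step n (f e) N (h e))"
  unfolding poly_term_def
proof (intro conjI allI)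
  fix e
  have deg: "degree (pseudo_step n (f e) N (h e)) \<le> N"
    unfolding pseudo_step_def using f h \<open>n \<le> N\<close>
    by (intro degree_diff_le order_trans[OF degree_smult_le] order_trans[OF degree_mult_le])
       (auto simp: poly_term_def intro!: order_trans[OF add_mono[OF degree_monom_le, of _ n]])
  have "coeff (monom (coeff (h e) N) (N - n) * f e) N = coeff (h e) N * coeff (f e) n"
    using \<open>n \<le> N\<close> by (simp add: coeff_monom_mult)
  then have "coeff (pseudo_step n (f e) N (h e)) N = 0"
    by (simp add: pseudo_step_def mult.commute)
  with deg show "degree (pseudo_step n (f e) N (h e)) \<le> N - 1"
    by (intro degree_le) (metis One_nat_def Suc_pred assms(4) coeff_eq_0 le_less_trans less_antisym not_less_eq order_le_less)
next
  fix j
  have "integral_term (\<lambda>e. coeff (f e) n * coeff (h e) j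
          - (if N - n \<le> j then coeff (h e) N * coeff (f e) (j - (N - n)) else 0))"
    using f h by (cases "N - n \<le> j") (auto simp: poly_term_def intro!: term_diff term_mult term_zero)
  then show "integral_term (\<lambda>e. coeff (pseudo_step n (f e) N (h e)) j)"
    by (cases "N - n \<le> j") (auto simp: pseudo_step_def coeff_monom_mult)
qed

lemma poly_pseudo_step:
  "poly (pseudo_step n f N h) x = coeff f n * poly h x - coeff h N * x ^ (N - n) * poly f x"
  by (simp add: pseudo_step_def poly_monom)

text \<open>The exponent \<open>k\<close> is governed by the formal degrees alone, so one
  \<open>R\<close> serves all assignments; only the quotient is chosen for each
  \<open>e\<close>.\<close>

lemma pseudo_remainder:
  assumes "poly_term N h" "poly_term n f" "n > 0"
  shows "\<exists>R k. poly_term (n - 1) R \<and> (\<forall>e. \<exists>Q. Polynomial.smult (coeff (f e) n ^ k) (h e) = f e * Q + R e)"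
  using assms
proof (induction N arbitrary: h)
  case 0
  then have "poly_term (n - 1) h" by (auto elim: poly_term_mono)
  then show ?case by (intro exI[of _ h] exI[of _ 0]) (auto intro!: exI[of _ 0])
next
  case (Suc N)
  show ?case
  proof (cases "n \<le> Suc N")
    case False
    then have "poly_term (n - 1) h" using Suc.prems by (auto elim: poly_term_mono)
    then show ?thesis by (intro exI[of _ h] exI[of _ 0]) (auto intro!: exI[of _ 0])
  next
    case True
    define h' where "h' = (\<lambda>e. pseudo_step n (f e) (Suc N) (h e))"
    have "poly_term N h'"
      using poly_term_pseudo_step[OF Suc.prems(2,1) True] by (simp add: h'_def)
    then obtain R k where R: "poly_term (n - 1) R"
        "\<And>e. \<exists>Q. Polynomial.smult (coeff (f e) n ^ k) (h' e) = f e * Q + R e"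
      using Suc.IH Suc.prems by meson
    have "\<exists>Q. Polynomial.smult (coeff (f e) n ^ Suc k) (h e) = f e * Q + R e" for e
    proof -
      obtain Q where Q: "Polynomial.smult (coeff (f e) n ^ k) (h' e) = f e * Q + R e" using R by blast
      have "Polynomial.smult (coeff (f e) n ^ Suc k) (h e)
        = Polynomial.smult (coeff (f e) n ^ k) (h' e) + f e * Polynomial.smult (coeff (f e) n ^ k) (monom (coeff (h e) (Suc N)) (Suc N - n))"
        by (simp add: h'_def pseudo_step_def smult_diff_right mult.commute)
      also have "\<dots> = f e * (Q + Polynomial.smult (coeff (f e) n ^ k) (monom (coeff (h e) (Suc N)) (Suc N - n))) + R e"
        by (simp add: Q algebra_simps)
      finally show ?thesis by blast
    qed
    with R(1) show ?thesis by blast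
  qed
qed

text \<open>With the leading coefficient outside \<open>I\<close>,
  \<open>exists_root_nonroot_iff\<close> turns solvability into the condition that the
  pseudo-remainder of \<open>g ^ n\<close> by \<open>f\<close> is nonzero modulo
  \<open>I\<close>.\<close>

lemma qf_ex_single:
  assumes f: "poly_term n f" and g: "poly_term m g"
  shows "qf_definable (\<lambda>I e. coeff (f e) n \<notin> I \<and> (\<exists>x. poly (f e) x \<in> I \<and> poly (g e) x \<notin> I))"
proof (cases "n = 0")
  case True
  show ?thesis
  proof (rule qf_cong[OF qf_const[of False]])
    fix I e
    have "poly (f e) x = coeff (f e) n" for x using poly_poly_term_0 f True by blast
    then show "coeff (f e) n \<notin> I \<and> (\<exists>x. poly (f e) x \<in> I \<and> poly (g e) x \<notin> I) \<longleftrightarrow> False" by auto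
  qed
next
  case False
  obtain R k where R: "poly_term (n - 1) R"
      "\<And>e. \<exists>Q. Polynomial.smult (coeff (f e) n ^ k) (g e ^ n) = f e * Q + R e"
    using pseudo_remainder[OF poly_term_power[OF g] f, of n] False by auto
  have "qf_definable (\<lambda>I e. coeff (f e) n \<notin> I \<and> (\<exists>j. coeff (R e) j \<notin> I))"
    using f R by (intro qf_conj qf_not qf_term qf_coeffs[of "n - 1"]) (auto simp: poly_term_def)
  then show ?thesis
  proof (rule qf_cong, goal_cases)
    case (1 I e)
    interpret acf_ideal I by fact
    obtain Q where "Polynomial.smult (coeff (f e) n ^ k) (g e ^ n) = f e * Q + R e" using R by blast
    moreover have "degree (R e) < n" "degree (f e) \<le> n"
      using f R(1) False by (auto simp: poly_term_def dest: spec[of _ e])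
    ultimately show ?case using exists_root_nonroot_iff[of "f e" n k "g e" Q "R e"] False by blast
  qed
qed

lemma poly_term_truncate:
  assumes "poly_term (Suc n) f" shows "poly_term n (\<lambda>e. f e - monom (coeff (f e) (Suc n)) (Suc n))"
  unfolding poly_term_def
proof (intro conjI allI)
  show "degree (f e - monom (coeff (f e) (Suc n)) (Suc n)) \<le> n" for e
    using assms by (intro degree_le) (auto simp: poly_term_def coeff_monom intro!: coeff_eq_0 elim!: allE[of _ e])
  show "integral_term (\<lambda>e. coeff (f e - monom (coeff (f e) (Suc n)) (Suc n)) j)" for j
    using assms by (cases "j = Suc n") (auto simp: poly_term_def coeff_monom intro: term_zero)
qed

text \<open>Euclid's algorithm with case distinctions on leading coefficients, by induction on the
  sum of the formal degrees plus one each. It ends with a single equation, or with none; then, the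
  residue field being infinite, the condition is that \<open>g\<close> is nonzero modulo
  \<open>I\<close>.\<close>

lemma qf_ex_system:
  fixes g :: "('i \<Rightarrow> 'a::idom) \<Rightarrow> 'a poly"
  assumes "\<And>f n. (f, n) \<in> set fs \<Longrightarrow> poly_term n f" and g: "poly_term m g"
  shows "qf_definable (\<lambda>I e. \<exists>x. (\<forall>(f, n) \<in> set fs. poly (f e) x \<in> I) \<and> poly (g e) x \<notin> I)"
  (is "qf_definable (?S fs)")
  using assms(1)
proof (induction "\<Sum>(f, n)\<leftarrow>fs. Suc n" arbitrary: fs rule: less_induct)
  case less
  \<comment> \<open>A vanishing leading coefficient allows truncation, or removal of the equation if
    \<open>n\<close> is 0, and the system gets smaller. Only the case \<open>rec\<close> of a
    nonvanishing one remains.\<close>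
  have drop_lead: "qf_definable (?S fs)"
    if fs: "set fs = set ((f, n) # rest)" and len: "(\<Sum>(f, n)\<leftarrow>fs. Suc n) = Suc n + (\<Sum>(f, n)\<leftarrow>rest. Suc n)"
     and rec: "qf_definable (\<lambda>I e. coeff (f e) n \<notin> I \<and> ?S fs I e)"
   for f n rest
  proof (cases n)
    case 0
    have f: "poly_term n f" using less.prems fs by auto
    have Q: "qf_definable (?S rest)"
      by (rule less.hyps) (use less.prems fs len 0 in auto)
    have P: "qf_definable (\<lambda>I e. coeff (f e) n \<in> I)" using f by (auto intro: qf_term simp: poly_term_def)
    show ?thesis
    proof (rule qf_if[OF P Q rec], goal_cases)
      case (1 I e)
      have "poly (f e) x = coeff (f e) n" for x using poly_poly_term_0 f 0 by blast
      then show ?case using 1 fs by auto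
    qed auto
  next
    case (Suc n')
    have f: "poly_term n f" using less.prems fs by auto
    define f' where "f' = (\<lambda>e. f e - monom (coeff (f e) n) n)"
    have f': "poly_term n' f'" using poly_term_truncate f Suc by (auto simp: f'_def)
    have Q: "qf_definable (?S ((f', n') # rest))"
      by (rule less.hyps) (use less.prems fs len Suc f' in auto)
    have P: "qf_definable (\<lambda>I e. coeff (f e) n \<in> I)" using f by (auto intro: qf_term simp: poly_term_def)
    show ?thesis
    proof (rule qf_if[OF P Q rec], goal_cases)
      case (1 I e)
      interpret acf_ideal I by fact
      have "poly (f e) x - poly (f' e) x = coeff (f e) n * x ^ n" for x
        by (simp add: f'_def poly_monom)
      then have "poly (f e) x \<in> I \<longleftrightarrow> poly (f' e) x \<in> I" for x
        using 1 by (intro mem_cong) (auto intro: mult_mem_right)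
      then show ?case using fs by auto
    qed auto
  qed
  \<comment> \<open>At the roots of \<open>f\<close>, a pseudo-division step multiplies the value of
    \<open>f'\<close> by the nonvanishing leading coefficient of \<open>f\<close>. So
    \<open>f'\<close> may be replaced by a polynomial of smaller formal degree.\<close>
  have two: "qf_definable (\<lambda>I e. coeff (f e) n \<notin> I \<and> ?S fs I e)"
    if fs: "set fs = set ((f, n) # (f', n') # rest)"
     and len: "(\<Sum>(f, n)\<leftarrow>fs. Suc n) = Suc n + Suc n' + (\<Sum>(f, n)\<leftarrow>rest. Suc n)"
     and le: "n \<le> n'" for f n f' n' rest
  proof (cases "n' = 0")
    case True
    then have n: "n = 0" using le by simp
    have f: "poly_term n f" using less.prems fs by auto
    show ?thesis
    proof (rule qf_cong[OF qf_const[of False]])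
      fix I e
      have "poly (f e) x = coeff (f e) n" for x using poly_poly_term_0 f n by blast
      then show "coeff (f e) n \<notin> I \<and> ?S fs I e \<longleftrightarrow> False"
        using fs by auto
    qed
  next
    case False
    have f: "poly_term n f" and f': "poly_term n' f'" using less.prems fs by auto
    define h where "h = (\<lambda>e. pseudo_step n (f e) n' (f' e))"
    have h: "poly_term (n' - 1) h" using poly_term_pseudo_step[OF f f' le] False by (simp add: h_def)
    have "qf_definable (\<lambda>I e. coeff (f e) n \<notin> I \<and> ?S ((f, n) # (h, n' - 1) # rest) I e)"
    proof (intro qf_conj qf_not qf_term less.hyps)
      show "integral_term (\<lambda>e. coeff (f e) n)" using f by (auto simp: poly_term_def)
    qed (use less.prems fs len False h in auto)
    then show ?thesis
    proof (rule qf_cong, goal_cases)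
      case (1 I e)
      interpret acf_ideal I by fact
      have "poly (h e) x \<in> I \<longleftrightarrow> poly (f' e) x \<in> I" if "coeff (f e) n \<notin> I" "poly (f e) x \<in> I" for x
      proof -
        have "poly (h e) x - coeff (f e) n * poly (f' e) x \<in> I"
          unfolding h_def poly_pseudo_step using that by (auto intro: uminus_mem mult_mem)
        from mem_cong[OF this] show ?thesis using that by (simp add: mult_mem_iff)
      qed
      then show ?case using fs by auto
    qed
  qed
  consider "fs = []" | f n where "fs = [(f, n)]" | f n f' n' rest where "fs = (f, n) # (f', n') # rest"
    by (metis neq_Nil_conv surj_pair)
  then show ?case
  proof cases
    case 1
    show ?thesis
    proof (rule qf_cong[OF qf_coeffs[OF g]])
      fix I :: "'a set" and e assume "acf_ideal I"
      then interpret acf_ideal I .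
      show "?S fs I e \<longleftrightarrow> (\<exists>j. coeff (g e) j \<notin> I)"
      proof
        assume "\<exists>j. coeff (g e) j \<notin> I"
        then obtain E where "finite E" "\<And>x. poly (g e) x \<in> I \<Longrightarrow> (\<exists>z\<in>E. x - z \<in> I)"
          using root_classes[OF order_refl] by blast
        with incongruent_element[of E] show "?S fs I e"
          using 1 by auto
      qed (use poly_mem in blast)
    qed
  next
    case 2
    then have "qf_definable (\<lambda>I e. coeff (f e) n \<notin> I \<and> (\<exists>x. poly (f e) x \<in> I \<and> poly (g e) x \<notin> I))"
      using qf_ex_single[OF _ g] less.prems by auto
    then show ?thesis using 2 by (intro drop_lead[of f n "[]"]) auto
  next
    case 3
    show ?thesis
    proof (cases "n \<le> n'")
      case True
      show ?thesis
        by (rule drop_lead[of f n "(f', n') # rest"]) (use 3 True two[of f n f' n' rest] in auto)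
    next
      case False
      have "set fs = set ((f', n') # (f, n) # rest)" using 3 by auto
      then show ?thesis
        by (intro drop_lead[of f' n' "(f, n) # rest"] two[of f' n' f n rest]) (use 3 False in auto)
    qed
  qed
qed

text \<open>The values x are sorted by the exact set \<open>S\<close> of vanishing terms. As
  \<open>I\<close> is prime, all other terms are nonzero iff their product is, which gives the
  single inequation of \<open>qf_ex_system\<close>.\<close>

theorem qf_ex:
  assumes "qf_definable R"
  shows "qf_definable (\<lambda>I e. \<exists>x. R I (e(i := x)))"
proof -
  obtain T P where T: "finite T" "\<And>t. t \<in> T \<Longrightarrow> integral_term t"
    and R: "\<And>I e. acf_ideal I \<Longrightarrow> R I e = P {t \<in> T. t e \<in> I}"
    using assms by (rule qf_definableE) blast
  have "\<forall>t\<in>T. integral_term t" using T(2) by simp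
  from integral_terms_as_poly_terms[OF this, of i] obtain p d where
    pd: "\<forall>t\<in>T. \<forall>e x. t (e(i := x)) = poly (p t e) x" "\<forall>t\<in>T. poly_term (d t) (p t)"
    by (elim exE conjE)
  have p: "t (e(i := x)) = poly (p t e) x" if "t \<in> T" for t e x using pd(1) that by simp
  have d: "poly_term (d t) (p t)" if "t \<in> T" for t using pd(2) that by simp
  have "qf_definable (\<lambda>I e. \<exists>x. (\<forall>t\<in>S. poly (p t e) x \<in> I) \<and> poly (\<Prod>t\<in>T - S. p t e) x \<notin> I)"
    if S: "S \<subseteq> T" for S
  proof -
    obtain ts where ts: "set ts = S" using finite_subset[OF S T(1)] finite_list by blast
    obtain m where m: "poly_term m (\<lambda>e. \<Prod>t\<in>T - S. p t e)"
      using poly_term_prod[of "T - S" p] T(1) d by blast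
    show ?thesis
      by (rule qf_cong[OF qf_ex_system[OF _ m, of "map (\<lambda>t. (p t, d t)) ts"]])
         (use ts S d in auto)
  qed
  then have "qf_definable (\<lambda>I e. \<exists>S\<in>Pow T. P S \<and>
      (\<exists>x. (\<forall>t\<in>S. poly (p t e) x \<in> I) \<and> poly (\<Prod>t\<in>T - S. p t e) x \<notin> I))"
    using T by (intro qf_Bex qf_conj qf_const) auto
  then show ?thesis
  proof (rule qf_cong, goal_cases)
    case (1 I e)
    interpret acf_ideal I by fact
    have eq: "{t \<in> T. t (e(i := x)) \<in> I} = {t \<in> T. poly (p t e) x \<in> I}" for x
      using p by auto
    have "(\<forall>t\<in>S. poly (p t e) x \<in> I) \<and> poly (\<Prod>t\<in>T - S. p t e) x \<notin> I
       \<longleftrightarrow> {t \<in> T. t (e(i := x)) \<in> I} = S" if "S \<subseteq> T" for S x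
      unfolding eq using that T(1) by (auto simp: poly_prod prod_mem_iff)
    then have "(\<exists>S\<in>Pow T. P S \<and> (\<exists>x. (\<forall>t\<in>S. poly (p t e) x \<in> I) \<and> poly (\<Prod>t\<in>T - S. p t e) x \<notin> I))
        \<longleftrightarrow> (\<exists>S\<in>Pow T. P S \<and> (\<exists>x. {t \<in> T. t (e(i := x)) \<in> I} = S))"
      by (intro bex_cong) auto
    also have "\<dots> \<longleftrightarrow> (\<exists>x. P {t \<in> T. t (e(i := x)) \<in> I})" by auto
    finally show ?case using R[OF 1] by simp
  qed
qed

lemma qf_ex_set:
  fixes R :: "'a::idom set \<Rightarrow> ('i \<Rightarrow> 'a) \<Rightarrow> bool"
  assumes "finite J" "qf_definable R"
  shows "qf_definable (\<lambda>I e. \<exists>f. R I (override_on e f J))"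
  using assms
proof (induction J arbitrary: R rule: finite_induct)
  case (insert j J)
  have eq: "override_on e f (insert j J) = (override_on e f J)(j := f j)" for e f :: "'i \<Rightarrow> 'a"
    by (auto simp: override_on_def fun_eq_iff)
  from insert have "qf_definable (\<lambda>I e. \<exists>f x. R I ((override_on e f J)(j := x)))"
    by (intro insert.IH qf_ex)
  then show ?case
  proof (rule qf_cong)
    fix I and e :: "'i \<Rightarrow> 'a"
    show "(\<exists>f. R I (override_on e f (insert j J))) \<longleftrightarrow> (\<exists>f x. R I ((override_on e f J)(j := x)))"
    proof
      assume "\<exists>f x. R I ((override_on e f J)(j := x))"
      then obtain f x where "R I ((override_on e f J)(j := x))" by blast
      moreover have "override_on e (f(j := x)) (insert j J) = (override_on e f J)(j := x)"
        using insert.hyps by (auto simp: override_on_def fun_eq_iff)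
      ultimately show "\<exists>f. R I (override_on e f (insert j J))" by metis
    qed (auto simp: eq)
  qed
qed simp

text \<open>As a polynomial in the variable \<open>i\<close>, each term vanishes identically modulo
  \<open>I\<close> or has at most \<open>d t\<close> root classes. Outside the union of these
  classes no term changes between vanishing and not vanishing, and \<open>sum d T\<close> depends on
  neither \<open>I\<close> nor \<open>e\<close>.\<close>

theorem qf_definable_one_variable:
  assumes "qf_definable R"
  shows "\<exists>C. \<forall>I e. acf_ideal I \<longrightarrow> (\<exists>E. finite E \<and> card E \<le> C \<and>
    (\<forall>x y. (\<forall>z\<in>E. x - z \<notin> I) \<longrightarrow> (\<forall>z\<in>E. y - z \<notin> I) \<longrightarrow> R I (e(i := x)) \<longrightarrow> R I (e(i := y))))"
proof -
  obtain T P where T: "finite T" "\<And>t. t \<in> T \<Longrightarrow> integral_term t"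
    and R: "\<And>I e. acf_ideal I \<Longrightarrow> R I e = P {t \<in> T. t e \<in> I}"
    using assms by (rule qf_definableE) blast
  have "\<forall>t\<in>T. integral_term t" using T(2) by simp
  from integral_terms_as_poly_terms[OF this, of i] obtain p d where
    pd: "\<forall>t\<in>T. \<forall>e x. t (e(i := x)) = poly (p t e) x" "\<forall>t\<in>T. poly_term (d t) (p t)"
    by (elim exE conjE)
  have p: "t (e(i := x)) = poly (p t e) x" if "t \<in> T" for t e x using pd(1) that by simp
  have d: "poly_term (d t) (p t)" if "t \<in> T" for t using pd(2) that by simp
  have "\<exists>E. finite E \<and> card E \<le> sum d T \<and>
    (\<forall>x y. (\<forall>z\<in>E. x - z \<notin> I) \<longrightarrow> (\<forall>z\<in>E. y - z \<notin> I) \<longrightarrow> R I (e(i := x)) \<longrightarrow> R I (e(i := y)))"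
    if "acf_ideal I" for I e
  proof -
    interpret acf_ideal I by fact
    have "\<exists>E. finite E \<and> card E \<le> d t \<and> (\<forall>x y. (\<forall>z\<in>E. x - z \<notin> I) \<longrightarrow> (\<forall>z\<in>E. y - z \<notin> I) \<longrightarrow>
       (poly (p t e) x \<in> I \<longleftrightarrow> poly (p t e) y \<in> I))" if "t \<in> T" for t
    proof (cases "\<exists>j. coeff (p t e) j \<notin> I")
      case True
      moreover have "degree (p t e) \<le> d t" using d[OF that] by (simp add: poly_term_def)
      ultimately show ?thesis using root_classes by meson
    next
      case False
      then have "poly (p t e) x \<in> I" for x by (intro poly_mem) auto
      then show ?thesis by (intro exI[of _ "{}"]) auto
    qed
    then obtain E where E: "\<And>t. t \<in> T \<Longrightarrow> finite (E t) \<and> card (E t) \<le> d t"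
      "\<And>t x y. t \<in> T \<Longrightarrow> (\<forall>z\<in>E t. x - z \<notin> I) \<Longrightarrow> (\<forall>z\<in>E t. y - z \<notin> I) \<Longrightarrow>
       (poly (p t e) x \<in> I \<longleftrightarrow> poly (p t e) y \<in> I)"
      by metis
    show ?thesis
    proof (intro exI[of _ "\<Union>t\<in>T. E t"] conjI allI impI)
      show "finite (\<Union>t\<in>T. E t)" using T E by auto
      show "card (\<Union>t\<in>T. E t) \<le> sum d T"
        using card_UN_le[OF T(1), of E] E(1) by (meson order_trans sum_mono)
      fix x y assume xy: "\<forall>z\<in>\<Union>t\<in>T. E t. x - z \<notin> I" "\<forall>z\<in>\<Union>t\<in>T. E t. y - z \<notin> I" and Rx: "R I (e(i := x))"
      have "{t \<in> T. t (e(i := x)) \<in> I} = {t \<in> T. t (e(i := y)) \<in> I}"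
        using p E(2)[of _ x y] xy by auto
      then show "R I (e(i := y))" using Rx R[OF \<open>acf_ideal I\<close>] by simp
    qed
  qed
  then show ?thesis by blast
qed

section \<open>Counting points of rationally parametrized sets\<close>

context acf_ideal
begin

text \<open>Gaussian elimination of one equation at a time, with the pivot \<open>v x0 y\<close>
  cleared by cross-multiplication instead of division.\<close>

lemma homogeneous_system_solution:
  fixes v :: "'b \<Rightarrow> 'c \<Rightarrow> 'a"
  assumes "finite Y" "finite X" "card Y < card X"
  shows "\<exists>a. (\<exists>x\<in>X. a x \<notin> I) \<and> (\<forall>y\<in>Y. (\<Sum>x\<in>X. a x * v x y) \<in> I)"
  using assms
proof (induction Y arbitrary: X v rule: finite_induct)
  case empty
  then show ?case using one_notin
    by (intro exI[of _ "\<lambda>_. 1"]) (auto simp: card_gt_0_iff)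
next
  case (insert y Y)
  show ?case
  proof (cases "\<forall>x\<in>X. v x y \<in> I")
    case True
    have "card Y < card X" using insert by simp
    then obtain a where "\<exists>x\<in>X. a x \<notin> I" "\<forall>y\<in>Y. (\<Sum>x\<in>X. a x * v x y) \<in> I"
      using insert.IH[OF insert.prems(1)] by blast
    then show ?thesis using True by (intro exI[of _ a]) (auto intro!: sum_mem mult_mem)
  next
    case False
    then obtain x0 where x0: "x0 \<in> X" "v x0 y \<notin> I" by blast
    define X' where "X' = X - {x0}"
    have X': "finite X'" "x0 \<notin> X'" "X = insert x0 X'" "card Y < card X'"
      using insert x0 by (auto simp: X'_def)
    obtain a where a: "\<exists>x\<in>X'. a x \<notin> I"
      "\<forall>z\<in>Y. (\<Sum>x\<in>X'. a x * (v x0 y * v x z - v x y * v x0 z)) \<in> I"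
      using insert.IH[OF X'(1,4), of "\<lambda>x z. v x0 y * v x z - v x y * v x0 z"] by blast
    define b where "b = (\<lambda>x. if x = x0 then - (\<Sum>x\<in>X'. a x * v x y) else v x0 y * a x)"
    have b: "(\<Sum>x\<in>X. b x * v x z) = (\<Sum>x\<in>X'. a x * (v x0 y * v x z - v x y * v x0 z))" for z
    proof -
      have "(\<Sum>x\<in>X. b x * v x z) = b x0 * v x0 z + (\<Sum>x\<in>X'. b x * v x z)"
        unfolding X'(3) using X' by simp
      also have "(\<Sum>x\<in>X'. b x * v x z) = (\<Sum>x\<in>X'. v x0 y * a x * v x z)"
        by (intro sum.cong) (use X' in \<open>auto simp: b_def\<close>)
      also have "b x0 * v x0 z = - (\<Sum>x\<in>X'. a x * v x y * v x0 z)"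
        by (simp add: b_def sum_distrib_right)
      finally show ?thesis by (simp add: sum_subtractf algebra_simps)
    qed
    have "\<exists>x\<in>X. b x \<notin> I"
      using a(1) X' x0(2) by (auto simp: b_def mult_mem_iff)
    moreover have "(\<Sum>x\<in>X. b x * v x y) \<in> I"
      unfolding b by (simp add: mult.commute zero_mem)
    ultimately show ?thesis using a(2) b by (intro exI[of _ b]) auto
  qed
qed

end

text \<open>\<open>poly_fun I B G y d f\<close>: on \<open>B\<close>, the function \<open>f\<close> is congruent to a polynomial of total degree
  at most \<open>d\<close> in the functions \<open>y g\<close> with \<open>g \<in> G\<close>.\<close>

inductive poly_fun :: "'a::idom set \<Rightarrow> 'b set \<Rightarrow> 'g set \<Rightarrow> ('g \<Rightarrow> 'b \<Rightarrow> 'a) \<Rightarrow> nat \<Rightarrow> ('b \<Rightarrow> 'a) \<Rightarrow> bool"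
  for I B G y where
  gen: "g \<in> G \<Longrightarrow> poly_fun I B G y 1 (y g)"
| const: "poly_fun I B G y 0 (\<lambda>b. c)"
| add: "poly_fun I B G y d f \<Longrightarrow> poly_fun I B G y d h \<Longrightarrow> poly_fun I B G y d (\<lambda>b. f b + h b)"
| mult: "poly_fun I B G y d f \<Longrightarrow> poly_fun I B G y d' h \<Longrightarrow> poly_fun I B G y (d + d') (\<lambda>b. f b * h b)"
| weaken: "poly_fun I B G y d f \<Longrightarrow> d \<le> d' \<Longrightarrow> (\<And>b. b \<in> B \<Longrightarrow> h b - f b \<in> I) \<Longrightarrow> poly_fun I B G y d' h"

context acf_ideal
begin

lemma poly_fun_mono: "poly_fun I B G y d f \<Longrightarrow> d \<le> d' \<Longrightarrow> poly_fun I B G y d' f"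
  by (erule poly_fun.weaken) (auto simp: zero_mem)

lemma poly_fun_uminus: "poly_fun I B G y d f \<Longrightarrow> poly_fun I B G y d (\<lambda>b. - f b)"
  using poly_fun.mult[OF poly_fun.const[of I B G y "-1"], of d f] by simp

lemma poly_fun_diff:
  "poly_fun I B G y d f \<Longrightarrow> poly_fun I B G y d h \<Longrightarrow> poly_fun I B G y d (\<lambda>b. f b - h b)"
  using poly_fun.add[OF _ poly_fun_uminus, of B G y d f h] by simp

lemma poly_fun_sum:
  "(\<And>i. i \<in> S \<Longrightarrow> poly_fun I B G y d (f i)) \<Longrightarrow> poly_fun I B G y d (\<lambda>b. \<Sum>i\<in>S. f i b)"
  by (induction S rule: infinite_finite_induct)
     (auto intro: poly_fun.add poly_fun_mono[OF poly_fun.const])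

lemma poly_fun_prod:
  "finite S \<Longrightarrow> (\<And>i. i \<in> S \<Longrightarrow> poly_fun I B G y d (f i)) \<Longrightarrow> poly_fun I B G y (card S * d) (\<lambda>b. \<Prod>i\<in>S. f i b)"
  by (induction S rule: finite_induct) (auto intro!: poly_fun.const poly_fun.mult)

lemma poly_fun_power: "poly_fun I B G y d f \<Longrightarrow> poly_fun I B G y (n * d) (\<lambda>b. f b ^ n)"
  by (induction n) (auto intro: poly_fun.const poly_fun.mult)

definition monomial :: "'g set \<Rightarrow> ('g \<Rightarrow> 'b \<Rightarrow> 'a) \<Rightarrow> ('g \<Rightarrow> nat) \<Rightarrow> 'b \<Rightarrow> 'a" where
  "monomial G y \<alpha> b = (\<Prod>g\<in>G. y g b ^ \<alpha> g)"

text \<open>The total degree is relaxed to degree at most \<open>d\<close> in each generator, so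
  that the exponents form a box with \<open>(d + 1) ^ card G\<close> elements.\<close>

lemma poly_fun_span:
  assumes "finite G" "poly_fun I B G y d f"
  shows "\<exists>c. \<forall>b\<in>B. f b - (\<Sum>\<alpha>\<in>G \<rightarrow>\<^sub>E {..d}. c \<alpha> * monomial G y \<alpha> b) \<in> I"
  using assms(2)
proof induction
  case (gen g)
  define \<alpha>0 where "\<alpha>0 = restrict (\<lambda>h. if h = g then 1 else 0::nat) G"
  have \<alpha>0: "\<alpha>0 \<in> G \<rightarrow>\<^sub>E {..1}" by (auto simp: \<alpha>0_def)
  have pr: "monomial G y \<alpha>0 b = y g b" for b
  proof -
    have "monomial G y \<alpha>0 b = (\<Prod>h\<in>G. if h = g then y h b else 1)"
      unfolding monomial_def by (intro prod.cong) (auto simp: \<alpha>0_def)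
    then show ?thesis using assms(1) gen by simp
  qed
  show ?case
  proof (intro exI[of _ "\<lambda>\<alpha>. if \<alpha> = \<alpha>0 then 1 else 0"] ballI)
    fix b
    have "(\<Sum>\<alpha>\<in>G \<rightarrow>\<^sub>E {..1}. (if \<alpha> = \<alpha>0 then 1 else 0) * monomial G y \<alpha> b)
      = (\<Sum>\<alpha>\<in>G \<rightarrow>\<^sub>E {..1}. if \<alpha> = \<alpha>0 then y g b else 0)"
      by (intro sum.cong) (auto simp: pr)
    also have "\<dots> = y g b"
      using \<alpha>0 assms(1) by (simp add: finite_PiE)
    finally show "y g b - (\<Sum>\<alpha>\<in>G \<rightarrow>\<^sub>E {..1}. (if \<alpha> = \<alpha>0 then 1 else 0) * monomial G y \<alpha> b) \<in> I"
      by (simp add: zero_mem)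
  qed
next
  case (const c)
  have "G \<rightarrow>\<^sub>E {..0::nat} = {restrict (\<lambda>_. 0) G}"
    by (auto simp: PiE_def Pi_def extensional_def fun_eq_iff)
  then show ?case by (intro exI[of _ "\<lambda>_. c"]) (auto simp: zero_mem monomial_def)
next
  case (add d f h)
  then obtain c c' where c:
    "\<forall>b\<in>B. f b - (\<Sum>\<alpha>\<in>G \<rightarrow>\<^sub>E {..d}. c \<alpha> * monomial G y \<alpha> b) \<in> I"
    "\<forall>b\<in>B. h b - (\<Sum>\<alpha>\<in>G \<rightarrow>\<^sub>E {..d}. c' \<alpha> * monomial G y \<alpha> b) \<in> I" by blast
  show ?case
  proof (intro exI[of _ "\<lambda>\<alpha>. c \<alpha> + c' \<alpha>"] ballI)
    fix b assume "b \<in> B"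
    then show "f b + h b - (\<Sum>\<alpha>\<in>G \<rightarrow>\<^sub>E {..d}. (c \<alpha> + c' \<alpha>) * monomial G y \<alpha> b) \<in> I"
      using cong_add c by (auto simp: distrib_right sum.distrib)
  qed
next
  case (mult d f d' h)
  then obtain c c' where c:
    "\<forall>b\<in>B. f b - (\<Sum>\<alpha>\<in>G \<rightarrow>\<^sub>E {..d}. c \<alpha> * monomial G y \<alpha> b) \<in> I"
    "\<forall>b\<in>B. h b - (\<Sum>\<alpha>\<in>G \<rightarrow>\<^sub>E {..d'}. c' \<alpha> * monomial G y \<alpha> b) \<in> I" by blast
  let ?A = "G \<rightarrow>\<^sub>E {..d}" and ?A' = "G \<rightarrow>\<^sub>E {..d'}" and ?S = "G \<rightarrow>\<^sub>E {..d + d'}"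
  define pl where "pl = (\<lambda>(\<alpha>, \<alpha>'). restrict (\<lambda>g. \<alpha> g + \<alpha>' g :: nat) G)"
  have pl: "pl ` (?A \<times> ?A') \<subseteq> ?S"
    by (auto simp: pl_def PiE_def Pi_def intro!: add_mono)
  have fin: "finite ?A" "finite ?A'" "finite ?S" using assms(1) by (auto intro: finite_PiE)
  define cc where "cc = (\<lambda>\<beta>. \<Sum>x\<in>{x \<in> ?A \<times> ?A'. pl x = \<beta>}. c (fst x) * c' (snd x))"
  have "(\<Sum>\<alpha>\<in>?A. c \<alpha> * monomial G y \<alpha> b) * (\<Sum>\<alpha>\<in>?A'. c' \<alpha> * monomial G y \<alpha> b)
     = (\<Sum>\<beta>\<in>?S. cc \<beta> * monomial G y \<beta> b)" for b
  proof -
    have "(\<Sum>\<alpha>\<in>?A. c \<alpha> * monomial G y \<alpha> b) * (\<Sum>\<alpha>\<in>?A'. c' \<alpha> * monomial G y \<alpha> b)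
       = (\<Sum>x\<in>?A \<times> ?A'. c (fst x) * c' (snd x) * monomial G y (pl x) b)"
      unfolding sum_product sum.cartesian_product
      by (intro sum.cong) (auto simp: monomial_def pl_def power_add prod.distrib algebra_simps)
    also have "\<dots> = (\<Sum>\<beta>\<in>?S. \<Sum>x\<in>{x \<in> ?A \<times> ?A'. pl x = \<beta>}. c (fst x) * c' (snd x) * monomial G y (pl x) b)"
      using fin pl by (intro sum.group[symmetric]) auto
    also have "\<dots> = (\<Sum>\<beta>\<in>?S. cc \<beta> * monomial G y \<beta> b)"
      unfolding cc_def sum_distrib_right by (intro sum.cong) auto
    finally show ?thesis .
  qed
  then show ?case using c cong_mult by (intro exI[of _ cc]) (metis (no_types, lifting))
next
  case (weaken d f d' h)
  then obtain c where c:
    "\<forall>b\<in>B. f b - (\<Sum>\<alpha>\<in>G \<rightarrow>\<^sub>E {..d}. c \<alpha> * monomial G y \<alpha> b) \<in> I" by blast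
  have sub: "G \<rightarrow>\<^sub>E {..d} \<subseteq> G \<rightarrow>\<^sub>E {..d'}" using weaken by (intro PiE_mono) auto
  show ?case
  proof (intro exI[of _ "\<lambda>\<alpha>. if \<alpha> \<in> G \<rightarrow>\<^sub>E {..d} then c \<alpha> else 0"] ballI)
    fix b assume b: "b \<in> B"
    have "(\<Sum>\<alpha>\<in>G \<rightarrow>\<^sub>E {..d'}. (if \<alpha> \<in> G \<rightarrow>\<^sub>E {..d} then c \<alpha> else 0) * monomial G y \<alpha> b)
      = (\<Sum>\<alpha>\<in>G \<rightarrow>\<^sub>E {..d}. c \<alpha> * monomial G y \<alpha> b)"
      using sub assms(1) by (intro sum.mono_neutral_cong_right) (auto intro: finite_PiE)
    then show "h b - (\<Sum>\<alpha>\<in>G \<rightarrow>\<^sub>E {..d'}. (if \<alpha> \<in> G \<rightarrow>\<^sub>E {..d} then c \<alpha> else 0) * monomial G y \<alpha> b) \<in> I"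
      using diff_mem_trans[OF weaken.hyps(3)[OF b] bspec[OF c b]] by (simp only:)
  qed
qed

text \<open>If \<open>B\<close> had more points than there are monomials, some nontrivial
  combination of the evaluations at these points would kill all monomials, hence all polynomial
  functions of degree \<open>d\<close>. The function separating a point of nonzero weight
  contradicts this.\<close>

lemma card_le_of_separating:
  assumes "finite G" "finite B"
    and sep: "\<And>b. b \<in> B \<Longrightarrow> \<exists>f. poly_fun I B G y d f \<and> f b \<notin> I \<and> (\<forall>b'\<in>B - {b}. f b' \<in> I)"
  shows "card B \<le> (d + 1) ^ card G"
proof (rule ccontr)
  assume "\<not> card B \<le> (d + 1) ^ card G"
  then have "card (G \<rightarrow>\<^sub>E {..d}) < card B" using assms(1) by (simp add: card_PiE)
  then obtain a where a: "\<exists>b\<in>B. a b \<notin> I"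
     "\<And>\<alpha>. \<alpha> \<in> G \<rightarrow>\<^sub>E {..d} \<Longrightarrow> (\<Sum>b\<in>B. a b * monomial G y \<alpha> b) \<in> I"
    using homogeneous_system_solution[of "G \<rightarrow>\<^sub>E {..d}" B "\<lambda>b \<alpha>. monomial G y \<alpha> b"]
      assms(1,2) by (auto simp: finite_PiE)
  then obtain b where b: "b \<in> B" "a b \<notin> I" by blast
  obtain f where f: "poly_fun I B G y d f" "f b \<notin> I" "\<And>b'. b' \<in> B - {b} \<Longrightarrow> f b' \<in> I"
    using sep[OF b(1)] by blast
  obtain c where c: "\<And>b. b \<in> B \<Longrightarrow> f b - (\<Sum>\<alpha>\<in>G \<rightarrow>\<^sub>E {..d}. c \<alpha> * monomial G y \<alpha> b) \<in> I"
    using poly_fun_span[OF assms(1) f(1)] by blast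
  have "(\<Sum>b\<in>B. a b * f b) - (\<Sum>b\<in>B. a b * (\<Sum>\<alpha>\<in>G \<rightarrow>\<^sub>E {..d}. c \<alpha> * monomial G y \<alpha> b)) \<in> I"
    by (intro cong_sum cong_mult c) (simp_all add: zero_mem)
  also have "(\<Sum>b\<in>B. a b * (\<Sum>\<alpha>\<in>G \<rightarrow>\<^sub>E {..d}. c \<alpha> * monomial G y \<alpha> b))
     = (\<Sum>\<alpha>\<in>G \<rightarrow>\<^sub>E {..d}. c \<alpha> * (\<Sum>b\<in>B. a b * monomial G y \<alpha> b))"
    unfolding sum_distrib_left by (subst sum.swap) (simp add: mult.left_commute)
  finally have "(\<Sum>b\<in>B. a b * f b) \<in> I \<longleftrightarrow> (\<Sum>\<alpha>\<in>G \<rightarrow>\<^sub>E {..d}. c \<alpha> * (\<Sum>b\<in>B. a b * monomial G y \<alpha> b)) \<in> I"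
    by (rule mem_cong)
  moreover have "(\<Sum>\<alpha>\<in>G \<rightarrow>\<^sub>E {..d}. c \<alpha> * (\<Sum>b\<in>B. a b * monomial G y \<alpha> b)) \<in> I"
    by (intro sum_mem mult_mem a(2))
  ultimately have "(\<Sum>b\<in>B. a b * f b) \<in> I" by simp
  moreover have "(\<Sum>b\<in>B. a b * f b) = a b * f b + (\<Sum>b'\<in>B - {b}. a b' * f b')"
    using b assms(2) by (simp add: sum.remove)
  moreover have "(\<Sum>b'\<in>B - {b}. a b' * f b') \<in> I" by (intro sum_mem mult_mem f(3))
  ultimately have "a b * f b \<in> I" using diff_mem by (metis add_diff_cancel_right')
  then show False using b f by (simp add: mult_mem_iff)
qed

end

text \<open>\<open>F\<close> is a system of representatives of a subfield with \<open>q\<close> elements of the residue field.\<close>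

locale finite_subfield = acf_ideal I for I :: "'a::idom set" +
  fixes F :: "'a set" and q :: nat
  assumes F_finite: "finite F" and F_card: "card F = q" and q_gt_1: "q > 1"
    and F_incong: "x \<in> F \<Longrightarrow> y \<in> F \<Longrightarrow> x - y \<in> I \<Longrightarrow> x = y"
    and F_root: "x \<in> F \<Longrightarrow> x ^ q - x \<in> I"
    and frobenius_add: "(x + y) ^ q - (x ^ q + y ^ q) \<in> I"
begin

text \<open>\<open>F\<close> is only a system of representatives and need not be closed under
  addition; the set of all elements fixed by the Frobenius map modulo \<open>I\<close> is.\<close>

definition Fq :: "'a set" where "Fq = {a. a ^ q - a \<in> I}"

lemma F_subset_Fq: "F \<subseteq> Fq"
  by (auto simp: Fq_def F_root)

lemma Fq_zero: "0 \<in> Fq" and Fq_one: "1 \<in> Fq"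
  using q_gt_1 by (auto simp: Fq_def zero_power zero_mem)

lemma Fq_add: "x \<in> Fq \<Longrightarrow> y \<in> Fq \<Longrightarrow> x + y \<in> Fq"
  using diff_mem_trans[OF frobenius_add cong_add] by (simp add: Fq_def)

lemma Fq_mult: "x \<in> Fq \<Longrightarrow> y \<in> Fq \<Longrightarrow> x * y \<in> Fq"
  using cong_mult by (simp add: Fq_def power_mult_distrib)

lemma Fq_uminus: "y \<in> Fq \<Longrightarrow> - y \<in> Fq"
proof -
  assume y: "y \<in> Fq"
  have "- (y ^ q + (- y) ^ q) \<in> I" using frobenius_add[of y "- y"] q_gt_1 by (simp add: zero_power)
  moreover have "y ^ q - y \<in> I" using y by (simp add: Fq_def)
  ultimately have "- (- (y ^ q + (- y) ^ q)) - (y ^ q - y) \<in> I" using uminus_mem diff_mem by blast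
  also have "- (- (y ^ q + (- y) ^ q)) - (y ^ q - y) = (- y) ^ q - (- y)" by simp
  finally show ?thesis by (simp add: Fq_def)
qed

lemma Fq_diff: "x \<in> Fq \<Longrightarrow> y \<in> Fq \<Longrightarrow> x - y \<in> Fq"
  using Fq_add[OF _ Fq_uminus, of x y] by simp

lemma Fq_sum: "(\<And>i. i \<in> S \<Longrightarrow> f i \<in> Fq) \<Longrightarrow> sum f S \<in> Fq"
  by (induction S rule: infinite_finite_induct) (auto intro: Fq_zero Fq_add)

lemma Fq_power: "x \<in> Fq \<Longrightarrow> x ^ n \<in> Fq"
  by (induction n) (auto intro: Fq_one Fq_mult)

lemma F_frob: "x \<in> F \<Longrightarrow> y \<in> F \<Longrightarrow> (x - y) ^ q - (x - y) \<in> I"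
  using Fq_diff F_subset_Fq by (auto simp: Fq_def)

text \<open>A class missing from \<open>F\<close> would give X^q - X more than q incongruent
  roots.\<close>

lemma Fq_representative:
  assumes "a \<in> Fq" shows "\<exists>x\<in>F. a - x \<in> I"
proof (rule ccontr)
  assume neg: "\<not> ?thesis"
  define f where "f = monom 1 q - [:0, 1::'a:]"
  have deg: "degree f \<le> q" unfolding f_def using q_gt_1
    by (intro degree_diff_le degree_monom_le) auto
  have "a \<notin> F" using neg zero_mem by force
  then have card: "card (insert a F) = q + 1" using F_finite F_card by simp
  have "coeff f q \<in> I"
  proof (rule coeffs_mem_of_roots[of f "insert a F"])
    show "poly f x \<in> I" if "x \<in> insert a F" for x
      using that assms F_root by (auto simp: f_def poly_monom Fq_def)
    show "x = y" if "x \<in> insert a F" "y \<in> insert a F" "x - y \<in> I" for x y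
      using that neg F_incong diff_mem_commute by blast
  qed (use deg card in simp)
  then show False using q_gt_1 one_notin by (auto simp: f_def coeff_pCons split: nat.splits)
qed

text \<open>Every function on \<open>B\<close> is a polynomial of degree at most \<open>q - 1\<close> in each coordinate; multiplied by a
  power of \<open>\<delta>\<close> it becomes a polynomial in the generators, so \<open>card B\<close> is at most the number of
  monomials.\<close>

lemma card_le_of_rational_parametrization:
  assumes "finite G" "finite J" "B \<subseteq> J \<rightarrow>\<^sub>E F"
    and \<delta>: "\<And>b. b \<in> B \<Longrightarrow> \<delta> b \<notin> I" "poly_fun I B G y e \<delta>"
    and coord: "\<And>j. j \<in> J \<Longrightarrow> poly_fun I B G y e (\<lambda>b. \<delta> b * b j)"
  shows "card B \<le> (card J * ((q - 1) * e) + 1) ^ card G"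
proof (rule card_le_of_separating)
  show "finite B" using assms(2,3) F_finite by (meson finite_PiE finite_subset)
  fix b0 assume b0: "b0 \<in> B"
  \<comment> \<open>As z^(q - 1) is 1 for nonzero z in the finite field, the factor of
    \<open>j\<close> is congruent to \<open>\<delta> b ^ (q - 1)\<close> if
    \<open>b j = b0 j\<close> and to 0 otherwise. The scaling by \<open>\<delta>\<close> makes it
    polynomial in the generators.\<close>
  define f where "f = (\<lambda>b. \<Prod>j\<in>J. \<delta> b ^ (q - 1) - (\<delta> b * b j - \<delta> b * b0 j) ^ (q - 1))"
  have "poly_fun I B G y (0 + e) (\<lambda>b. b0 j * \<delta> b)" for j
    by (intro poly_fun.mult poly_fun.const \<delta>)
  then have "poly_fun I B G y (card J * ((q - 1) * e)) f"
    unfolding f_def using assms(2) \<delta>(2) coord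
    by (intro poly_fun_prod poly_fun_diff poly_fun_power) (auto simp: mult.commute)
  moreover have "f b0 \<notin> I"
    using \<delta>(1)[OF b0] q_gt_1 assms(2) by (auto simp: f_def prod_mem_iff zero_power dest: power_mem)
  moreover have "f b \<in> I" if "b \<in> B - {b0}" for b
  proof -
    have "b \<in> J \<rightarrow>\<^sub>E F" "b0 \<in> J \<rightarrow>\<^sub>E F" using that b0 assms(3) by auto
    moreover have "b \<noteq> b0" using that by auto
    ultimately obtain j where j: "j \<in> J" "b j \<noteq> b0 j" "b j \<in> F" "b0 j \<in> F"
      by (metis PiE_ext PiE_mem)
    define z where "z = b j - b0 j"
    have z: "z \<notin> I" using F_incong j by (auto simp: z_def)
    have "z ^ q = z * z ^ (q - 1)" using q_gt_1 by (cases q) auto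
    then have "z * (z ^ (q - 1) - 1) \<in> I" using F_frob[of "b j" "b0 j"] j
      by (simp add: right_diff_distrib flip: z_def)
    with z have "z ^ (q - 1) - 1 \<in> I" by (simp add: mult_mem_iff)
    moreover have "\<delta> b ^ (q - 1) - (\<delta> b * b j - \<delta> b * b0 j) ^ (q - 1) = - (\<delta> b ^ (q - 1) * (z ^ (q - 1) - 1))"
      by (simp add: z_def right_diff_distrib flip: power_mult_distrib)
    ultimately have "\<delta> b ^ (q - 1) - (\<delta> b * b j - \<delta> b * b0 j) ^ (q - 1) \<in> I"
      by (auto intro: uminus_mem mult_mem simp del: mult_eq_0_iff)
    then show ?thesis using j(1) assms(2) by (auto simp: f_def prod_mem_iff)
  qed
  ultimately show "\<exists>f. poly_fun I B G y (card J * ((q - 1) * e)) f \<and> f b0 \<notin> I \<and> (\<forall>b'\<in>B - {b0}. f b' \<in> I)"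
    by blast
qed (use assms in auto)

end

section \<open>Algebraic integers and finite fields\<close>

inductive_set int_span :: "complex set \<Rightarrow> complex set" for S where
  span_zero: "0 \<in> int_span S"
| span_base: "s \<in> S \<Longrightarrow> s \<in> int_span S"
| span_add: "x \<in> int_span S \<Longrightarrow> y \<in> int_span S \<Longrightarrow> x + y \<in> int_span S"
| span_uminus: "x \<in> int_span S \<Longrightarrow> - x \<in> int_span S"

lemma int_span_mult:
  assumes "z \<in> int_span S" "\<And>s. s \<in> S \<Longrightarrow> a * s \<in> int_span T"
  shows "a * z \<in> int_span T"
  using assms(1) by induction (use assms(2) in \<open>auto intro: int_span.intros simp: distrib_left\<close>)

lemma int_span_sum: "(\<And>i. i \<in> A \<Longrightarrow> f i \<in> int_span S) \<Longrightarrow> sum f A \<in> int_span S"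
  by (induction A rule: infinite_finite_induct) (auto intro: int_span.intros)

lemma int_span_coeffs:
  assumes "finite S" "z \<in> int_span S"
  shows "\<exists>c. z = (\<Sum>s\<in>S. of_int (c s) * s)"
  using assms(2)
proof induction
  case span_zero
  show ?case by (intro exI[of _ "\<lambda>_. 0"]) simp
next
  case (span_base s)
  have "(\<Sum>t\<in>S. of_int (if t = s then 1 else 0) * t) = (\<Sum>t\<in>S. if t = s then s else 0)"
    by (intro sum.cong) auto
  then show ?case using assms(1) span_base by (intro exI[of _ "\<lambda>t. if t = s then 1 else 0"]) simp
next
  case (span_add x y)
  then obtain c d where "x = (\<Sum>s\<in>S. of_int (c s) * s)" "y = (\<Sum>s\<in>S. of_int (d s) * s)" by blast
  then show ?case by (intro exI[of _ "\<lambda>s. c s + d s"]) (simp add: sum.distrib distrib_right)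
next
  case (span_uminus x)
  then obtain c where "x = (\<Sum>s\<in>S. of_int (c s) * s)" by blast
  then show ?case by (intro exI[of _ "\<lambda>s. - c s"]) (simp add: sum_negf)
qed

text \<open>The numbers whose multiplication preserves the module spanned by \<open>S\<close>. For
  finite \<open>S\<close> containing 1 they are algebraic integers, so placing two numbers in one
  such ring settles their sum and product.\<close>

definition multiplier_ring :: "complex set \<Rightarrow> complex set" where
  "multiplier_ring S = {x. \<forall>s\<in>S. x * s \<in> int_span S}"

lemma multiplier_ring_add: "x \<in> multiplier_ring S \<Longrightarrow> y \<in> multiplier_ring S \<Longrightarrow> x + y \<in> multiplier_ring S"
  by (auto simp: multiplier_ring_def distrib_right intro: span_add)

lemma multiplier_ring_uminus: "x \<in> multiplier_ring S \<Longrightarrow> - x \<in> multiplier_ring S"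
  by (auto simp: multiplier_ring_def intro: span_uminus)

lemma multiplier_ring_mult: "x \<in> multiplier_ring S \<Longrightarrow> y \<in> multiplier_ring S \<Longrightarrow> x * y \<in> multiplier_ring S"
  by (auto simp: multiplier_ring_def mult.assoc intro: int_span_mult)

lemma multiplier_ring_of_nat: "of_nat n \<in> multiplier_ring S"
  by (induction n)
    (auto simp: multiplier_ring_def distrib_right intro: int_span.intros)

lemma multiplier_ring_of_int: "of_int n \<in> multiplier_ring S"
  by (cases n rule: int_cases2) (auto intro: multiplier_ring_of_nat multiplier_ring_uminus)

text \<open>An element of a multiplier ring is an eigenvalue of an integer matrix.\<close>

lemma algebraic_int_multiplier_ring:
  assumes "finite S" "1 \<in> S" "x \<in> multiplier_ring S"
  shows "algebraic_int x"
proof -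
  obtain ss where ss: "set ss = S" "distinct ss" using finite_distinct_list[OF assms(1)] by blast
  define n where "n = length ss"
  have "\<forall>s\<in>S. \<exists>c. x * s = (\<Sum>t\<in>S. of_int (c t) * t)"
    using int_span_coeffs[OF assms(1)] assms(3) by (auto simp: multiplier_ring_def)
  from bchoice[OF this] obtain c where c: "\<And>s. s \<in> S \<Longrightarrow> x * s = (\<Sum>t\<in>S. of_int (c s t) * t)" by blast
  define Z where "Z = mat n n (\<lambda>(i, j). c (ss ! i) (ss ! j))"
  define v where "v = vec n (\<lambda>i. ss ! i)"
  have Z: "Z \<in> carrier_mat n n" by (simp add: Z_def)
  have v: "v \<in> carrier_vec n" by (simp add: v_def)
  obtain i0 where i0: "i0 < n" "ss ! i0 = 1" using assms(2) ss n_def by (metis in_set_conv_nth)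
  have "v \<noteq> 0\<^sub>v n"
  proof
    assume "v = 0\<^sub>v n"
    then have "v $ i0 = 0" using i0 by simp
    then show False using i0 by (simp add: v_def)
  qed
  moreover have "map_mat of_int Z *\<^sub>v v = x \<cdot>\<^sub>v v"
  proof (rule eq_vecI)
    fix i assume i: "i < dim_vec (x \<cdot>\<^sub>v v)"
    then have i: "i < n" by (simp add: v_def)
    have "(map_mat of_int Z *\<^sub>v v) $ i = (\<Sum>j<n. of_int (c (ss ! i) (ss ! j)) * ss ! j)"
      using i by (simp add: Z_def v_def scalar_prod_def lessThan_atLeast0)
    also have "\<dots> = (\<Sum>t\<in>S. of_int (c (ss ! i) t) * t)"
      using bij_betw_nth[OF ss(2), of "{..<n}" S] ss(1) n_def by (intro sum.reindex_bij_betw) auto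
    also have "\<dots> = x * ss ! i" using c[of "ss ! i"] i ss n_def by auto
    finally show "(map_mat of_int Z *\<^sub>v v) $ i = (x \<cdot>\<^sub>v v) $ i" using i by (simp add: v_def)
  qed (simp add: Z_def v_def)
  ultimately have "eigenvalue (map_mat of_int Z) x"
    unfolding eigenvalue_def eigenvector_def using v Z by auto
  then have "poly (char_poly (map_mat of_int Z)) x = 0"
    using eigenvalue_root_char_poly[of "map_mat of_int Z" n x] Z by simp
  then have "poly (map_poly of_int (char_poly Z)) x = 0"
    by (simp add: of_int_hom.char_poly_hom[OF Z])
  moreover have "lead_coeff (char_poly Z) = 1" using degree_monic_char_poly[OF Z] by simp
  ultimately show ?thesis unfolding algebraic_int_altdef_ipoly by blast
qed

text \<open>The new module is spanned by the products of \<open>S\<close> with 1, x, ..., x^(n - 1),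
  where n is the degree of \<open>p\<close>. Multiplication by \<open>x\<close> preserves it, since
  \<open>p\<close> expresses x^n by lower powers with coefficients that act on the old
  module.\<close>

lemma multiplier_ring_extend:
  assumes S: "finite S" "1 \<in> S" and p: "lead_coeff p = 1" "poly p x = 0"
    and coeffs: "\<And>i. coeff p i \<in> multiplier_ring S"
  shows "\<exists>S'. finite S' \<and> 1 \<in> S' \<and> multiplier_ring S \<subseteq> multiplier_ring S' \<and> x \<in> multiplier_ring S'"
proof -
  define n where "n = degree p"
  have n: "n > 0"
  proof (rule ccontr)
    assume "\<not> n > 0"
    then have "p = 1" using p(1) by (metis degree_0_id n_def neq0_conv one_pCons)
    with p show False by simp
  qed
  define S' where "S' = (\<lambda>(j, s). x ^ j * s) ` ({..<n} \<times> S)"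
  have S': "x ^ j * s \<in> S'" if "j < n" "s \<in> S" for j s using that by (auto simp: S'_def)
  have span: "x ^ j * z \<in> int_span S'" if "j < n" "z \<in> int_span S" for j z
    by (rule int_span_mult[OF that(2)]) (intro span_base S' that(1))
  have "multiplier_ring S \<subseteq> multiplier_ring S'"
  proof
    fix y assume y: "y \<in> multiplier_ring S"
    have "y * (x ^ j * s) \<in> int_span S'" if "j < n" "s \<in> S" for j s
      using span[of j "y * s"] y that by (simp add: multiplier_ring_def mult.left_commute)
    then show "y \<in> multiplier_ring S'" by (auto simp: multiplier_ring_def S'_def)
  qed
  moreover have "x * (x ^ j * s) \<in> int_span S'" if j: "j < n" and s: "s \<in> S" for j s
  proof (cases "Suc j = n")
    case False
    then show ?thesis using S'[of "Suc j" s] j s by (auto intro: span_base simp: mult.assoc)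
  next
    case True
    have "0 = (\<Sum>i\<le>n. coeff p i * x ^ i)" using p(2) by (simp add: poly_altdef n_def)
    also have "\<dots> = (\<Sum>i<n. coeff p i * x ^ i) + x ^ n"
      using p(1) by (simp add: n_def lessThan_Suc_atMost[symmetric])
    finally have xn: "x ^ n = - (\<Sum>i<n. coeff p i * x ^ i)" by (simp add: eq_neg_iff_add_eq_0 add.commute)
    have "x * (x ^ j * s) = x ^ n * s" by (simp flip: True)
    also have "\<dots> = - (\<Sum>i<n. x ^ i * (coeff p i * s))"
      unfolding xn by (simp add: sum_distrib_left mult_ac)
    also have "\<dots> \<in> int_span S'"
      using coeffs s by (intro span_uminus int_span_sum span) (auto simp: multiplier_ring_def)
    finally show ?thesis .
  qed
  then have "x \<in> multiplier_ring S'" by (auto simp: multiplier_ring_def S'_def)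
  moreover have "1 \<in> S'" using S'[of 0 1] n S by simp
  ultimately show ?thesis using S by (intro exI[of _ S']) (auto simp: S'_def)
qed

lemma common_multiplier_ring:
  assumes "finite X" "\<And>x. x \<in> X \<Longrightarrow> algebraic_int x"
  shows "\<exists>S. finite S \<and> 1 \<in> S \<and> X \<subseteq> multiplier_ring S"
  using assms
proof (induction X rule: finite_induct)
  case empty
  then show ?case by (intro exI[of _ "{1}"]) auto
next
  case (insert x X)
  then obtain S where S: "finite S" "1 \<in> S" "X \<subseteq> multiplier_ring S" by auto
  have "algebraic_int x" using insert.prems by blast
  then obtain p where p: "lead_coeff p = 1" "\<forall>i. coeff p i \<in> \<int>" "poly p x = 0"
    by (rule algebraic_int.cases) blast
  then have "coeff p i \<in> multiplier_ring S" for i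
    by (metis Ints_cases multiplier_ring_of_int)
  from multiplier_ring_extend[OF S(1,2) p(1,3) this] S(3) show ?case by blast
qed

lemma algebraic_int_add: "algebraic_int x \<Longrightarrow> algebraic_int y \<Longrightarrow> algebraic_int (x + y :: complex)"
  using common_multiplier_ring[of "{x, y}"] algebraic_int_multiplier_ring multiplier_ring_add by blast

lemma algebraic_int_mult: "algebraic_int x \<Longrightarrow> algebraic_int y \<Longrightarrow> algebraic_int (x * y :: complex)"
  using common_multiplier_ring[of "{x, y}"] algebraic_int_multiplier_ring multiplier_ring_mult by blast

text \<open>Transitivity of integrality: the coefficients lie in one multiplier ring, to which
  \<open>x\<close> is adjoined.\<close>

lemma algebraic_int_monic_root:
  fixes p :: "complex poly"
  assumes "lead_coeff p = 1" "poly p x = 0" "\<And>i. algebraic_int (coeff p i)"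
  shows "algebraic_int x"
proof -
  obtain S where S: "finite S" "1 \<in> S" "coeff p ` {..degree p} \<subseteq> multiplier_ring S"
    using common_multiplier_ring[of "coeff p ` {..degree p}"] assms(3) by auto
  have "coeff p i \<in> multiplier_ring S" for i
    using S(3) multiplier_ring_of_int[of 0 S] by (cases "i \<le> degree p") (auto simp: coeff_eq_0)
  from multiplier_ring_extend[OF S(1,2) assms(1,2) this] show ?thesis
    using algebraic_int_multiplier_ring by blast
qed

typedef algint = "{x :: complex. algebraic_int x}"
  by (rule exI[of _ 0]) simp

setup_lifting type_definition_algint

instantiation algint :: idom
begin

lift_definition zero_algint :: algint is 0 by simp
lift_definition one_algint :: algint is 1 by simp
lift_definition plus_algint :: "algint \<Rightarrow> algint \<Rightarrow> algint" is "(+)" by (simp add: algebraic_int_add)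
lift_definition times_algint :: "algint \<Rightarrow> algint \<Rightarrow> algint" is "(*)" by (simp add: algebraic_int_mult)
lift_definition uminus_algint :: "algint \<Rightarrow> algint" is uminus by simp
lift_definition minus_algint :: "algint \<Rightarrow> algint \<Rightarrow> algint" is "(-)"
  using algebraic_int_add[of _ "- _"] by auto

instance
  by standard (transfer; simp add: algebra_simps)+

end

lemma Rep_algint_of_nat: "Rep_algint (of_nat n) = of_nat n"
  by (induction n) (simp_all add: zero_algint.rep_eq one_algint.rep_eq plus_algint.rep_eq)

lemma Rep_algint_power: "Rep_algint (x ^ n) = Rep_algint x ^ n"
  by (induction n) (simp_all add: one_algint.rep_eq times_algint.rep_eq)

lemma Rep_algint_sum: "Rep_algint (sum f S) = (\<Sum>i\<in>S. Rep_algint (f i))"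
  by (induction S rule: infinite_finite_induct) (simp_all add: zero_algint.rep_eq plus_algint.rep_eq)

lemma Rep_algint_eq_0_iff: "Rep_algint x = 0 \<longleftrightarrow> x = 0"
  by (metis Rep_algint_inject zero_algint.rep_eq)

lemma algint_monic_root:
  fixes f :: "algint poly"
  assumes "lead_coeff f = 1" "degree f > 0"
  shows "\<exists>x. poly f x = 0"
proof -
  define g where "g = map_poly Rep_algint f"
  have coeff: "coeff g i = Rep_algint (coeff f i)" for i
    by (simp add: g_def coeff_map_poly zero_algint.rep_eq)
  have deg: "degree g = degree f"
    by (simp add: g_def map_poly_degree_eq Rep_algint_eq_0_iff degree_map_poly)
  obtain z where z: "poly g z = 0"
    using alg_closed_imp_poly_has_root[of g] assms deg by auto
  have "algebraic_int z"
  proof (rule algebraic_int_monic_root[OF _ z])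
    show "lead_coeff g = 1" using assms by (simp add: coeff deg one_algint.rep_eq)
    show "algebraic_int (coeff g i)" for i using Rep_algint by (simp add: coeff)
  qed
  then have "Rep_algint (poly f (Abs_algint z)) = poly g z"
    by (simp add: poly_altdef Rep_algint_sum times_algint.rep_eq Rep_algint_power Abs_algint_inverse coeff deg)
  then show ?thesis using z Rep_algint_eq_0_iff by auto
qed

section \<open>Maximal ideals above a prime\<close>

definition algint_ideal :: "algint set \<Rightarrow> bool" where
  "algint_ideal J \<longleftrightarrow> 0 \<in> J \<and> (\<forall>x\<in>J. \<forall>y\<in>J. x + y \<in> J) \<and> (\<forall>x\<in>J. \<forall>y. y * x \<in> J)"

text \<open>Zorn's lemma for the proper ideals containing p. The multiples of p form a proper ideal
  because 1/p is rational but not an integer, hence no algebraic integer.\<close>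

lemma exists_maximal_ideal:
  assumes "prime (p::nat)"
  shows "\<exists>I. acf_ideal I \<and> (of_nat p :: algint) \<in> I"
proof -
  define \<A> where "\<A> = {J. algint_ideal J \<and> of_nat p \<in> J \<and> 1 \<notin> J}"
  let ?J = "range (\<lambda>y. y * (of_nat p :: algint))"
  have "?J \<in> \<A>"
  proof -
    have "1 \<noteq> y * of_nat p" for y :: algint
    proof
      assume "1 = y * of_nat p"
      then have "Rep_algint 1 = Rep_algint (y * of_nat p)" by simp
      then have 1: "1 = Rep_algint y * of_nat p"
        by (simp add: one_algint.rep_eq times_algint.rep_eq Rep_algint_of_nat)
      then have "Rep_algint y = 1 / of_nat p" using assms by (auto simp: field_simps)
      then have "Rep_algint y \<in> \<rat>" by simp
      then have "Rep_algint y \<in> \<int>" using rational_algebraic_int_is_int Rep_algint by blast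
      then obtain m where "Rep_algint y = of_int m" by (auto elim: Ints_cases)
      with 1 have "of_int 1 = (of_int (m * int p) :: complex)" by simp
      then have "1 = m * int p" by (simp only: of_int_eq_iff)
      then show False using prime_gt_1_nat[OF assms]
        by (metis dvd_triv_right of_nat_dvd_iff of_nat_1 nat_dvd_1_iff_1 less_irrefl)
    qed
    moreover have "algint_ideal ?J"
      unfolding algint_ideal_def
    proof (intro conjI ballI allI)
      show "0 \<in> ?J" by (rule range_eqI[of _ _ 0]) simp
      fix x y :: algint assume "x \<in> ?J" "y \<in> ?J"
      then show "x + y \<in> ?J" by (auto simp flip: distrib_right)
    next
      fix x y :: algint assume "x \<in> ?J"
      then show "y * x \<in> ?J" by (auto simp flip: mult.assoc)
    qed
    moreover have "of_nat p \<in> ?J" by (rule range_eqI[of _ _ 1]) simp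
    ultimately show ?thesis unfolding \<A>_def by blast
  qed
  then have "\<A> \<noteq> {}" by blast
  moreover have "\<Union>\<C> \<in> \<A>" if "\<C> \<noteq> {}" and chain: "subset.chain \<A> \<C>" for \<C>
  proof -
    have sub: "\<C> \<subseteq> \<A>" using chain by (simp add: subset.chain_def)
    have ideals: "algint_ideal Z \<and> of_nat p \<in> Z \<and> 1 \<notin> Z" if "Z \<in> \<C>" for Z
      using sub that by (auto simp: \<A>_def)
    have "x + y \<in> \<Union>\<C>" if xy: "x \<in> \<Union>\<C>" "y \<in> \<Union>\<C>" for x y
    proof -
      from xy obtain X Y where XY: "X \<in> \<C>" "Y \<in> \<C>" "x \<in> X" "y \<in> Y" by blast
      then have "X \<subseteq> Y \<or> Y \<subseteq> X" using chain by (auto simp: subset_chain_def)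
      then obtain Z where Z: "Z \<in> \<C>" "x \<in> Z" "y \<in> Z" using XY by blast
      then have "x + y \<in> Z" using ideals[OF Z(1)] by (auto simp: algint_ideal_def)
      then show ?thesis using Z(1) by blast
    qed
    moreover have "y * x \<in> \<Union>\<C>" if "x \<in> \<Union>\<C>" for x y
      using that ideals unfolding algint_ideal_def by blast
    moreover obtain Z where "Z \<in> \<C>" using \<open>\<C> \<noteq> {}\<close> by blast
    then have "0 \<in> \<Union>\<C>" "of_nat p \<in> \<Union>\<C>" using ideals[of Z] by (auto simp: algint_ideal_def)
    moreover have "1 \<notin> \<Union>\<C>" using ideals by blast
    ultimately show ?thesis unfolding \<A>_def algint_ideal_def by blast
  qed
  ultimately have "\<exists>M\<in>\<A>. \<forall>X\<in>\<A>. M \<subseteq> X \<longrightarrow> X = M" by (rule subset_Zorn_nonempty)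
  then obtain I where I: "I \<in> \<A>" and max: "\<And>X. X \<in> \<A> \<Longrightarrow> I \<subseteq> X \<Longrightarrow> X = I" by blast
  have ideal: "0 \<in> I" "\<And>x y. x \<in> I \<Longrightarrow> y \<in> I \<Longrightarrow> x + y \<in> I" "\<And>x y. x \<in> I \<Longrightarrow> y * x \<in> I"
    and p: "of_nat p \<in> I" and one: "1 \<notin> I"
    using I by (auto simp: \<A>_def algint_ideal_def)
  have "acf_ideal I"
  proof
    fix x assume x: "x \<notin> I"
    \<comment> \<open>The ideal generated by \<open>I\<close> and \<open>x\<close>. Maximality
      forces 1 into it, which yields an inverse of \<open>x\<close> modulo \<open>I\<close>.\<close>
    define X where "X = {z. \<exists>w\<in>I. \<exists>y. z = w + x * y}"
    have "I \<subseteq> X" using mult_zero_right[of x] by (force simp: X_def)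
    moreover have "x \<in> X" using ideal(1) by (auto simp: X_def intro!: bexI[of _ 0] exI[of _ 1])
    ultimately have "X \<notin> \<A>" using max x by blast
    moreover have "algint_ideal X"
      unfolding algint_ideal_def
    proof (intro conjI ballI allI)
      show "0 \<in> X" using \<open>I \<subseteq> X\<close> ideal by blast
      fix a b assume "a \<in> X" "b \<in> X"
      then obtain w y w' y' where "w \<in> I" "w' \<in> I" "a = w + x * y" "b = w' + x * y'" by (auto simp: X_def)
      then show "a + b \<in> X" using ideal(2)[of w w']
        by (auto simp: X_def algebra_simps intro!: bexI[of _ "w + w'"] exI[of _ "y + y'"])
    next
      fix a b assume "a \<in> X"
      then obtain w y where "w \<in> I" "a = w + x * y" by (auto simp: X_def)
      then show "b * a \<in> X" using ideal(3)[of w b]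
        by (auto simp: X_def algebra_simps intro!: bexI[of _ "b * w"] exI[of _ "b * y"])
    qed
    ultimately have "1 \<in> X" using p \<open>I \<subseteq> X\<close> by (auto simp: \<A>_def)
    then obtain w y where wy: "w \<in> I" "1 = w + x * y" by (auto simp: X_def)
    have "x * y = 1 - w" using wy(2) by (simp add: eq_diff_eq add.commute)
    then have "x * y - 1 = - 1 * w" by simp
    then show "\<exists>y. x * y - 1 \<in> I" using ideal(3)[OF wy(1), of "-1"] by (intro exI[of _ y]) simp
  qed (use ideal one algint_monic_root in auto)
  with p show ?thesis by blast
qed

section \<open>The Frobenius map and roots of unity modulo the ideal\<close>

context acf_ideal
begin

lemma frobenius_prime:
  assumes "prime p" "of_nat p \<in> I"
  shows "(x + y) ^ p - (x ^ p + y ^ p) \<in> I"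
proof -
  have "p > 0" using assms(1) prime_gt_0_nat by blast
  have "(x + y) ^ p = (\<Sum>k\<le>p. of_nat (p choose k) * x ^ k * y ^ (p - k))" by (rule binomial_ring)
  also have "{..p} = insert 0 (insert p {0<..<p})" by auto
  finally have "(x + y) ^ p - (x ^ p + y ^ p) = (\<Sum>k\<in>{0<..<p}. of_nat (p choose k) * x ^ k * y ^ (p - k))"
    using \<open>p > 0\<close> by simp
  also have "\<dots> \<in> I"
  proof (rule sum_mem)
    fix k assume "k \<in> {0<..<p}"
    then have "p dvd (p choose k)" using assms(1) by (intro dvd_choose_prime) auto
    then obtain c where "p choose k = p * c" by blast
    then show "of_nat (p choose k) * x ^ k * y ^ (p - k) \<in> I"
      using assms(2) by (auto intro!: mult_mem_right)
  qed
  finally show ?thesis .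
qed

lemma frobenius_prime_power:
  assumes "prime p" "of_nat p \<in> I"
  shows "(x + y) ^ (p ^ n) - (x ^ (p ^ n) + y ^ (p ^ n)) \<in> I"
proof (induction n)
  case (Suc n)
  have "((x + y) ^ (p ^ n)) ^ p - (x ^ (p ^ n) + y ^ (p ^ n)) ^ p \<in> I" by (rule cong_power[OF Suc])
  from diff_mem_trans[OF this frobenius_prime[OF assms]] show ?case
    by (simp add: power_mult[symmetric] mult.commute)
qed (simp add: zero_mem)

end

text \<open>The field with \<open>q\<close> elements is represented by \<open>0\<close> and the roots of unity of order dividing
  \<open>q - 1\<close>.\<close>

theorem exists_finite_subfield:
  assumes "primepow (q::nat)"
  shows "\<exists>(I :: algint set) F. finite_subfield I F q"
proof -
  from assms obtain p n where pn: "prime p" "n > 0" "q = p ^ n" by (auto simp: primepow_def)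
  have q: "q > 1" using primepow_gt_Suc_0[OF assms] by simp
  obtain I :: "algint set" where "acf_ideal I" and p: "of_nat p \<in> I" using exists_maximal_ideal[OF pn(1)] by blast
  then interpret acf_ideal I by simp
  define F :: "algint set" where "F = {x. x = 0 \<or> x ^ (q - 1) = 1}"
  have image: "Rep_algint ` F = insert 0 {z. z ^ (q - 1) = 1}"
  proof (intro equalityI subsetI)
    fix z assume "z \<in> Rep_algint ` F"
    then obtain x where "x = 0 \<or> x ^ (q - 1) = 1" "z = Rep_algint x" by (auto simp: F_def)
    then show "z \<in> insert 0 {z. z ^ (q - 1) = 1}"
      by (auto simp: zero_algint.rep_eq one_algint.rep_eq Rep_algint_power[symmetric])
  next
    fix z :: complex assume z: "z \<in> insert 0 {z. z ^ (q - 1) = 1}"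
    then have alg: "algebraic_int z"
      using q by (auto intro!: algebraic_int_root[of 1 "monom 1 (q - 1)" z] simp: poly_monom degree_monom_eq)
    have "Abs_algint z ^ (q - 1) = 1" if "z \<noteq> 0"
    proof -
      have "Rep_algint (Abs_algint z ^ (q - 1)) = Rep_algint 1"
        using z alg that by (auto simp: Rep_algint_power Abs_algint_inverse one_algint.rep_eq)
      then show ?thesis by (simp only: Rep_algint_inject)
    qed
    moreover have "Abs_algint z = 0" if "z = 0" using that by (simp add: zero_algint_def)
    ultimately have "Abs_algint z \<in> F" by (auto simp: F_def)
    then show "z \<in> Rep_algint ` F" using alg by (auto simp: image_iff Abs_algint_inverse intro!: bexI[of _ "Abs_algint z"])
  qed
  have inj: "inj_on Rep_algint F" by (auto simp: inj_on_def Rep_algint_inject)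
  have fin: "finite {z::complex. z ^ (q - 1) = 1}" using q by (intro finite_roots_unity) auto
  have "card F = card (Rep_algint ` F)" using card_image[OF inj] by simp
  also have "\<dots> = q" unfolding image using fin q card_roots_unity_eq[of "q - 1"] by (simp add: zero_power)
  finally have card: "card F = q" .
  have finF: "finite F" using card q by (metis card.infinite not_one_less_zero)
  have notin: "x \<notin> I" if "x ^ (q - 1) = 1" for x
  proof
    assume "x \<in> I"
    then have "x ^ (q - 1) \<in> I" using q by (cases "q - 1") (auto intro: mult_mem_right)
    then show False using that one_notin by simp
  qed
  have incong: "x = y" if xy: "x \<in> F" "y \<in> F" "x - y \<in> I" for x y
  proof (cases "x = 0 \<or> y = 0")
    case True
    then show ?thesis using xy notin uminus_mem[of "- y"] by (auto simp: F_def)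
  next
    case False
    then have pw: "x ^ (q - 1) = 1" "y ^ (q - 1) = 1" using xy by (auto simp: F_def)
    \<comment> \<open>\<open>w\<close> is x / y, as \<open>y ^ (q - 2)\<close> inverts
      \<open>y\<close>.\<close>
    define w where "w = x * y ^ (q - 2)"
    have yy: "y * y ^ (q - 2) = 1" using pw(2) q
      by (metis One_nat_def Suc_diff_Suc numeral_2_eq_2 power_Suc)
    have "w - 1 = (x - y) * y ^ (q - 2)" using yy by (simp add: w_def left_diff_distrib)
    then have w1: "w - 1 \<in> I" using xy by (auto intro: mult_mem_right)
    have wpow: "w ^ (q - 1) = 1"
    proof -
      have "w ^ (q - 1) = x ^ (q - 1) * (y ^ (q - 1)) ^ (q - 2)"
        unfolding w_def power_mult_distrib by (simp add: power_mult[symmetric] mult.commute)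
      then show ?thesis using pw by simp
    qed
    \<comment> \<open>For a root of unity other than 1 the sum of the first q - 1 powers is zero; as
      \<open>w\<close> is congruent to 1, this sum is also congruent to q - 1. But q - 1 and q
      cannot both lie in \<open>I\<close>.\<close>
    have "w = 1"
    proof (rule ccontr)
      assume "w \<noteq> 1"
      have "(w - 1) * (\<Sum>i<q - 1. w ^ i) = 0"
        using wpow power_diff_1_eq[of w "q - 1"] by simp
      with \<open>w \<noteq> 1\<close> have zero: "(\<Sum>i<q - 1. w ^ i) = 0" by simp
      have "(\<Sum>i<q - 1. w ^ i) - (\<Sum>i<q - 1. 1) \<in> I"
        using cong_power[OF w1] by (intro cong_sum) simp
      then have "- of_nat (q - 1) \<in> I" using zero by simp
      then have "of_nat (q - 1) \<in> I" using uminus_mem by fastforce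
      moreover have "(of_nat q :: algint) \<in> I"
        using pn p by (cases n) (auto intro: mult_mem_right)
      ultimately have "of_nat q - of_nat (q - 1) \<in> I" by (rule diff_mem[rotated])
      then show False using one_notin q by (simp add: of_nat_diff)
    qed
    then have "x = x * (y * y ^ (q - 2))" "x * y ^ (q - 2) = 1" using yy by (simp_all add: w_def)
    then show ?thesis by (metis mult.left_commute mult.right_neutral)
  qed
  have "finite_subfield I F q"
  proof
    show "x ^ q - x \<in> I" if "x \<in> F" for x
    proof -
      have "x ^ q = x * x ^ (q - 1)" using q by (cases q) auto
      then show ?thesis using that q by (auto simp: F_def zero_mem zero_power)
    qed
    show "(x + y) ^ q - (x ^ q + y ^ q) \<in> I" for x y
      unfolding pn(3) by (rule frobenius_prime_power[OF pn(1) p])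
  qed (use finF card q incong in auto)
  then show ?thesis by blast
qed

section \<open>Paths and their dichotomy\<close>

text \<open>The variables of the formula for paths: coefficients of the polynomials, parameters of
  the linear forms, and in \<open>Vtx j i\<close> coordinate i at position j. With the polynomials
  among the variables, the bounds of the dichotomy are uniform in them.\<close>

datatype path_var = Coef nat nat nat | Tau nat | Vtx nat nat

text \<open>Vertices in \<open>M\<close> are vectors \<open>x\<close> of length \<open>A\<close>, vertices in \<open>N\<close> are vectors \<open>n = (\<nu>, \<eta>)\<close> of
  length \<open>\<beta> + t\<close>. The polynomials are sums of univariate polynomials in linear forms, one of which
  separates any bounded number of given points. The even positions of a path are in \<open>M\<close> iff \<open>p\<close>.\<close>

locale path_system =
  fixes k A \<beta> t NT R :: nat
  assumes k_pos: "k \<ge> 1" and t_le: "t \<le> A"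
begin

text \<open>Only the part \<nu> of \<open>n\<close> enters. With the powers of \<tau> as weights,
  the difference of the values at two points is a polynomial in \<tau>, so all but boundedly many
  \<tau> separate them.\<close>

definition lin_form :: "'a::idom \<Rightarrow> (nat \<Rightarrow> 'a) \<Rightarrow> (nat \<Rightarrow> 'a) \<Rightarrow> 'a" where
  "lin_form \<tau> x n = (\<Sum>m<A + \<beta>. (if m < A then x m else n (m - A)) * \<tau> ^ m)"

definition poly_val ::
  "(nat \<Rightarrow> nat \<Rightarrow> nat \<Rightarrow> 'a::idom) \<Rightarrow> (nat \<Rightarrow> 'a) \<Rightarrow> (nat \<Rightarrow> 'a) \<Rightarrow> (nat \<Rightarrow> 'a) \<Rightarrow> nat \<Rightarrow> 'a" where
  "poly_val c \<tau> x n i = (\<Sum>\<sigma><NT. \<Sum>d<R. c i \<sigma> d * lin_form (\<tau> \<sigma>) x n ^ d)"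

definition adjacent ::
  "'a::idom set \<Rightarrow> (nat \<Rightarrow> nat \<Rightarrow> nat \<Rightarrow> 'a) \<Rightarrow> (nat \<Rightarrow> 'a) \<Rightarrow> (nat \<Rightarrow> 'a) \<Rightarrow> (nat \<Rightarrow> 'a) \<Rightarrow> bool" where
  "adjacent I c \<tau> x n \<longleftrightarrow> (\<forall>i<t. poly_val c \<tau> x n i - n (\<beta> + i) \<in> I)"

definition vdim :: "bool \<Rightarrow> nat \<Rightarrow> nat" where
  "vdim p j = (if even j = p then A else \<beta> + t)"

definition vec_cong :: "'a::idom set \<Rightarrow> nat \<Rightarrow> (nat \<Rightarrow> 'a) \<Rightarrow> (nat \<Rightarrow> 'a) \<Rightarrow> bool" where
  "vec_cong I m v w \<longleftrightarrow> (\<forall>i<m. v i - w i \<in> I)"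

text \<open>Of the ends j and j + 1 of edge j, \<open>xpos\<close> is the one in M and
  \<open>npos\<close> the one in N.\<close>

definition xpos :: "bool \<Rightarrow> nat \<Rightarrow> nat" where
  "xpos p j = (if even j = p then j else Suc j)"

definition npos :: "bool \<Rightarrow> nat \<Rightarrow> nat" where
  "npos p j = (if even j = p then Suc j else j)"

text \<open>Distinctness is asked for equal parities, since positions of different parity lie in
  different parts. It is distinctness modulo \<open>I\<close>, as the coordinates may be any ring
  elements.\<close>

definition is_path ::
  "'a::idom set \<Rightarrow> (nat \<Rightarrow> nat \<Rightarrow> nat \<Rightarrow> 'a) \<Rightarrow> (nat \<Rightarrow> 'a) \<Rightarrow> bool \<Rightarrow> (nat \<Rightarrow> nat \<Rightarrow> 'a) \<Rightarrow> bool" where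
  "is_path I c \<tau> p V \<longleftrightarrow>
     (\<forall>j<2 * k. adjacent I c \<tau> (V (xpos p j)) (V (npos p j))) \<and>
     (\<forall>j\<le>2 * k. \<forall>j'\<le>2 * k. j \<noteq> j' \<and> even j = even j' \<longrightarrow> \<not> vec_cong I (vdim p j) (V j) (V j'))"

lemma xpos_le: "j < 2 * k \<Longrightarrow> xpos p j \<le> 2 * k" and npos_le: "j < 2 * k \<Longrightarrow> npos p j \<le> 2 * k"
  by (auto simp: xpos_def npos_def)

lemma vdim_xpos: "vdim p (xpos p j) = A" and vdim_npos: "vdim p (npos p j) = \<beta> + t"
  by (auto simp: xpos_def npos_def vdim_def)

lemma lin_form_cong:
  "(\<And>m. m < A \<Longrightarrow> x m = x' m) \<Longrightarrow> (\<And>m. m < \<beta> \<Longrightarrow> n m = n' m) \<Longrightarrow> lin_form \<tau> x n = lin_form \<tau> x' n'"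
  unfolding lin_form_def by (intro sum.cong) auto

lemma adjacent_cong:
  assumes "\<And>m. m < A \<Longrightarrow> x m = x' m" "\<And>m. m < \<beta> + t \<Longrightarrow> n m = n' m"
  shows "adjacent I c \<tau> x n \<longleftrightarrow> adjacent I c \<tau> x' n'"
proof -
  have "lin_form s x n = lin_form s x' n'" for s using assms by (intro lin_form_cong) auto
  then have "poly_val c \<tau> x n = poly_val c \<tau> x' n'" by (simp add: poly_val_def fun_eq_iff)
  then show ?thesis using assms(2) by (simp add: adjacent_def)
qed

lemma is_path_cong:
  assumes eq: "\<And>j i. j \<le> 2 * k \<Longrightarrow> i < vdim p j \<Longrightarrow> V j i = V' j i"
  shows "is_path I c \<tau> p V \<longleftrightarrow> is_path I c \<tau> p V'"
proof -
  have "adjacent I c \<tau> (V (xpos p j)) (V (npos p j)) \<longleftrightarrow> adjacent I c \<tau> (V' (xpos p j)) (V' (npos p j))"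
    if "j < 2 * k" for j
    using that by (intro adjacent_cong eq) (auto simp: vdim_xpos vdim_npos xpos_le npos_le)
  moreover have "vec_cong I (vdim p j) (V j) (V j') \<longleftrightarrow> vec_cong I (vdim p j) (V' j) (V' j')"
    if "j \<le> 2 * k" "j' \<le> 2 * k" "even j = even j'" for j j'
  proof -
    have "vdim p j' = vdim p j" using that by (simp add: vdim_def)
    then show ?thesis using that eq[of j] eq[of j'] by (simp add: vec_cong_def)
  qed
  ultimately show ?thesis unfolding is_path_def by auto
qed

lemma term_lin_form: "integral_term (\<lambda>e. lin_form (e (Tau s)) (\<lambda>i. e (Vtx j i)) (\<lambda>i. e (Vtx j' i)))"
proof -
  have "integral_term (\<lambda>e. if m < A then e (Vtx j m) else e (Vtx j' (m - A)))" for m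
    by (cases "m < A") (auto intro: term_var)
  then show ?thesis unfolding lin_form_def by (intro term_sum term_mult term_power term_var)
qed

lemma qf_is_path:
  "qf_definable (\<lambda>I (e :: path_var \<Rightarrow> 'a::idom).
     is_path I (\<lambda>i \<sigma> d. e (Coef i \<sigma> d)) (\<lambda>\<sigma>. e (Tau \<sigma>)) p (\<lambda>j i. e (Vtx j i)))"
proof -
  have Ball: "(\<forall>i<m. P i) \<longleftrightarrow> (\<forall>i\<in>{..<m}. P i)" "(\<forall>i\<le>m. P i) \<longleftrightarrow> (\<forall>i\<in>{..m}. P i)" for m :: nat and P
    by auto
  have adj: "qf_definable (\<lambda>I (e :: path_var \<Rightarrow> 'a).
    adjacent I (\<lambda>i \<sigma> d. e (Coef i \<sigma> d)) (\<lambda>\<sigma>. e (Tau \<sigma>)) (\<lambda>i. e (Vtx j i)) (\<lambda>i. e (Vtx j' i)))" for j j'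
    unfolding adjacent_def poly_val_def Ball
    by (intro qf_Ball finite_lessThan qf_term term_diff term_sum term_mult term_power term_var term_lin_form)
  have cong: "qf_definable (\<lambda>I (e :: path_var \<Rightarrow> 'a).
    vec_cong I m (\<lambda>i. e (Vtx j i)) (\<lambda>i. e (Vtx j' i)))" for m j j'
    unfolding vec_cong_def Ball by (intro qf_Ball finite_lessThan qf_term term_diff term_var)
  have neq: "qf_definable (\<lambda>I (e :: path_var \<Rightarrow> 'a). P \<longrightarrow>
    \<not> vec_cong I m (\<lambda>i. e (Vtx j i)) (\<lambda>i. e (Vtx j' i)))" for P m j j'
    by (cases P) (auto intro: qf_const qf_not[OF cong])
  show ?thesis
    unfolding is_path_def Ball by (intro qf_conj qf_Ball finite_lessThan finite_atMost adj neq)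
qed

section \<open>Values of a coordinate at the first inner position\<close>

definition joined ::
  "'a::idom set \<Rightarrow> (nat \<Rightarrow> nat \<Rightarrow> nat \<Rightarrow> 'a) \<Rightarrow> (nat \<Rightarrow> 'a) \<Rightarrow> bool \<Rightarrow> nat \<Rightarrow> (nat \<Rightarrow> 'a) \<Rightarrow> (nat \<Rightarrow> 'a) \<Rightarrow> 'a \<Rightarrow> bool"
  where "joined I c \<tau> p i0 v0 v1 u \<longleftrightarrow>
    (\<exists>V. is_path I c \<tau> p V \<and> V 0 = v0 \<and> V (2 * k) = v1 \<and> V 1 i0 = u)"

definition exceptional_set ::
  "'a::idom set \<Rightarrow> (nat \<Rightarrow> nat \<Rightarrow> nat \<Rightarrow> 'a) \<Rightarrow> (nat \<Rightarrow> 'a) \<Rightarrow> bool \<Rightarrow> nat \<Rightarrow> (nat \<Rightarrow> 'a) \<Rightarrow> (nat \<Rightarrow> 'a) \<Rightarrow> 'a set \<Rightarrow> bool"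
  where "exceptional_set I c \<tau> p i0 v0 v1 E \<longleftrightarrow>
    (\<forall>u u'. (\<forall>z\<in>E. u - z \<notin> I) \<longrightarrow> (\<forall>z\<in>E. u' - z \<notin> I) \<longrightarrow>
      joined I c \<tau> p i0 v0 v1 u \<longrightarrow>
      joined I c \<tau> p i0 v0 v1 u')"

text \<open>Eliminating all inner coordinates except \<open>Vtx 1 i0\<close> leaves a
  quantifier-free condition on this variable, with polynomials, linear forms and endpoints as
  parameters; so \<open>C\<close> is uniform in all of these.\<close>

lemma path_dichotomy_aux:
  assumes "i0 < vdim p 1"
  shows "\<exists>C. \<forall>(I :: 'a::idom set) c \<tau> v0 v1. acf_ideal I \<longrightarrow> (\<exists>E. finite E \<and> card E \<le> C \<and> exceptional_set I c \<tau> p i0 v0 v1 E)"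
proof -
  define J where "J = (\<lambda>(j, i). Vtx j i) ` (SIGMA j:{0<..<2 * k}. {..<vdim p j}) - {Vtx 1 i0}"
  define P where "P = (\<lambda>I (e :: path_var \<Rightarrow> 'a).
     is_path I (\<lambda>i \<sigma> d. e (Coef i \<sigma> d)) (\<lambda>\<sigma>. e (Tau \<sigma>)) p (\<lambda>j i. e (Vtx j i)))"
  have "qf_definable (\<lambda>I e. \<exists>f. P I (override_on e f J))"
    unfolding P_def by (intro qf_ex_set qf_is_path) (auto simp: J_def)
  from qf_definable_one_variable[OF this, of "Vtx 1 i0"] obtain C where
    C: "\<forall>I e. acf_ideal I \<longrightarrow> (\<exists>E. finite E \<and> card E \<le> C \<and>
     (\<forall>x y. (\<forall>z\<in>E. x - z \<notin> I) \<longrightarrow> (\<forall>z\<in>E. y - z \<notin> I) \<longrightarrow>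
       (\<exists>f. P I (override_on (e(Vtx 1 i0 := x)) f J)) \<longrightarrow> (\<exists>f. P I (override_on (e(Vtx 1 i0 := y)) f J))))"
    by (elim exE)
  show ?thesis
  proof (intro exI[of _ C] allI impI)
    fix I :: "'a set" and c :: "nat \<Rightarrow> nat \<Rightarrow> nat \<Rightarrow> 'a" and \<tau> v0 v1 :: "nat \<Rightarrow> 'a"
    assume I: "acf_ideal I"
    \<comment> \<open>The 0 is a default: inner coordinates below \<open>vdim\<close> are overridden
      by the quantified variables or, for \<open>Vtx 1 i0\<close>, set to \<open>u\<close>.\<close>
    define e where "e = (\<lambda>x. case x of Coef i \<sigma> d \<Rightarrow> c i \<sigma> d | Tau \<sigma> \<Rightarrow> \<tau> \<sigma> |
      Vtx j i \<Rightarrow> if j = 0 then v0 i else if j = 2 * k then v1 i else 0)"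
    have iff: "(\<exists>f. P I (override_on (e(Vtx 1 i0 := u)) f J)) \<longleftrightarrow>
      joined I c \<tau> p i0 v0 v1 u" for u
    proof
      assume "\<exists>f. P I (override_on (e(Vtx 1 i0 := u)) f J)"
      then obtain f where f: "P I (override_on (e(Vtx 1 i0 := u)) f J)" by blast
      have coef: "override_on (e(Vtx 1 i0 := u)) f J (Coef i \<sigma> d) = c i \<sigma> d"
        and tau: "override_on (e(Vtx 1 i0 := u)) f J (Tau \<sigma>) = \<tau> \<sigma>" for i \<sigma> d
        by (auto simp: override_on_def J_def e_def)
      show "joined I c \<tau> p i0 v0 v1 u"
        using f k_pos unfolding joined_def P_def coef tau
        by (intro exI[of _ "\<lambda>j i. override_on (e(Vtx 1 i0 := u)) f J (Vtx j i)"])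
           (auto simp: override_on_def J_def e_def fun_eq_iff)
    next
      assume "joined I c \<tau> p i0 v0 v1 u"
      then obtain V where V: "is_path I c \<tau> p V" "V 0 = v0" "V (2 * k) = v1" "V 1 i0 = u"
        unfolding joined_def by blast
      define f where "f = (\<lambda>x. case x of Vtx j i \<Rightarrow> V j i | _ \<Rightarrow> 0)"
      have coef: "override_on (e(Vtx 1 i0 := u)) f J (Coef i \<sigma> d) = c i \<sigma> d"
        and tau: "override_on (e(Vtx 1 i0 := u)) f J (Tau \<sigma>) = \<tau> \<sigma>" for i \<sigma> d
        by (auto simp: override_on_def J_def e_def)
      have "override_on (e(Vtx 1 i0 := u)) f J (Vtx j i) = V j i" if ji: "j \<le> 2 * k" "i < vdim p j" for j i
      proof -
        consider "j = 0" | "j = 2 * k" | "0 < j" "j < 2 * k" using ji by linarith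
        then show ?thesis using V ji k_pos
          by cases (auto simp: override_on_def J_def e_def f_def)
      qed
      then have "is_path I c \<tau> p (\<lambda>j i. override_on (e(Vtx 1 i0 := u)) f J (Vtx j i)) \<longleftrightarrow> is_path I c \<tau> p V"
        by (intro is_path_cong)
      then have "P I (override_on (e(Vtx 1 i0 := u)) f J)"
        unfolding P_def coef tau using V(1) by blast
      then show "\<exists>f. P I (override_on (e(Vtx 1 i0 := u)) f J)" by blast
    qed
    from C[rule_format, OF I, of e]
    show "\<exists>E. finite E \<and> card E \<le> C \<and> exceptional_set I c \<tau> p i0 v0 v1 E"
      unfolding iff exceptional_set_def .
  qed
qed

lemma path_dichotomy:
  "\<exists>C. \<forall>(I :: 'a::idom set) c \<tau> p i0 v0 v1. acf_ideal I \<longrightarrow> i0 < vdim p 1 \<longrightarrow> (\<exists>E. finite E \<and> card E \<le> C \<and> exceptional_set I c \<tau> p i0 v0 v1 E)"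
proof -
  define Q where "Q = (\<lambda>C (p, i0). \<forall>(I :: 'a set) c \<tau> v0 v1. acf_ideal I \<longrightarrow>
    (\<exists>E. finite E \<and> card E \<le> C \<and> exceptional_set I c \<tau> p i0 v0 v1 E))"
  have "\<exists>C. i0 < vdim p 1 \<longrightarrow> Q C (p, i0)" for p i0
    using path_dichotomy_aux[of i0 p] unfolding Q_def by (cases "i0 < vdim p 1") auto
  then have "\<forall>x. \<exists>C. snd x < vdim (fst x) 1 \<longrightarrow> Q C x" by simp
  from choice[OF this] obtain f where f: "\<And>x. snd x < vdim (fst x) 1 \<Longrightarrow> Q (f x) x" by blast
  define C where "C = (\<Sum>x\<in>UNIV \<times> {..<A + (\<beta> + t)}. f x)"
  show ?thesis
  proof (intro exI[of _ C] allI impI)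
    fix I :: "'a set" and c \<tau> p i0 v0 v1 assume I: "acf_ideal I" and i0: "i0 < vdim p 1"
    have "i0 < A + (\<beta> + t)" using i0 by (auto simp: vdim_def split: if_splits)
    then have "f (p, i0) \<le> C" unfolding C_def by (intro member_le_sum) auto
    moreover have "Q (f (p, i0)) (p, i0)" using f i0 by simp
    then obtain E where "finite E" "card E \<le> f (p, i0)" "exceptional_set I c \<tau> p i0 v0 v1 E"
      using I unfolding Q_def by blast
    ultimately show "\<exists>E. finite E \<and> card E \<le> C \<and> exceptional_set I c \<tau> p i0 v0 v1 E"
      using order_trans by blast
  qed
qed

end

section \<open>Configurations of paths\<close>

context acf_ideal
begin

text \<open>The coefficients are, up to sign, elementary symmetric functions of the
  \<open>z e\<close>.\<close>

lemma poly_fun_coeff_linear_prod: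
  assumes "finite S" "\<And>e. e \<in> S \<Longrightarrow> poly_fun I B G y 1 (z e)"
  shows "poly_fun I B G y (card S) (\<lambda>b. coeff (\<Prod>e\<in>S. [:- z e b, 1:]) d)"
  using assms
proof (induction S arbitrary: d rule: finite_induct)
  case empty
  show ?case using poly_fun.const[of I B G y "coeff 1 d"] by simp
next
  case (insert e S)
  define P where "P = (\<lambda>b. \<Prod>e\<in>S. [:- z e b, 1:])"
  have "poly_fun I B G y (1 + card S) (\<lambda>b. - z e b * coeff (P b) d)"
    unfolding P_def using insert by (intro poly_fun.mult poly_fun_uminus) auto
  moreover have "poly_fun I B G y (1 + card S) (\<lambda>b. coeff (pCons 0 (P b)) d)"
  proof (cases d)
    case 0
    then show ?thesis by (auto intro: poly_fun_mono[OF poly_fun.const])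
  next
    case (Suc d')
    then show ?thesis unfolding P_def using insert by (auto intro!: poly_fun_mono[OF insert.IH])
  qed
  ultimately have "poly_fun I B G y (1 + card S) (\<lambda>b. - z e b * coeff (P b) d + coeff (pCons 0 (P b)) d)"
    by (rule poly_fun.add)
  moreover have "(\<lambda>b. coeff (\<Prod>e\<in>insert e S. [:- z e b, 1:]) d) = (\<lambda>b. - z e b * coeff (P b) d + coeff (pCons 0 (P b)) d)"
    using insert.hyps by (simp add: P_def fun_eq_iff)
  ultimately show ?case using insert.hyps by simp
qed

text \<open>Lagrange interpolation with cleared denominators.\<close>

lemma poly_fun_interpolation:
  fixes f :: "'b \<Rightarrow> 'a poly" and S :: "'e set"
  assumes S: "finite S" and z: "\<And>e. e \<in> S \<Longrightarrow> poly_fun I B G y 1 (z e)"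
    and v: "\<And>e. e \<in> S \<Longrightarrow> poly_fun I B G y m (v e)"
    and deg: "\<And>b. b \<in> B \<Longrightarrow> degree (f b) < card S"
    and val: "\<And>b e. b \<in> B \<Longrightarrow> e \<in> S \<Longrightarrow> poly (f b) (z e b) - v e b \<in> I"
    and incong: "\<And>b e e'. b \<in> B \<Longrightarrow> e \<in> S \<Longrightarrow> e' \<in> S \<Longrightarrow> z e b - z e' b \<in> I \<Longrightarrow> e = e'"
  shows "poly_fun I B G y (m + card S * card S)
    (\<lambda>b. (\<Prod>e\<in>S. \<Prod>e'\<in>S - {e}. z e b - z e' b) * coeff (f b) d)"
proof -
  define \<Delta> where "\<Delta> = (\<lambda>e b. \<Prod>e'\<in>S - {e}. z e b - z e' b)"
  \<comment> \<open>The Lagrange polynomial times the product of all denominators: in the summand of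
    \<open>e\<close> its own denominator \<open>\<Delta> e\<close> has cancelled.\<close>
  define g where "g = (\<lambda>b. \<Sum>e\<in>S. Polynomial.smult (v e b * (\<Prod>e'\<in>S - {e}. \<Delta> e' b)) (\<Prod>e'\<in>S - {e}. [:- z e' b, 1:]))"
  have deg_g: "degree (g b) \<le> card S - 1" for b
    unfolding g_def
  proof (rule degree_sum_le[OF S])
    fix e assume "e \<in> S"
    have "degree (\<Prod>e'\<in>S - {e}. [:- z e' b, 1:]) = card (S - {e})"
      by (subst degree_prod_eq_sum_degree) auto
    then show "degree (Polynomial.smult (v e b * (\<Prod>e'\<in>S - {e}. \<Delta> e' b)) (\<Prod>e'\<in>S - {e}. [:- z e' b, 1:])) \<le> card S - 1"
      using degree_smult_le[of _ "\<Prod>e'\<in>S - {e}. [:- z e' b, 1:]"] \<open>e \<in> S\<close> S by (simp add: card_Diff_singleton)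
  qed
  have val_g: "poly (g b) (z e b) = v e b * (\<Prod>e\<in>S. \<Delta> e b)" if "e \<in> S" for e b
  proof -
    have "poly (g b) (z e b) = (\<Sum>e1\<in>S. v e1 b * (\<Prod>e'\<in>S - {e1}. \<Delta> e' b) * (\<Prod>e'\<in>S - {e1}. z e b - z e' b))"
      by (simp add: g_def poly_sum poly_prod)
    also have "\<dots> = (\<Sum>e1\<in>S. if e1 = e then v e b * (\<Prod>e'\<in>S - {e}. \<Delta> e' b) * \<Delta> e b else 0)"
    proof (intro sum.cong refl)
      fix e1 assume "e1 \<in> S"
      have "(\<Prod>e'\<in>S - {e1}. z e b - z e' b) = 0" if "e1 \<noteq> e"
        using S that \<open>e \<in> S\<close> by (intro prod_zero) (auto intro!: bexI[of _ e])
      then show "v e1 b * (\<Prod>e'\<in>S - {e1}. \<Delta> e' b) * (\<Prod>e'\<in>S - {e1}. z e b - z e' b)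
        = (if e1 = e then v e b * (\<Prod>e'\<in>S - {e}. \<Delta> e' b) * \<Delta> e b else 0)"
        by (auto simp: \<Delta>_def)
    qed
    also have "\<dots> = v e b * (\<Delta> e b * (\<Prod>e'\<in>S - {e}. \<Delta> e' b))" using S that by (simp add: mult_ac)
    also have "\<Delta> e b * (\<Prod>e'\<in>S - {e}. \<Delta> e' b) = (\<Prod>e\<in>S. \<Delta> e b)" using S that by (simp add: prod.remove)
    finally show ?thesis .
  qed
  have cong: "(\<Prod>e\<in>S. \<Delta> e b) * coeff (f b) d - coeff (g b) d \<in> I" if b: "b \<in> B" for b
  proof -
    define h where "h = Polynomial.smult (\<Prod>e\<in>S. \<Delta> e b) (f b) - g b"
    have inj: "inj_on (\<lambda>e. z e b) S" using incong[OF b] zero_mem by (auto simp: inj_on_def)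
    have "coeff h d \<in> I"
    proof (rule coeffs_mem_of_roots)
      have "card S > 0" using deg[OF b] by simp
      then have "degree h < card S" unfolding h_def
        using deg[OF b] deg_g[of b] degree_smult_le[of "\<Prod>e\<in>S. \<Delta> e b" "f b"]
        by (intro degree_diff_less) auto
      then show "degree h < card ((\<lambda>e. z e b) ` S)" by (simp add: card_image[OF inj])
      fix x assume "x \<in> (\<lambda>e. z e b) ` S"
      then obtain e where e: "e \<in> S" "x = z e b" by blast
      have "poly h x = (\<Prod>e\<in>S. \<Delta> e b) * (poly (f b) (z e b) - v e b)"
        using val_g[OF e(1)] e(2) by (simp add: h_def right_diff_distrib mult.commute)
      then show "poly h x \<in> I" using val[OF b e(1)] by (simp add: mult_mem)
      fix x' assume "x' \<in> (\<lambda>e. z e b) ` S" "x - x' \<in> I"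
      then show "x = x'" using incong[OF b] e by auto
    qed
    then show ?thesis by (simp add: h_def)
  qed
  have card': "card (S - {e}) \<le> card S" for e using S by (intro card_mono) auto
  have \<Delta>: "poly_fun I B G y (card S - 1) (\<Delta> e)" if "e \<in> S" for e
  proof -
    have "poly_fun I B G y (card (S - {e}) * 1) (\<Delta> e)"
      unfolding \<Delta>_def using S z that by (intro poly_fun_prod poly_fun_diff) auto
    then show ?thesis using S that by (simp add: card_Diff_singleton)
  qed
  have "poly_fun I B G y (m + card S * card S) (\<lambda>b. coeff (g b) d)"
    unfolding g_def coeff_sum coeff_smult
  proof (rule poly_fun_sum)
    fix e assume e: "e \<in> S"
    have "poly_fun I B G y (m + card (S - {e}) * (card S - 1) + card (S - {e}))
       (\<lambda>b. v e b * (\<Prod>e'\<in>S - {e}. \<Delta> e' b) * coeff (\<Prod>e'\<in>S - {e}. [:- z e' b, 1:]) d)"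
      using S z v \<Delta> e by (intro poly_fun.mult poly_fun_prod poly_fun_coeff_linear_prod) auto
    moreover have "m + card (S - {e}) * (card S - 1) + card (S - {e}) \<le> m + card S * card S"
    proof -
      have "card (S - {e}) * (card S - 1) + card (S - {e}) = card (S - {e}) * Suc (card S - 1)" by simp
      also have "\<dots> = card (S - {e}) * card S" using S e by (metis One_nat_def Suc_pred card_gt_0_iff empty_iff)
      also have "\<dots> \<le> card S * card S" using card' by simp
      finally show ?thesis by simp
    qed
    ultimately show "poly_fun I B G y (m + card S * card S)
       (\<lambda>b. v e b * (\<Prod>e'\<in>S - {e}. \<Delta> e' b) * coeff (\<Prod>e'\<in>S - {e}. [:- z e' b, 1:]) d)"
      by (rule poly_fun_mono)
  qed
  from poly_fun.weaken[OF this order_refl cong[unfolded \<Delta>_def]] show ?thesis .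
qed

lemma poly_fun_node_differences:
  assumes "finite S" "\<And>e. e \<in> S \<Longrightarrow> poly_fun I B G y 1 (z e)"
  shows "poly_fun I B G y (card S * card S) (\<lambda>b. \<Prod>e\<in>S. \<Prod>e'\<in>S - {e}. z e b - z e' b)"
proof (rule poly_fun_prod[OF assms(1)])
  fix e assume "e \<in> S"
  have "poly_fun I B G y (card (S - {e}) * 1) (\<lambda>b. \<Prod>e'\<in>S - {e}. z e b - z e' b)"
    using assms \<open>e \<in> S\<close> by (intro poly_fun_prod poly_fun_diff) auto
  then show "poly_fun I B G y (card S) (\<lambda>b. \<Prod>e'\<in>S - {e}. z e b - z e' b)"
    by (rule poly_fun_mono) (simp add: card_Diff1_le)
qed

end

section \<open>Dimension count along a path\<close>

lemma sum_alternating: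
  fixes g :: "bool \<Rightarrow> nat"
  shows "(\<Sum>j\<in>{0<..<2 * Suc m}. g (even j)) = Suc m * g False + m * g True"
proof (induction m)
  case 0
  have "{0<..<2 * Suc 0} = {1::nat}" by auto
  then show ?case by simp
next
  case (Suc m)
  have "{0<..<2 * Suc (Suc m)} = insert (2 * Suc m) (insert (Suc (2 * Suc m)) {0<..<2 * Suc m})" by auto
  with Suc show ?case by simp
qed

text \<open>The inequalities say that the 2k - 1 inner vertices of a path have at most as many
  coordinates as its 2k edges give equations, for endpoints in M and in N respectively.\<close>

locale path_field = path_system k A \<beta> t NT R + finite_subfield I F q
  for k A \<beta> t NT R :: nat and I :: "'a::idom set" and F q +
  assumes dims_M: "k * (\<beta> + t) + (k - 1) * A \<le> 2 * k * t"
    and dims_N: "k * A + (k - 1) * (\<beta> + t) \<le> 2 * k * t"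
begin

text \<open>Each position has a nonnegative excess \<open>vdim p j - t\<close> over the equations of
  one edge. All inner positions together have excess at most t, the equations of the one remaining
  edge, so any subset has too.\<close>

lemma sum_vdim_le:
  assumes "S \<subseteq> {0<..<2 * k}"
  shows "(\<Sum>j\<in>S. vdim p j) \<le> t * (card S + 1)"
proof -
  have t: "t \<le> vdim p j" for j using t_le by (simp add: vdim_def)
  obtain m where m: "k = Suc m" using k_pos by (cases k) auto
  have fin: "finite S" using assms finite_subset by blast
  have "(\<Sum>j\<in>{0<..<2 * k}. vdim p j) = k * vdim p 1 + (k - 1) * vdim p 2"
    using sum_alternating[of "\<lambda>b. if b = p then A else \<beta> + t" m] by (simp add: vdim_def m)
  also have "\<dots> \<le> 2 * k * t" using dims_M dims_N by (cases p) (simp_all add: vdim_def)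
  finally have le: "(\<Sum>j\<in>{0<..<2 * k}. vdim p j) \<le> 2 * k * t" .
  have "(\<Sum>j\<in>{0<..<2 * k}. vdim p j) = (\<Sum>j\<in>{0<..<2 * k}. vdim p j - t) + (2 * k - 1) * t"
  proof -
    have "(\<Sum>j\<in>{0<..<2 * k}. vdim p j) = (\<Sum>j\<in>{0<..<2 * k}. (vdim p j - t) + t)"
      using t by simp
    then show ?thesis by (simp only: sum.distrib) simp
  qed
  moreover have "2 * k * t = (2 * k - 1) * t + t" using k_pos by (cases k) (auto simp: algebra_simps)
  ultimately have "(\<Sum>j\<in>{0<..<2 * k}. vdim p j - t) \<le> t" using le by linarith
  moreover have "(\<Sum>j\<in>S. vdim p j - t) \<le> (\<Sum>j\<in>{0<..<2 * k}. vdim p j - t)"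
    using assms by (intro sum_mono2) auto
  moreover have "(\<Sum>j\<in>S. vdim p j) = (\<Sum>j\<in>S. vdim p j - t) + card S * t"
  proof -
    have "(\<Sum>j\<in>S. vdim p j) = (\<Sum>j\<in>S. (vdim p j - t) + t)" using t by simp
    then show ?thesis by (simp only: sum.distrib) simp
  qed
  ultimately show ?thesis by (simp add: algebra_simps)
qed

text \<open>The last condition separates position 1 of each path from all vertices of earlier paths
  in the same part, so that every prescribed value \<open>u l\<close> constrains a new
  vertex.\<close>

definition config ::
  "(nat \<Rightarrow> nat \<Rightarrow> nat \<Rightarrow> 'a) \<Rightarrow> (nat \<Rightarrow> 'a) \<Rightarrow> bool \<Rightarrow> (nat \<Rightarrow> 'a) \<Rightarrow> (nat \<Rightarrow> 'a) \<Rightarrow> nat \<Rightarrow> (nat \<Rightarrow> 'a) \<Rightarrow> nat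
    \<Rightarrow> (nat \<Rightarrow> nat \<Rightarrow> nat \<Rightarrow> 'a) \<Rightarrow> bool" where
  "config c \<tau> p v0 v1 i0 u L W \<longleftrightarrow> (\<forall>l<L. is_path I c \<tau> p (W l) \<and> W l 0 = v0 \<and> W l (2 * k) = v1 \<and>
     W l 1 i0 = u l \<and> (\<forall>l'<l. \<forall>j\<le>2 * k. odd j \<longrightarrow> \<not> vec_cong I (vdim p 1) (W l 1) (W l' j)))"

text \<open>Each earlier path excludes at most 2k + 1 values of coordinate \<open>i0\<close>; any
  other value in \<open>U\<close> gives a path whose first inner vertex is new.\<close>

lemma greedy_config:
  assumes U: "finite U" "U \<subseteq> F" and card: "L * (2 * k + 1) < card U" and i0: "i0 < vdim p 1"
    and paths: "\<And>u. u \<in> U \<Longrightarrow> joined I c \<tau> p i0 v0 v1 u"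
  shows "\<exists>W u. (\<forall>l<L. u l \<in> U) \<and> config c \<tau> p v0 v1 i0 u L W"
  using card
proof (induction L)
  case 0
  then show ?case by (auto simp: config_def)
next
  case (Suc L)
  then obtain W u where W: "\<forall>l<L. u l \<in> U" "config c \<tau> p v0 v1 i0 u L W" by auto
  define X where "X = {x \<in> U. \<exists>e \<in> (\<lambda>(l, j). W l j i0) ` ({..<L} \<times> {..2 * k}). x - e \<in> I}"
  have "card X \<le> card ((\<lambda>(l, j). W l j i0) ` ({..<L} \<times> {..2 * k}))"
    using U(2) F_incong by (intro card_le_of_cover[THEN conjunct2]) (auto simp: X_def)
  also have "\<dots> \<le> card ({..<L} \<times> {..2 * k})" by (intro card_image_le) auto
  also have "\<dots> = L * (2 * k + 1)" by simp
  finally have "card X < card U" using Suc.prems by simp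
  moreover have "X \<subseteq> U" by (auto simp: X_def)
  ultimately obtain x where x: "x \<in> U" "x \<notin> X" by (metis less_irrefl subsetI subset_antisym)
  obtain V where V: "is_path I c \<tau> p V" "V 0 = v0" "V (2 * k) = v1" "V 1 i0 = x" 
    using paths[OF x(1)] unfolding joined_def by blast
  have "\<not> vec_cong I (vdim p 1) V1 (W l j)" if "l < L" "j \<le> 2 * k" "V1 i0 = x" for l j V1
  proof
    assume "vec_cong I (vdim p 1) V1 (W l j)"
    then have "x - W l j i0 \<in> I" using i0 that by (auto simp: vec_cong_def)
    then show False using x that by (auto simp: X_def)
  qed
  then have "config c \<tau> p v0 v1 i0 (u(L := x)) (Suc L) (W(L := V))"
    using W(2) V by (auto simp: config_def less_Suc_eq)
  moreover have "\<forall>l<Suc L. (u(L := x)) l \<in> U" using W(1) x by (auto simp: less_Suc_eq)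
  ultimately show ?case by blast
qed

end

section \<open>Coincidences, new edges and separating forms\<close>

context path_field
begin

lemma vec_cong_sym: "vec_cong I m v w \<Longrightarrow> vec_cong I m w v"
  by (simp add: vec_cong_def diff_mem_commute)

text \<open>The last t coordinates of \<open>n\<close> are values of the polynomials at the point
  formed by \<open>x\<close> and the first \<beta> coordinates, so this point determines the
  edge.\<close>

lemma adjacent_determines:
  assumes adj: "adjacent I c \<tau> x n" "adjacent I c \<tau> x' n'"
    and x: "vec_cong I A x x'" and n: "vec_cong I \<beta> n n'"
  shows "vec_cong I (\<beta> + t) n n'"
proof -
  have lin: "lin_form s x n - lin_form s x' n' \<in> I" for s
    unfolding lin_form_def using x n
    by (intro cong_sum cong_mult) (auto simp: vec_cong_def zero_mem)
  have val: "poly_val c \<tau> x n i - poly_val c \<tau> x' n' i \<in> I" for i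
    unfolding poly_val_def by (intro cong_sum cong_mult cong_power lin) (simp add: zero_mem)
  have last: "n (\<beta> + i) - n' (\<beta> + i) \<in> I" if "i < t" for i
  proof -
    have "n (\<beta> + i) - poly_val c \<tau> x n i \<in> I" "poly_val c \<tau> x' n' i - n' (\<beta> + i) \<in> I"
      using adj that by (auto simp: adjacent_def diff_mem_commute[of "n (\<beta> + i)"])
    then show ?thesis using diff_mem_trans val by blast
  qed
  show ?thesis unfolding vec_cong_def
  proof (intro allI impI)
    fix i assume "i < \<beta> + t"
    then show "n i - n' i \<in> I" using n last[of "i - \<beta>"] by (cases "i < \<beta>") (auto simp: vec_cong_def)
  qed
qed

text \<open>Edge \<open>j\<close> of a path joins the positions \<open>j\<close> and \<open>j + 1\<close>. Positions are new relative to the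
  paths with smaller index.\<close>

definition pattern :: "bool \<Rightarrow> nat \<Rightarrow> (nat \<Rightarrow> nat \<Rightarrow> nat \<Rightarrow> 'a) \<Rightarrow> ((nat \<times> nat) \<times> (nat \<times> nat)) set" where
  "pattern p L W = {((l, j), (l', j')). l < L \<and> l' < L \<and> j \<le> 2 * k \<and> j' \<le> 2 * k \<and> even j = even j' \<and>
     vec_cong I (vdim p j) (W l j) (W l' j')}"

definition new_pos :: "((nat \<times> nat) \<times> (nat \<times> nat)) set \<Rightarrow> nat \<Rightarrow> nat set" where
  "new_pos Q l = {j \<in> {0<..<2 * k}. \<forall>l'<l. \<forall>j'\<le>2 * k. ((l, j), (l', j')) \<notin> Q}"

text \<open>The edge before every new position and the edge after the last one: one edge more than
  new positions, each with a new end.\<close>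

definition new_edges :: "((nat \<times> nat) \<times> (nat \<times> nat)) set \<Rightarrow> nat \<Rightarrow> nat set" where
  "new_edges Q l = insert (Max (new_pos Q l)) ((\<lambda>j. j - 1) ` new_pos Q l)"

lemma new_pos_subset: "new_pos Q l \<subseteq> {0<..<2 * k}" and finite_new_pos: "finite (new_pos Q l)"
  by (auto simp: new_pos_def)

lemma one_in_new_pos:
  assumes "config c \<tau> p v0 v1 i0 u L W" "l < L"
  shows "1 \<in> new_pos (pattern p L W) l"
  using assms k_pos by (auto simp: new_pos_def pattern_def config_def)

lemma new_edges:
  assumes "new_pos Q l \<noteq> {}"
  shows "new_edges Q l \<subseteq> {..<2 * k}" "card (new_edges Q l) = card (new_pos Q l) + 1"
    and "j \<in> new_edges Q l \<Longrightarrow> j \<in> new_pos Q l \<or> Suc j \<in> new_pos Q l"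
proof -
  let ?S = "new_pos Q l"
  have Max: "Max ?S \<in> ?S" using Max_in[OF finite_new_pos assms] .
  have pos: "0 < j \<and> j < 2 * k" if "j \<in> ?S" for j using that new_pos_subset by fastforce
  show "new_edges Q l \<subseteq> {..<2 * k}"
    using pos[OF Max] pos by (auto simp: new_edges_def intro: less_imp_diff_less)
  have "inj_on (\<lambda>j. j - 1) ?S"
  proof (rule inj_onI)
    fix x y assume "x \<in> ?S" "y \<in> ?S" "x - 1 = y - 1"
    then show "x = y" using pos[of x] pos[of y] by linarith
  qed
  then have "card ((\<lambda>j. j - 1) ` ?S) = card ?S" by (rule card_image)
  moreover have "Max ?S \<notin> (\<lambda>j. j - 1) ` ?S"
  proof
    assume "Max ?S \<in> (\<lambda>j. j - 1) ` ?S"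
    then obtain j where j: "j \<in> ?S" "Max ?S = j - 1" by blast
    then show False using Max_ge[OF finite_new_pos j(1)] pos[OF j(1)] by linarith
  qed
  ultimately show "card (new_edges Q l) = card ?S + 1"
    using finite_new_pos by (simp add: new_edges_def)
  show "j \<in> ?S \<or> Suc j \<in> ?S" if "j \<in> new_edges Q l"
    using that Max pos by (force simp: new_edges_def)
qed

text \<open>By \<open>adjacent_determines\<close> both edges would have the same ends modulo
  \<open>I\<close>. On different paths this contradicts the new end of the edge on the later path,
  on one path the distinctness of its positions.\<close>

lemma edge_points_distinct_le:
  assumes conf: "config c \<tau> p v0 v1 i0 u L W" and Q: "Q = pattern p L W"
    and l: "l < L" "l' \<le> l" and j: "j \<in> new_edges Q l" "j' \<in> new_edges Q l'"
    and x: "vec_cong I A (W l (xpos p j)) (W l' (xpos p j'))"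
    and n: "vec_cong I \<beta> (W l (npos p j)) (W l' (npos p j'))"
  shows "l = l' \<and> j = j'"
proof -
  have l': "l' < L" using l by simp
  have ne: "new_pos Q l \<noteq> {}" "new_pos Q l' \<noteq> {}"
    using one_in_new_pos[OF conf l(1)] one_in_new_pos[OF conf l'] Q by auto
  have jk: "j < 2 * k" "j' < 2 * k" using new_edges(1)[OF ne(1)] new_edges(1)[OF ne(2)] j by auto
  have "adjacent I c \<tau> (W l (xpos p j)) (W l (npos p j))"
       "adjacent I c \<tau> (W l' (xpos p j')) (W l' (npos p j'))"
    using conf l(1) l' jk by (auto simp: config_def is_path_def)
  from adjacent_determines[OF this x n] have n': "vec_cong I (\<beta> + t) (W l (npos p j)) (W l' (npos p j'))" .
  have par: "even (xpos p j) = even (xpos p j')" "even (npos p j) = even (npos p j')"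
    by (auto simp: xpos_def npos_def)
  have inQ: "((l, xpos p j), (l', xpos p j')) \<in> Q" "((l, npos p j), (l', npos p j')) \<in> Q"
    unfolding Q pattern_def using l(1) l' jk x n' par
    by (auto simp: vdim_xpos vdim_npos xpos_le npos_le)
  have "\<not> l' < l"
  proof
    assume "l' < l"
    then have "xpos p j \<notin> new_pos Q l" "npos p j \<notin> new_pos Q l"
      using inQ xpos_le[OF jk(2)] npos_le[OF jk(2)] by (auto simp: new_pos_def)
    moreover have "j \<in> {xpos p j, npos p j}" "Suc j \<in> {xpos p j, npos p j}"
      by (auto simp: xpos_def npos_def)
    ultimately show False using new_edges(3)[OF ne(1) j(1)] by auto
  qed
  then have eq: "l = l'" using l by simp
  have path: "is_path I c \<tau> p (W l)" using conf l by (simp add: config_def)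
  have "xpos p j = xpos p j'" "npos p j = npos p j'"
    using path x n' par jk unfolding is_path_def eq
    by (metis xpos_le vdim_xpos, metis npos_le vdim_npos)
  then have "j = j'" by (auto simp: xpos_def npos_def split: if_splits)
  with eq show ?thesis by simp
qed

lemma edge_points_distinct:
  assumes conf: "config c \<tau> p v0 v1 i0 u L W" and Q: "Q = pattern p L W"
    and l: "l < L" "l' < L" and j: "j \<in> new_edges Q l" "j' \<in> new_edges Q l'"
    and x: "vec_cong I A (W l (xpos p j)) (W l' (xpos p j'))"
    and n: "vec_cong I \<beta> (W l (npos p j)) (W l' (npos p j'))"
  shows "(l, j) = (l', j')"
proof (cases "l' \<le> l")
  case True
  then show ?thesis using edge_points_distinct_le[OF conf Q l(1) True j x n] by simp
next
  case False
  then have "l \<le> l'" by simp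
  from edge_points_distinct_le[OF conf Q l(2) this j(2,1) vec_cong_sym[OF x] vec_cong_sym[OF n]]
  show ?thesis by simp
qed

definition edge_val :: "'a \<Rightarrow> bool \<Rightarrow> (nat \<Rightarrow> nat \<Rightarrow> nat \<Rightarrow> 'a) \<Rightarrow> nat \<times> nat \<Rightarrow> 'a" where
  "edge_val s p W e = lin_form s (W (fst e) (xpos p (snd e))) (W (fst e) (npos p (snd e)))"

text \<open>The difference of the forms is a polynomial in \<tau> whose coefficients are the A +
  \<beta> coordinate differences, not all in \<open>I\<close>.\<close>

lemma separating_form_pair:
  assumes \<tau>: "inj_on \<tau> {..<NT}" "\<tau> ` {..<NT} \<subseteq> F"
    and neq: "\<not> (vec_cong I A x x' \<and> vec_cong I \<beta> n n')"
  shows "card {s \<in> {..<NT}. lin_form (\<tau> s) x n - lin_form (\<tau> s) x' n' \<in> I} \<le> A + \<beta>"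
proof -
  define d where "d = (\<lambda>m. if m < A then x m - x' m else n (m - A) - n' (m - A))"
  define P where "P = (\<Sum>m<A + \<beta>. monom (d m) m)"
  have coeff: "coeff P m = (if m < A + \<beta> then d m else 0)" for m
    by (simp add: P_def coeff_sum coeff_monom)
  have "poly P s = (\<Sum>m<A + \<beta>. d m * s ^ m)" for s by (simp add: P_def poly_sum poly_monom)
  then have P: "poly P s = lin_form s x n - lin_form s x' n'" for s
    unfolding lin_form_def sum_subtractf[symmetric]
    by (simp only:) (intro sum.cong, auto simp: d_def left_diff_distrib)
  obtain m where m: "m < A + \<beta>" "d m \<notin> I"
  proof -
    from neq consider m where "m < A" "x m - x' m \<notin> I" | m where "m < \<beta>" "n m - n' m \<notin> I"
      by (auto simp: vec_cong_def)
    then show ?thesis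
    proof cases
      case 1
      then show ?thesis using that[of m] by (simp add: d_def)
    next
      case 2
      then show ?thesis using that[of "A + m"] by (simp add: d_def)
    qed
  qed
  have "degree P \<le> A + \<beta>" by (rule degree_le) (simp add: coeff)
  then obtain E where E: "finite E" "card E \<le> A + \<beta>" "\<And>s. poly P s \<in> I \<Longrightarrow> \<exists>e\<in>E. s - e \<in> I"
    using root_classes[of P "A + \<beta>" m] m coeff by auto
  let ?X = "{s \<in> {..<NT}. lin_form (\<tau> s) x n - lin_form (\<tau> s) x' n' \<in> I}"
  have "card (\<tau> ` ?X) \<le> card E"
  proof (rule card_le_of_cover[THEN conjunct2, OF E(1)])
    show "\<exists>e\<in>E. s - e \<in> I" if "s \<in> \<tau> ` ?X" for s using that E(3) P by auto
    show "a = b" if "a \<in> \<tau> ` ?X" "b \<in> \<tau> ` ?X" "a - b \<in> I" for a b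
      using that \<tau>(2) by (intro F_incong) auto
  qed
  moreover have "card (\<tau> ` ?X) = card ?X" using \<tau>(1) by (intro card_image) (auto simp: inj_on_def)
  ultimately show ?thesis using E(2) by simp
qed

text \<open>There are at most \<open>R * R\<close> pairs of new edges, each spoilt by at most A +
  \<beta> of the forms; this dictates the size of \<open>NT\<close>.\<close>

lemma separating_form:
  assumes conf: "config c \<tau> p v0 v1 i0 u L W" and Q: "Q = pattern p L W"
    and \<tau>: "inj_on \<tau> {..<NT}" "\<tau> ` {..<NT} \<subseteq> F"
    and Ed: "Ed = (SIGMA l:{..<L}. new_edges Q l)" "finite Ed" "card Ed \<le> R" and NT: "NT > R * R * (A + \<beta>)"
  shows "\<exists>s<NT. \<forall>e\<in>Ed. \<forall>e'\<in>Ed. edge_val (\<tau> s) p W e - edge_val (\<tau> s) p W e' \<in> I \<longrightarrow> e = e'"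
proof -
  define X where "X = (\<lambda>(e, e'). {s \<in> {..<NT}. edge_val (\<tau> s) p W e - edge_val (\<tau> s) p W e' \<in> I})"
  define pairs where "pairs = {(e, e') \<in> Ed \<times> Ed. e \<noteq> e'}"
  have fin: "finite pairs" and card_pairs: "card pairs \<le> R * R"
  proof -
    have sub: "pairs \<subseteq> Ed \<times> Ed" by (auto simp: pairs_def)
    then show "finite pairs" using Ed(2) finite_subset by blast
    have "card pairs \<le> card (Ed \<times> Ed)" using sub Ed(2) by (intro card_mono) auto
    also have "\<dots> \<le> R * R" using Ed(3) by (simp add: card_cartesian_product mult_mono)
    finally show "card pairs \<le> R * R" .
  qed
  have "card (X w) \<le> A + \<beta>" if "w \<in> pairs" for w
  proof -
    obtain l j l' j' where w: "w = ((l, j), (l', j'))" by (metis surj_pair)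
    with that Ed have "l < L" "l' < L" "j \<in> new_edges Q l" "j' \<in> new_edges Q l'" "(l, j) \<noteq> (l', j')"
      by (auto simp: pairs_def)
    then have "\<not> (vec_cong I A (W l (xpos p j)) (W l' (xpos p j')) \<and> vec_cong I \<beta> (W l (npos p j)) (W l' (npos p j')))"
      using edge_points_distinct[OF conf Q] by blast
    from separating_form_pair[OF \<tau> this] show ?thesis by (simp add: X_def w edge_val_def)
  qed
  then have "(\<Sum>w\<in>pairs. card (X w)) \<le> (\<Sum>w\<in>pairs. A + \<beta>)" by (rule sum_mono)
  with card_UN_le[OF fin, of X] have "card (\<Union>w\<in>pairs. X w) \<le> (\<Sum>w\<in>pairs. A + \<beta>)" by linarith
  also have "\<dots> \<le> R * R * (A + \<beta>)" using card_pairs by simp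
  finally have "card (\<Union>w\<in>pairs. X w) < card {..<NT}" using NT by simp
  moreover have "(\<Union>w\<in>pairs. X w) \<subseteq> {..<NT}" by (auto simp: X_def)
  ultimately obtain s where "s < NT" "s \<notin> (\<Union>w\<in>pairs. X w)"
    by (metis lessThan_iff less_irrefl subsetI subset_antisym)
  then show ?thesis by (intro exI[of _ s]) (auto simp: X_def pairs_def)
qed

end

section \<open>Coefficient vectors with a common coincidence pattern\<close>

context path_field
begin

definition coef_index :: "(nat \<times> nat \<times> nat) set" where
  "coef_index = {..<t} \<times> {..<NT} \<times> {..<R}"

definition coef_fun :: "(nat \<times> nat \<times> nat \<Rightarrow> 'a) \<Rightarrow> nat \<Rightarrow> nat \<Rightarrow> nat \<Rightarrow> 'a" where
  "coef_fun b i \<sigma> d = b (i, \<sigma>, d)"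

lemma poly_fun_lin_form:
  assumes "\<And>m. m < A \<Longrightarrow> poly_fun I B G y 1 (\<lambda>b. x b m)" "\<And>m. m < \<beta> \<Longrightarrow> poly_fun I B G y 1 (\<lambda>b. n b m)"
  shows "poly_fun I B G y 1 (\<lambda>b. lin_form s (x b) (n b))"
  unfolding lin_form_def
proof (rule poly_fun_sum)
  fix m assume m: "m \<in> {..<A + \<beta>}"
  have "poly_fun I B G y 1 (\<lambda>b. if m < A then x b m else n b (m - A))"
    using m assms by (cases "m < A") auto
  from poly_fun.mult[OF this poly_fun.const] show
    "poly_fun I B G y 1 (\<lambda>b. (if m < A then x b m else n b (m - A)) * s ^ m)" by simp
qed

lemma sum_split_block:
  fixes T :: "nat \<Rightarrow> nat \<Rightarrow> 'b::comm_monoid_add"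
  assumes "s < m" "r \<le> n"
  shows "(\<Sum>\<sigma><m. \<Sum>d<n. T \<sigma> d) = (\<Sum>d<r. T s d) + (\<Sum>\<sigma><m. \<Sum>d<n. if \<sigma> = s \<and> d < r then 0 else T \<sigma> d)"
proof -
  have "(\<Sum>\<sigma><m. \<Sum>d<n. T \<sigma> d) = (\<Sum>\<sigma><m. (\<Sum>d<n. if \<sigma> = s \<and> d < r then T \<sigma> d else 0)
     + (\<Sum>d<n. if \<sigma> = s \<and> d < r then 0 else T \<sigma> d))"
    unfolding sum.distrib[symmetric] by (intro sum.cong) auto
  also have "\<dots> = (\<Sum>\<sigma><m. \<Sum>d<n. if \<sigma> = s \<and> d < r then T \<sigma> d else 0)
     + (\<Sum>\<sigma><m. \<Sum>d<n. if \<sigma> = s \<and> d < r then 0 else T \<sigma> d)" by (rule sum.distrib)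
  also have "(\<Sum>\<sigma><m. \<Sum>d<n. if \<sigma> = s \<and> d < r then T \<sigma> d else 0) = (\<Sum>\<sigma><m. if \<sigma> = s then (\<Sum>d<n. if d < r then T s d else 0) else 0)"
    by (intro sum.cong) auto
  also have "\<dots> = (\<Sum>d<n. if d < r then T s d else 0)" using assms(1) by simp
  also have "\<dots> = (\<Sum>d<r. T s d)"
    using assms(2) by (intro sum.mono_neutral_cong_right) auto
  finally show ?thesis .
qed

text \<open>Let r be the number of new edges. The edge equations are interpolation conditions at r
  distinct points, so in each of the t polynomials r coefficients are rational functions of the
  other coefficients and the vertices. By \<open>sum_vdim_le\<close> the new vertices have at most
  \<open>t * r\<close> coordinates. Thus eliminating \<open>t * r\<close> coefficients pays for all
  of them, and the prescribed values save \<open>L\<close> parameters.\<close>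

lemma card_class_le:
  assumes B: "B \<subseteq> coef_index \<rightarrow>\<^sub>E F" "B \<noteq> {}" and L: "L > 0" "L * (2 * k) \<le> R" and i0: "i0 < vdim p 1"
    and conf: "\<And>b. b \<in> B \<Longrightarrow> config (coef_fun b) \<tau> p v0 v1 i0 u L (W b)"
    and pat: "\<And>b. b \<in> B \<Longrightarrow> pattern p L (W b) = Q"
    and s: "s < NT" and sep: "\<And>b e e'. b \<in> B \<Longrightarrow> e \<in> (SIGMA l:{..<L}. new_edges Q l) \<Longrightarrow>
        e' \<in> (SIGMA l:{..<L}. new_edges Q l) \<Longrightarrow>
        edge_val (\<tau> s) p (W b) e - edge_val (\<tau> s) p (W b) e' \<in> I \<Longrightarrow> e = e'"
  shows "card B \<le> ((card coef_index * (R + 1 + R * R) + 1) * q) ^ (card coef_index - L)"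
proof -
  define Ed where "Ed = (SIGMA l:{..<L}. new_edges Q l)"
  define r where "r = card Ed"
  obtain b0 where b0: "b0 \<in> B" using B(2) by blast
  have one: "1 \<in> new_pos Q l" if "l < L" for l
    using one_in_new_pos[OF conf[OF b0] that] pat[OF b0] by simp
  have ne: "new_pos Q l \<noteq> {}" if "l < L" for l using one[OF that] by blast
  have finEd: "finite Ed" using new_edges(1)[OF ne] unfolding Ed_def
    by (intro finite_SigmaI) (auto intro: finite_subset)
  have r: "r = (\<Sum>l<L. card (new_pos Q l) + 1)"
    unfolding r_def Ed_def using new_edges(1,2)[OF ne]
    by (subst card_SigmaI) (auto intro: finite_subset)
  have r_le: "r \<le> R"
  proof -
    have "card (new_pos Q l) + 1 \<le> 2 * k" for l
      using card_mono[OF _ new_pos_subset[of Q l]] k_pos by simp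
    then have "r \<le> (\<Sum>l<L. 2 * k)" unfolding r by (intro sum_mono)
    then show ?thesis using L by simp
  qed
  have "r \<ge> L" unfolding r using sum_mono[of "{..<L}" "\<lambda>_. 1" "\<lambda>l. card (new_pos Q l) + 1"] by simp
  with L have r_pos: "r > 0" by simp

  \<comment> \<open>\<open>GV\<close> indexes the free vertex coordinates, without the prescribed
    one on each path; \<open>GC\<close> indexes the coefficients outside the block that is solved
    for.\<close>
  define GV where "GV = (SIGMA l:{..<L}. (SIGMA j:new_pos Q l. {..<vdim p j}) - {(1, i0)})"
  define GC where "GC = coef_index - {..<t} \<times> {s} \<times> {..<r}"
  define G where "G = GV <+> GC"
  define y where "y = (\<lambda>g b. case g of Inl (l, j, i) \<Rightarrow> W b l j i | Inr x \<Rightarrow> b x)"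
  have finGV: "finite GV" unfolding GV_def by (auto intro!: finite_SigmaI finite_new_pos)
  have fin_index: "finite coef_index" by (simp add: coef_index_def)
  have finG: "finite G" unfolding G_def GC_def using finGV fin_index by simp
  have cardG: "card G + L \<le> card coef_index"
  proof -
    define X where "X = (\<lambda>l. \<Sum>j\<in>new_pos Q l. vdim p j)"
    have Xpos: "X l \<ge> 1" if "l < L" for l
    proof -
      have "vdim p 1 \<le> X l" unfolding X_def using finite_new_pos one[OF that] by (intro member_le_sum) auto
      then show ?thesis using i0 by simp
    qed
    have "card ((SIGMA j:new_pos Q l. {..<vdim p j}) - {(1, i0)}) = X l - 1" if "l < L" for l
      using one[OF that] i0 finite_new_pos[of Q l] by (subst card_Diff_singleton) (auto simp: X_def)
    then have "card GV = (\<Sum>l<L. X l - 1)" unfolding GV_def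
      by (subst card_SigmaI) (auto intro!: finite_SigmaI finite_new_pos)
    moreover have "(\<Sum>l<L. X l - 1) + L = (\<Sum>l<L. X l)"
    proof -
      have "(\<Sum>l<L. X l) = (\<Sum>l<L. (X l - 1) + 1)" using Xpos by (intro sum.cong) force+
      also have "\<dots> = (\<Sum>l<L. X l - 1) + L" by (simp only: sum.distrib) simp
      finally show ?thesis by simp
    qed
    moreover have "(\<Sum>l<L. X l) \<le> t * r"
      unfolding r sum_distrib_left X_def by (intro sum_mono sum_vdim_le new_pos_subset)
    moreover have "card GC = card coef_index - t * r"
      unfolding GC_def using s r_le by (subst card_Diff_subset) (auto simp: coef_index_def card_cartesian_product)
    moreover have "t * r \<le> card coef_index"
    proof -
      have "t * r \<le> t * (NT * R)" using r_le s by (intro mult_le_mono2) (metis le_trans mult_le_mono1 mult_1 Suc_leI less_nat_zero_code neq0_conv One_nat_def)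
      then show ?thesis by (simp add: coef_index_def card_cartesian_product)
    qed
    moreover have "card G = card GV + card GC" unfolding G_def using finGV fin_index
      by (intro card_Plus) (auto simp: GC_def)
    ultimately show ?thesis by linarith
  qed

  \<comment> \<open>Induction over the paths: an old inner position coincides with one on an earlier
    path, which is the same for all \<open>b\<close> as the class has a fixed pattern. Endpoints and
    prescribed coordinates are constants.\<close>
  have coord: "poly_fun I B G y 1 (\<lambda>b. W b l j i)" if "l < L" "j \<le> 2 * k" "i < vdim p j" for l j i
    using that
  proof (induction l arbitrary: j i rule: less_induct)
    case (less l)
    have ends: "W b l 0 = v0" "W b l (2 * k) = v1" "W b l 1 i0 = u l" if "b \<in> B" for b
      using conf[OF that] less.prems(1) by (auto simp: config_def)
    consider "j = 0" | "j = 2 * k" | "j \<in> new_pos Q l" | "0 < j" "j < 2 * k" "j \<notin> new_pos Q l"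
      using less.prems(2) by linarith
    then show ?case
    proof cases
      case 1
      show ?thesis by (rule poly_fun.weaken[OF poly_fun.const[of I B G y "v0 i"]]) (auto simp: 1 ends zero_mem)
    next
      case 2
      show ?thesis by (rule poly_fun.weaken[OF poly_fun.const[of I B G y "v1 i"]]) (auto simp: 2 ends zero_mem)
    next
      case 3
      show ?thesis
      proof (cases "(j, i) = (1, i0)")
        case True
        then show ?thesis using ends
          by (intro poly_fun.weaken[OF poly_fun.const[of I B G y "u l"]]) (auto simp: zero_mem)
      next
        case False
        then have "Inl (l, j, i) \<in> G" using 3 less.prems by (auto simp: G_def GV_def)
        from poly_fun.gen[OF this, of I B y] show ?thesis by (simp add: y_def)
      qed
    next
      case 4
      then obtain l' j' where l': "l' < l" "j' \<le> 2 * k" "((l, j), (l', j')) \<in> Q"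
        by (auto simp: new_pos_def)
      then have "even j = even j'" using pat[OF b0] by (auto simp: pattern_def)
      then have dim: "vdim p j' = vdim p j" by (simp add: vdim_def)
      have "poly_fun I B G y 1 (\<lambda>b. W b l' j' i)"
        using l' less.prems dim by (intro less.IH) auto
      then show ?thesis
      proof (rule poly_fun.weaken)
        fix b assume "b \<in> B"
        then have "((l, j), (l', j')) \<in> pattern p L (W b)" using l'(3) pat by simp
        then show "W b l j i - W b l' j' i \<in> I"
          using less.prems by (auto simp: pattern_def vec_cong_def)
      qed simp
    qed
  qed

  have EdD: "fst e < L" "snd e < 2 * k" if "e \<in> Ed" for e
    using that new_edges(1)[OF ne, of "fst e"] by (auto simp: Ed_def)
  have edge: "poly_fun I B G y 1 (\<lambda>b. edge_val z p (W b) e)" if "e \<in> Ed" for e z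
    unfolding edge_val_def
    by (intro poly_fun_lin_form coord EdD[OF that] xpos_le npos_le) (auto simp: vdim_xpos vdim_npos)
  define z where "z = (\<lambda>e b. edge_val (\<tau> s) p (W b) e)"
  define \<delta> where "\<delta> = (\<lambda>b. \<Prod>e\<in>Ed. \<Prod>e'\<in>Ed - {e}. z e b - z e' b)"
  have z: "poly_fun I B G y 1 (z e)" if "e \<in> Ed" for e
    unfolding z_def by (rule edge[OF that])
  have incong: "e = e'" if "b \<in> B" "e \<in> Ed" "e' \<in> Ed" "z e b - z e' b \<in> I" for b e e'
    using sep[OF that(1)] that unfolding z_def Ed_def by blast
  have rr: "r * r \<le> R * R" using r_le by (intro mult_mono) auto
  have \<delta>: "poly_fun I B G y (r * r) \<delta>"
    unfolding \<delta>_def r_def by (intro poly_fun_node_differences finEd z)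

  have solved: "poly_fun I B G y (R + 1 + R * R) (\<lambda>b. \<delta> b * b (i, s, d))" if i: "i < t" and d: "d < r" for i d
  proof -
    \<comment> \<open>\<open>f\<close> is the block of polynomial \<open>i\<close> as a polynomial
      in the form \<open>s\<close>; \<open>v e\<close> is the value that the equation of edge
      \<open>e\<close> forces on it once the other terms are subtracted.\<close>
    define f where "f = (\<lambda>b :: nat \<times> nat \<times> nat \<Rightarrow> 'a. \<Sum>d<r. monom (b (i, s, d)) d)"
    define v where "v = (\<lambda>e b. W b (fst e) (npos p (snd e)) (\<beta> + i) -
       (\<Sum>\<sigma><NT. \<Sum>d<R. if \<sigma> = s \<and> d < r then 0 else b (i, \<sigma>, d) * edge_val (\<tau> \<sigma>) p (W b) e ^ d))"
    have coeff: "coeff (f b) d = (if d < r then b (i, s, d) else 0)" for b d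
      by (simp add: f_def coeff_sum coeff_monom)
    have "degree (f b) < card Ed" for b
    proof -
      have "degree (f b) \<le> r - 1" by (rule degree_le) (use r_pos in \<open>auto simp: coeff\<close>)
      then show ?thesis using r_pos by (simp add: r_def)
    qed
    moreover have "poly_fun I B G y (R + 1) (v e)" if e: "e \<in> Ed" for e
      unfolding v_def
    proof (intro poly_fun_diff poly_fun_sum)
      show "poly_fun I B G y (R + 1) (\<lambda>b. W b (fst e) (npos p (snd e)) (\<beta> + i))"
        using EdD[OF e] i by (intro poly_fun_mono[OF coord] npos_le) (auto simp: vdim_npos)
      fix \<sigma> d assume \<sigma>: "\<sigma> \<in> {..<NT}" and d: "d \<in> {..<R}"
      show "poly_fun I B G y (R + 1) (\<lambda>b. if \<sigma> = s \<and> d < r then 0 else b (i, \<sigma>, d) * edge_val (\<tau> \<sigma>) p (W b) e ^ d)"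
      proof (cases "\<sigma> = s \<and> d < r")
        case True
        then show ?thesis by (simp add: poly_fun_mono[OF poly_fun.const])
      next
        case False
        then have "Inr (i, \<sigma>, d) \<in> G" using i \<sigma> d by (auto simp: G_def GC_def coef_index_def)
        from poly_fun.gen[OF this, of I B y] have "poly_fun I B G y 1 (\<lambda>b. b (i, \<sigma>, d))" by (simp add: y_def)
        from poly_fun.mult[OF this poly_fun_power[OF edge[OF e]], of d "\<tau> \<sigma>"]
        have "poly_fun I B G y (R + 1) (\<lambda>b. b (i, \<sigma>, d) * edge_val (\<tau> \<sigma>) p (W b) e ^ d)"
          by (rule poly_fun_mono) (use d in simp)
        then show ?thesis by (simp only: False if_False)
      qed
    qed
    moreover have "poly (f b) (z e b) - v e b \<in> I" if b: "b \<in> B" and e: "e \<in> Ed" for b e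
    proof -
      have "poly (f b) (z e b) = (\<Sum>d<r. b (i, s, d) * z e b ^ d)"
        by (simp add: f_def poly_sum poly_monom)
      then have "poly (f b) (z e b) - v e b =
         (\<Sum>\<sigma><NT. \<Sum>d<R. b (i, \<sigma>, d) * edge_val (\<tau> \<sigma>) p (W b) e ^ d) - W b (fst e) (npos p (snd e)) (\<beta> + i)"
        unfolding v_def z_def
        using sum_split_block[OF s r_le, of "\<lambda>\<sigma> d. b (i, \<sigma>, d) * edge_val (\<tau> \<sigma>) p (W b) e ^ d"]
        by (simp add: algebra_simps)
      also have "\<dots> = poly_val (coef_fun b) \<tau> (W b (fst e) (xpos p (snd e))) (W b (fst e) (npos p (snd e))) i
         - W b (fst e) (npos p (snd e)) (\<beta> + i)"
        by (simp add: poly_val_def coef_fun_def edge_val_def)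
      also have "\<dots> \<in> I"
        using conf[OF b] EdD[OF e] i by (auto simp: config_def is_path_def adjacent_def)
      finally show ?thesis .
    qed
    ultimately have "poly_fun I B G y (R + 1 + card Ed * card Ed) (\<lambda>b. \<delta> b * coeff (f b) d)"
      unfolding \<delta>_def using finEd z incong by (intro poly_fun_interpolation[where v = v]) auto
    then have "poly_fun I B G y (R + 1 + R * R) (\<lambda>b. \<delta> b * coeff (f b) d)"
      by (rule poly_fun_mono) (use rr in \<open>simp add: r_def\<close>)
    then show ?thesis using d by (simp add: coeff)
  qed

  have "card B \<le> (card coef_index * ((q - 1) * (R + 1 + R * R)) + 1) ^ card G"
  proof (rule card_le_of_rational_parametrization[where \<delta> = \<delta> and y = y])
    show "\<delta> b \<notin> I" if "b \<in> B" for b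
      using incong[OF that] finEd by (auto simp: \<delta>_def prod_mem_iff)
    show "poly_fun I B G y (R + 1 + R * R) \<delta>" by (rule poly_fun_mono[OF \<delta>]) (use rr in simp)
    fix x assume x: "x \<in> coef_index"
    show "poly_fun I B G y (R + 1 + R * R) (\<lambda>b. \<delta> b * b x)"
    proof (cases "x \<in> {..<t} \<times> {s} \<times> {..<r}")
      case True
      then show ?thesis using solved by auto
    next
      case False
      then have "Inr x \<in> G" using x by (auto simp: G_def GC_def)
      from poly_fun.gen[OF this, of I B y] have "poly_fun I B G y 1 (\<lambda>b. b x)" by (simp add: y_def)
      from poly_fun.mult[OF \<delta> this] show ?thesis by (rule poly_fun_mono) (use rr in simp)
    qed
  qed (use finG fin_index B in auto)
  also have "\<dots> \<le> ((card coef_index * (R + 1 + R * R) + 1) * q) ^ card G"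
  proof (rule power_mono)
    have "card coef_index * ((q - 1) * (R + 1 + R * R)) + 1 \<le> card coef_index * (q * (R + 1 + R * R)) + q"
      using q_gt_1 by (intro add_mono mult_le_mono2 mult_le_mono1) auto
    also have "\<dots> = (card coef_index * (R + 1 + R * R) + 1) * q" by (simp add: algebra_simps)
    finally show "card coef_index * ((q - 1) * (R + 1 + R * R)) + 1 \<le> (card coef_index * (R + 1 + R * R) + 1) * q" .
  qed simp
  also have "\<dots> \<le> ((card coef_index * (R + 1 + R * R) + 1) * q) ^ (card coef_index - L)"
    using cardG q_gt_1 by (intro power_increasing) auto
  finally show ?thesis .
qed

end

section \<open>Choice of the polynomials\<close>

context path_field
begin

text \<open>For each bad vector a configuration and a separating form are chosen. The vectors are
  then sorted by the pattern, a relation on L (2k + 1) positions, and by the form, and each class is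
  bounded by \<open>card_class_le\<close>.\<close>

lemma card_bad_le:
  assumes L: "L > 0" "L * (2 * k) \<le> R" and i0: "i0 < vdim p 1"
    and \<tau>: "inj_on \<tau> {..<NT}" "\<tau> ` {..<NT} \<subseteq> F" and NT: "NT > R * R * (A + \<beta>)"
  shows "card {b \<in> coef_index \<rightarrow>\<^sub>E F. \<exists>W. config (coef_fun b) \<tau> p v0 v1 i0 u L W}
    \<le> 2 ^ (L * (2 * k + 1) * (L * (2 * k + 1))) * NT *
      ((card coef_index * (R + 1 + R * R) + 1) * q) ^ (card coef_index - L)" (is "card ?Bad \<le> ?N * NT * ?K")
proof -
  define W where "W = (\<lambda>b. SOME W. config (coef_fun b) \<tau> p v0 v1 i0 u L W)"
  have conf: "config (coef_fun b) \<tau> p v0 v1 i0 u L (W b)" if "b \<in> ?Bad" for b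
    using that someI_ex[of "\<lambda>W. config (coef_fun b) \<tau> p v0 v1 i0 u L W"] by (auto simp: W_def)
  define Q where "Q = (\<lambda>b. pattern p L (W b))"
  define Ed where "Ed = (\<lambda>b. SIGMA l:{..<L}. new_edges (Q b) l)"
  define sep where "sep = (\<lambda>b s. s < NT \<and> (\<forall>e\<in>Ed b. \<forall>e'\<in>Ed b.
    edge_val (\<tau> s) p (W b) e - edge_val (\<tau> s) p (W b) e' \<in> I \<longrightarrow> e = e'))"
  have ex_sep: "\<exists>s. sep b s" if b: "b \<in> ?Bad" for b
  proof -
    have ne: "new_pos (Q b) l \<noteq> {}" if "l < L" for l
      using one_in_new_pos[OF conf[OF b] that] by (auto simp: Q_def)
    have sub: "new_edges (Q b) l \<subseteq> {..<2 * k}" if "l < L" for l using new_edges(1)[OF ne[OF that]] .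
    then have Ed_sub: "Ed b \<subseteq> {..<L} \<times> {..<2 * k}" unfolding Ed_def by blast
    have "finite (Ed b)" using Ed_sub by (rule finite_subset) simp
    moreover have "card (Ed b) \<le> R"
      using card_mono[OF _ Ed_sub] L by (simp add: card_cartesian_product)
    ultimately have "\<exists>s<NT. \<forall>e\<in>Ed b. \<forall>e'\<in>Ed b.
        edge_val (\<tau> s) p (W b) e - edge_val (\<tau> s) p (W b) e' \<in> I \<longrightarrow> e = e'"
      by (intro separating_form[OF conf[OF b] _ \<tau> _ _ _ NT, of "Q b"]) (simp_all add: Q_def Ed_def)
    then show ?thesis by (auto simp: sep_def)
  qed
  define s where "s = (\<lambda>b. SOME s. sep b s)"
  have s: "sep b (s b)" if "b \<in> ?Bad" for b
    using someI_ex[OF ex_sep[OF that]] by (simp add: s_def)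
  define X where "X = {..<L} \<times> {..2 * k}"
  define cls where "cls = (\<lambda>(Q', s'). {b \<in> ?Bad. Q b = Q' \<and> s b = s'})"
  have fin: "finite (Pow (X \<times> X) \<times> {..<NT})" by (simp add: X_def)
  have "?Bad \<subseteq> (\<Union>w\<in>Pow (X \<times> X) \<times> {..<NT}. cls w)"
  proof
    fix b assume b: "b \<in> ?Bad"
    have "Q b \<in> Pow (X \<times> X)" by (auto simp: Q_def pattern_def X_def)
    moreover have "s b < NT" using s[OF b] by (simp add: sep_def)
    ultimately show "b \<in> (\<Union>w\<in>Pow (X \<times> X) \<times> {..<NT}. cls w)"
      using b by (intro UN_I[of "(Q b, s b)"]) (simp_all add: cls_def)
  qed
  moreover have "finite (\<Union>w\<in>Pow (X \<times> X) \<times> {..<NT}. cls w)"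
  proof -
    have "finite (coef_index \<rightarrow>\<^sub>E F)" using F_finite by (intro finite_PiE) (auto simp: coef_index_def)
    then have finBad: "finite ?Bad" by simp
    have "finite (cls w)" for w
      by (rule finite_subset[OF _ finBad]) (cases w, auto simp: cls_def)
    then show ?thesis using fin by blast
  qed
  ultimately have "card ?Bad \<le> card (\<Union>w\<in>Pow (X \<times> X) \<times> {..<NT}. cls w)" by (intro card_mono)
  also have "\<dots> \<le> (\<Sum>w\<in>Pow (X \<times> X) \<times> {..<NT}. card (cls w))" by (rule card_UN_le[OF fin])
  also have "\<dots> \<le> (\<Sum>w\<in>Pow (X \<times> X) \<times> {..<NT}. ?K)"
  proof (rule sum_mono)
    fix w assume w: "w \<in> Pow (X \<times> X) \<times> {..<NT}"
    obtain Q' s' where w': "w = (Q', s')" by (cases w)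
    show "card (cls w) \<le> ?K"
    proof (cases "cls w = {}")
      case False
      show ?thesis
      proof (rule card_class_le[where W = W and Q = Q' and s = s', OF _ False L i0])
        show "cls w \<subseteq> coef_index \<rightarrow>\<^sub>E F" by (auto simp: cls_def w')
        show "config (coef_fun b) \<tau> p v0 v1 i0 u L (W b)" if "b \<in> cls w" for b
          using that conf by (auto simp: cls_def w')
        show "pattern p L (W b) = Q'" if "b \<in> cls w" for b using that by (auto simp: cls_def w' Q_def)
        show "s' < NT" using w w' by simp
        show "e = e'" if "b \<in> cls w" and e: "e \<in> (SIGMA l:{..<L}. new_edges Q' l)"
          "e' \<in> (SIGMA l:{..<L}. new_edges Q' l)"
          "edge_val (\<tau> s') p (W b) e - edge_val (\<tau> s') p (W b) e' \<in> I" for b e e'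
        proof -
          have b: "b \<in> ?Bad" "Q b = Q'" "s b = s'" using that(1) by (auto simp: cls_def w')
          from s[OF b(1)] e show ?thesis unfolding sep_def Ed_def b(2,3) by blast
        qed
      qed
    qed simp
  qed
  also have "\<dots> = card (Pow (X \<times> X) \<times> {..<NT}) * ?K" by simp
  also have "card (Pow (X \<times> X) \<times> {..<NT}) = ?N * NT"
    by (simp add: X_def card_cartesian_product card_Pow)
  finally show ?thesis .
qed

end

text \<open>What a copy of the theta graph provides over \<open>F\<close>. Distinct vertices at
  position 1 make some coordinate take many values.\<close>

definition (in path_system) path_bundle ::
  "'a::idom set \<Rightarrow> 'a set \<Rightarrow> (nat \<Rightarrow> nat \<Rightarrow> nat \<Rightarrow> 'a) \<Rightarrow> (nat \<Rightarrow> 'a) \<Rightarrow> nat \<Rightarrow> bool \<Rightarrow> (nat \<Rightarrow> nat \<Rightarrow> nat \<Rightarrow> 'a) \<Rightarrow> bool" where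
  "path_bundle I F c \<tau> s p W \<longleftrightarrow>
    (\<forall>l<s. is_path I c \<tau> p (W l) \<and> W l 0 = W 0 0 \<and> W l (2 * k) = W 0 (2 * k) \<and>
      (\<forall>j\<le>2 * k. W l j \<in> {..<vdim p j} \<rightarrow>\<^sub>E F)) \<and>
    (\<forall>l<s. \<forall>l'<s. l \<noteq> l' \<longrightarrow> W l 1 \<noteq> W l' 1)"

text \<open>\<open>S\<close> lies in the product of its projections.\<close>

lemma many_values_in_coordinate:
  assumes "finite S" "S \<subseteq> {..<m} \<rightarrow>\<^sub>E F" "card S > (C + 1) ^ m"
  shows "\<exists>i<m. card ((\<lambda>f. f i) ` S) > C"
proof (rule ccontr)
  assume "\<not> ?thesis"
  then have le: "card ((\<lambda>f. f i) ` S) \<le> C" if "i < m" for i using that by force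
  have "S \<subseteq> PiE {..<m} (\<lambda>i. (\<lambda>f. f i) ` S)" using assms(2) by (auto simp: PiE_def)
  then have "card S \<le> card (PiE {..<m} (\<lambda>i. (\<lambda>f. f i) ` S))"
    using assms(1) by (intro card_mono finite_PiE) auto
  also have "\<dots> = (\<Prod>i<m. card ((\<lambda>f. f i) ` S))" by (simp add: card_PiE)
  also have "\<dots> \<le> (\<Prod>i<m. C + 1)" using le by (intro prod_mono) (auto intro: le_SucI)
  also have "\<dots> = (C + 1) ^ m" by simp
  finally show False using assms(3) by simp
qed

context path_system
begin

text \<open>So many first inner vertices give some coordinate more than \<open>C\<close> values,
  hence one outside the exceptional set. Then all values outside it occur, and \<open>U\<close>
  contains more than L (2k + 1) of them, enough for the greedy choice.\<close>

lemma bundle_gives_config: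
  fixes I :: "'a::idom set"
  assumes fs: "finite_subfield I F q"
    and dims: "k * (\<beta> + t) + (k - 1) * A \<le> 2 * k * t" "k * A + (k - 1) * (\<beta> + t) \<le> 2 * k * t"
    and C: "\<And>i0 v0 v1. i0 < vdim p 1 \<Longrightarrow> \<exists>E. finite E \<and> card E \<le> C \<and> exceptional_set I c \<tau> p i0 v0 v1 E"
    and bun: "path_bundle I F c \<tau> s p W" and s: "s > (C + 1) ^ (A + (\<beta> + t))"
    and U: "U \<subseteq> F" "card U = C + L * (2 * k + 1) + 1"
  shows "\<exists>i0 u W'. i0 < vdim p 1 \<and> u \<in> {..<L} \<rightarrow>\<^sub>E U \<and>
    path_field.config k A \<beta> t NT R I c \<tau> p (W 0 0) (W 0 (2 * k)) i0 u L W'"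
proof -
  interpret fs: finite_subfield I F q by fact
  interpret pf: path_field k A \<beta> t NT R I F q 
    by (intro path_field.intro path_field_axioms.intro path_system_axioms fs dims)
  have paths: "is_path I c \<tau> p (W l)" "W l 0 = W 0 0" "W l (2 * k) = W 0 (2 * k)"
      "W l 1 \<in> {..<vdim p 1} \<rightarrow>\<^sub>E F" if "l < s" for l
    using bun[unfolded path_bundle_def, THEN conjunct1, rule_format, OF that] k_pos by auto
  define S where "S = (\<lambda>l. W l 1) ` {..<s}"
  have "inj_on (\<lambda>l. W l 1) {..<s}" 
    using bun[unfolded path_bundle_def, THEN conjunct2] by (auto simp: inj_on_def)
  then have "card S = s" by (simp add: S_def card_image)
  moreover have "(C + 1) ^ vdim p 1 \<le> (C + 1) ^ (A + (\<beta> + t))"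
    by (intro power_increasing) (auto simp: vdim_def)
  ultimately have "card S > (C + 1) ^ vdim p 1" using s by linarith
  moreover have S: "finite S" "S \<subseteq> {..<vdim p 1} \<rightarrow>\<^sub>E F" using paths(4) by (auto simp: S_def)
  ultimately obtain i0 where i0: "i0 < vdim p 1" "card ((\<lambda>f. f i0) ` S) > C"
    using many_values_in_coordinate by blast
  obtain E where E: "finite E" "card E \<le> C" "exceptional_set I c \<tau> p i0 (W 0 0) (W 0 (2 * k)) E"
    using C[OF i0(1)] by blast
  have sub: "(\<lambda>f. f i0) ` S \<subseteq> F" using S(2) i0(1) by (auto simp: PiE_def Pi_def)
  have few: "card Y \<le> C" if "Y \<subseteq> F" "\<And>x. x \<in> Y \<Longrightarrow> \<exists>z\<in>E. x - z \<in> I" for Y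
    using fs.card_le_of_cover[OF E(1), of Y] that fs.F_incong E(2) by (meson le_trans subsetD)
  obtain x where x: "x \<in> (\<lambda>f. f i0) ` S" "\<forall>z\<in>E. x - z \<notin> I"
    using few[OF sub] i0(2) by (meson not_le)
  then obtain l where "l < s" "x = W l 1 i0" by (auto simp: S_def)
  then have ex: "joined I c \<tau> p i0 (W 0 0) (W 0 (2 * k)) x"
    using paths unfolding joined_def by blast
  define U' where "U' = {u \<in> U. \<forall>z\<in>E. u - z \<notin> I}"
  have finU: "finite U" using U by (metis add_is_0 card.infinite one_neq_zero)
  have "card (U - U') \<le> C" using U by (intro few) (auto simp: U'_def)
  moreover have "card U = card U' + card (U - U')"
    using finU by (subst card_Un_disjoint[symmetric]) (auto simp: U'_def intro!: arg_cong[where f = card])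
  ultimately have "L * (2 * k + 1) < card U'" using U(2) by linarith
  moreover have "joined I c \<tau> p i0 (W 0 0) (W 0 (2 * k)) u"
    if "u \<in> U'" for u
    using E(3) x(2) ex that unfolding exceptional_set_def U'_def by blast
  moreover have "finite U'" "U' \<subseteq> F" using finU U(1) by (auto simp: U'_def)
  ultimately obtain W' u where W': "\<forall>l<L. u l \<in> U'" "pf.config c \<tau> p (W 0 0) (W 0 (2 * k)) i0 u L W'"
    using pf.greedy_config[of U' L i0 p c \<tau> "W 0 0" "W 0 (2 * k)"] i0(1) by blast
  have "pf.config c \<tau> p (W 0 0) (W 0 (2 * k)) i0 (restrict u {..<L}) L W'"
    using W'(2) by (simp add: pf.config_def)
  moreover have "restrict u {..<L} \<in> {..<L} \<rightarrow>\<^sub>E U" using W'(1) by (auto simp: U'_def)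
  ultimately show ?thesis using i0(1) by blast
qed

text \<open>Union bound over \<open>p\<close>, two endpoints over \<open>F\<close>, the coordinate
  \<open>i0\<close> and the values \<open>u\<close> from \<open>U\<close>: these are O(q^(2n))
  events with O(q^(D - L)) vectors each, so only O(q^(D - 1)) of the q^D coefficient vectors are
  bad.\<close>

theorem good_coefficients:
  assumes t_pos: "t > 0"
    and dims: "k * (\<beta> + t) + (k - 1) * A \<le> 2 * k * t" "k * A + (k - 1) * (\<beta> + t) \<le> 2 * k * t"
    and R: "R = (2 * (A + (\<beta> + t)) + 1) * (2 * k)" and NT: "NT = R * R * (A + \<beta>) + 1"
  shows "\<exists>s0 q0. \<forall>(I :: 'a::idom set) F q. finite_subfield I F q \<longrightarrow> q \<ge> q0 \<longrightarrow>
    (\<exists>c \<tau>. (\<forall>i<t. \<forall>\<sigma><NT. \<forall>d<R. c i \<sigma> d \<in> F) \<and> (\<forall>\<sigma><NT. \<tau> \<sigma> \<in> F) \<and>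
      (\<forall>s\<ge>s0. \<forall>p W. \<not> path_bundle I F c \<tau> s p W))"
proof -
  define n where "n = A + (\<beta> + t)"
  \<comment> \<open>One more than the exponent of q in the number of pairs of endpoints.\<close>
  define L where "L = 2 * n + 1"
  obtain C where C: "\<forall>(I :: 'a set) c \<tau> p i0 v0 v1. acf_ideal I \<longrightarrow> i0 < vdim p 1 \<longrightarrow>
      (\<exists>E. finite E \<and> card E \<le> C \<and> exceptional_set I c \<tau> p i0 v0 v1 E)"
    using path_dichotomy by blast
  \<comment> \<open>\<open>C\<close> elements may be exceptional, L (2k + 1) may be excluded by the
    greedy choice, and one must remain.\<close>
  define Uc where "Uc = C + L * (2 * k + 1) + 1"
  define D where "D = t * (NT * R)"
  define K where "K = 2 ^ (L * (2 * k + 1) * (L * (2 * k + 1))) * NT"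
  define M where "M = 2 * (n * Uc ^ L) * (K * (D * (R + 1 + R * R) + 1) ^ (D - L))"
  \<comment> \<open>q has to exceed the constant \<open>M\<close> of the union bound, and
    \<open>F\<close> has to contain \<open>NT\<close> parameters of forms and the set
    \<open>U\<close>.\<close>
  define q0 where "q0 = NT + Uc + M + 1"
  show ?thesis
  proof (rule exI[of _ "(C + 1) ^ n + 1"], rule exI[of _ q0], intro allI impI)
    fix I :: "'a set" and F q assume fs: "finite_subfield I F q" and q: "q \<ge> q0"
    interpret fs: finite_subfield I F q by fact
    interpret pf: path_field k A \<beta> t NT R I F q 
    by (intro path_field.intro path_field_axioms.intro path_system_axioms fs dims)
    obtain \<tau> where \<tau>: "inj_on \<tau> {..<NT}" "\<tau> ` {..<NT} \<subseteq> F"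
      using card_le_inj[of "{..<NT}" F] fs.F_finite fs.F_card q by (auto simp: q0_def)
    have "Uc \<le> card F" using q fs.F_card by (simp add: q0_def)
    then obtain U where U: "U \<subseteq> F" "card U = Uc" using obtain_subset_with_card_n by metis
    have finU: "finite U" using U(1) fs.F_finite finite_subset by blast
    define VS where "VS = (\<lambda>p. {..<vdim p 0} \<rightarrow>\<^sub>E F)"
    define Ix where "Ix = (SIGMA p:UNIV. VS p \<times> VS p \<times> {..<vdim p 1} \<times> ({..<L} \<rightarrow>\<^sub>E U))"
    define Bad where "Bad = (\<lambda>(p, v0, v1, i0, u).
       {b \<in> pf.coef_index \<rightarrow>\<^sub>E F. \<exists>W. pf.config (pf.coef_fun b) \<tau> p v0 v1 i0 u L W})"
    have vdim_le: "vdim p j \<le> n" for p j by (simp add: vdim_def n_def)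
    have finVS: "finite (VS p)" for p unfolding VS_def using fs.F_finite by (intro finite_PiE) auto
    have finIx: "finite Ix" unfolding Ix_def using finVS finU by (intro finite_SigmaI finite_cartesian_product finite_PiE) auto
    have cardVS: "card (VS p) \<le> q ^ n" for p
      unfolding VS_def using fs.F_card fs.q_gt_1 vdim_le by (simp add: card_PiE power_increasing)
    have cardIx: "card Ix \<le> 2 * (q ^ n * (q ^ n * (n * Uc ^ L)))"
    proof -
      have "card Ix = (\<Sum>p\<in>UNIV. card (VS p \<times> VS p \<times> {..<vdim p 1} \<times> ({..<L} \<rightarrow>\<^sub>E U)))"
        unfolding Ix_def using finVS finU by (intro card_SigmaI) (auto intro!: finite_PiE)
      also have "\<dots> \<le> (\<Sum>p\<in>(UNIV :: bool set). q ^ n * (q ^ n * (n * Uc ^ L)))"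
        using cardVS vdim_le U(2)
        by (intro sum_mono) (auto simp: card_cartesian_product card_PiE intro!: mult_le_mono)
      finally show ?thesis by (simp add: UNIV_bool)
    qed
    have D: "card pf.coef_index = D" by (simp add: pf.coef_index_def D_def card_cartesian_product)
    have LR: "L * (2 * k) = R" by (simp add: R L_def n_def)
    have "L \<le> R" unfolding LR[symmetric] using k_pos by simp
    also have "R \<le> D"
    proof -
      have "1 * R \<le> (t * NT) * R" using t_pos NT by (intro mult_le_mono1) simp
      then show ?thesis by (simp add: D_def mult.assoc)
    qed
    finally have LD: "L \<le> D" .
    have "card (Bad w) \<le> K * ((D * (R + 1 + R * R) + 1) * q) ^ (D - L)" if w: "w \<in> Ix" for w
    proof -
      obtain p v0 v1 i0 u where w': "w = (p, v0, v1, i0, u)" by (metis surj_pair)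
      then have "i0 < vdim p 1" using w by (auto simp: Ix_def)
      then show ?thesis unfolding w' Bad_def K_def prod.case D[symmetric]
        by (intro pf.card_bad_le \<tau>) (use LR NT in \<open>auto simp: L_def\<close>)
    qed
    then have "(\<Sum>w\<in>Ix. card (Bad w)) \<le> card Ix * (K * ((D * (R + 1 + R * R) + 1) * q) ^ (D - L))"
      using sum_bounded_above[of Ix "\<lambda>w. card (Bad w)"] by auto
    then have "card (\<Union>w\<in>Ix. Bad w) \<le> card Ix * (K * ((D * (R + 1 + R * R) + 1) * q) ^ (D - L))"
      using card_UN_le[OF finIx, of Bad] by linarith
    also have "\<dots> \<le> 2 * (q ^ n * (q ^ n * (n * Uc ^ L))) * (K * ((D * (R + 1 + R * R) + 1) * q) ^ (D - L))"
      using cardIx by (rule mult_le_mono1)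
    also have "\<dots> = M * (q ^ n * q ^ n * q ^ (D - L))"
      unfolding M_def power_mult_distrib by (simp only: mult_ac)
    also have "q ^ n * q ^ n * q ^ (D - L) = q ^ (D - 1)"
      using LD by (simp add: power_add[symmetric] L_def)
    also have "M * q ^ (D - 1) < q * q ^ (D - 1)" using q fs.q_gt_1 by (simp add: q0_def)
    also have "q * q ^ (D - 1) = q ^ D" using LD by (simp add: L_def flip: power_Suc)
    also have "q ^ D = card (pf.coef_index \<rightarrow>\<^sub>E F)"
      using D fs.F_card by (subst card_PiE) (auto simp: pf.coef_index_def)
    finally have lt: "card (\<Union>w\<in>Ix. Bad w) < card (pf.coef_index \<rightarrow>\<^sub>E F)" .
    have "(\<Union>w\<in>Ix. Bad w) \<subseteq> pf.coef_index \<rightarrow>\<^sub>E F" by (auto simp: Bad_def)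
    with lt obtain b where b: "b \<in> pf.coef_index \<rightarrow>\<^sub>E F" "b \<notin> (\<Union>w\<in>Ix. Bad w)"
      by (metis less_irrefl subsetI subset_antisym)
    have "\<not> path_bundle I F (pf.coef_fun b) \<tau> s p W" if s: "s \<ge> (C + 1) ^ n + 1" for s p W
    proof
      assume bun: "path_bundle I F (pf.coef_fun b) \<tau> s p W"
      have "\<exists>i0 u W'. i0 < vdim p 1 \<and> u \<in> {..<L} \<rightarrow>\<^sub>E U \<and>
          pf.config (pf.coef_fun b) \<tau> p (W 0 0) (W 0 (2 * k)) i0 u L W'"
      proof (rule bundle_gives_config[OF fs dims _ bun _ U(1)])
        show "\<exists>E. finite E \<and> card E \<le> C \<and> exceptional_set I (pf.coef_fun b) \<tau> p i0 v0 v1 E"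
          if "i0 < vdim p 1" for i0 v0 v1
          using C[rule_format, OF fs.acf_ideal_axioms that] .
        show "(C + 1) ^ (A + (\<beta> + t)) < s" using s by (simp add: n_def)
        show "card U = C + L * (2 * k + 1) + 1" using U(2) by (simp add: Uc_def)
      qed
      then obtain i0 u W' where i0: "i0 < vdim p 1" and u: "u \<in> {..<L} \<rightarrow>\<^sub>E U"
        and W': "pf.config (pf.coef_fun b) \<tau> p (W 0 0) (W 0 (2 * k)) i0 u L W'" by blast
      have "0 < s" using s by simp
      then have ends: "W 0 0 \<in> {..<vdim p 0} \<rightarrow>\<^sub>E F" "W 0 (2 * k) \<in> {..<vdim p (2 * k)} \<rightarrow>\<^sub>E F"
        using bun[unfolded path_bundle_def, THEN conjunct1, rule_format, of 0] by auto
      have "vdim p (2 * k) = vdim p 0" by (simp add: vdim_def)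
      with ends have "(p, W 0 0, W 0 (2 * k), i0, u) \<in> Ix"
        using i0 u by (auto simp: Ix_def VS_def)
      moreover have "b \<in> Bad (p, W 0 0, W 0 (2 * k), i0, u)"
        using W' b(1) by (auto simp: Bad_def)
      ultimately show False using b(2) by blast
    qed
    moreover have "\<forall>i<t. \<forall>\<sigma><NT. \<forall>d<R. pf.coef_fun b i \<sigma> d \<in> F"
      using b(1) by (auto simp: pf.coef_fun_def pf.coef_index_def PiE_def Pi_def)
    moreover have "\<forall>\<sigma><NT. \<tau> \<sigma> \<in> F" using \<tau> by auto
    ultimately show "\<exists>c \<tau>. (\<forall>i<t. \<forall>\<sigma><NT. \<forall>d<R. c i \<sigma> d \<in> F) \<and> (\<forall>\<sigma><NT. \<tau> \<sigma> \<in> F) \<and>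
      (\<forall>s\<ge>(C + 1) ^ n + 1. \<forall>p W. \<not> path_bundle I F c \<tau> s p W)" by blast
  qed
qed

end

section \<open>The graph\<close>

context path_field
begin

lemma vec_cong_eq:
  assumes "v \<in> {..<m} \<rightarrow>\<^sub>E F" "w \<in> {..<m} \<rightarrow>\<^sub>E F"
  shows "vec_cong I m v w \<longleftrightarrow> v = w"
proof
  assume "vec_cong I m v w"
  then show "v = w" using assms F_incong
    by (intro PiE_ext[OF assms]) (auto simp: vec_cong_def PiE_def Pi_def)
qed (simp add: vec_cong_def zero_mem)

text \<open>Restricting the second vertex of an edge to \<nu> is a bijection onto all pairs of x and
  \<nu>: \<eta> is determined by the polynomials, and it exists over \<open>F\<close> because
  \<open>Fq\<close> is closed under the ring operations.\<close>

lemma card_edges: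
  assumes c: "\<forall>i<t. \<forall>\<sigma><NT. \<forall>d<R. c i \<sigma> d \<in> F" and \<tau>: "\<forall>\<sigma><NT. \<tau> \<sigma> \<in> F"
  shows "card {(x, n) \<in> ({..<A} \<rightarrow>\<^sub>E F) \<times> ({..<\<beta> + t} \<rightarrow>\<^sub>E F). adjacent I c \<tau> x n} = q ^ (A + \<beta>)"
proof -
  let ?X = "{..<A} \<rightarrow>\<^sub>E F" and ?Y = "{..<\<beta> + t} \<rightarrow>\<^sub>E F" and ?Z = "{..<\<beta>} \<rightarrow>\<^sub>E F"
  let ?E = "{(x, n) \<in> ?X \<times> ?Y. adjacent I c \<tau> x n}"
  define h where "h = (\<lambda>(x :: nat \<Rightarrow> 'a, n :: nat \<Rightarrow> 'a). (x, restrict n {..<\<beta>}))"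
  have "inj_on h ?E"
  proof (rule inj_onI)
    fix a b assume ab: "a \<in> ?E" "b \<in> ?E" "h a = h b"
    obtain x n x' n' where eq: "a = (x, n)" "b = (x', n')" by (metis surj_pair)
    have x: "x = x'" and n: "restrict n {..<\<beta>} = restrict n' {..<\<beta>}" using ab(3) by (auto simp: h_def eq)
    have "n m = n' m" if "m < \<beta>" for m using fun_cong[OF n, of m] that by simp
    then have "vec_cong I \<beta> n n'" by (simp add: vec_cong_def zero_mem)
    moreover have "vec_cong I A x x'" by (simp add: vec_cong_def zero_mem x)
    ultimately have "vec_cong I (\<beta> + t) n n'"
      using adjacent_determines[of c \<tau> x n x' n'] ab by (auto simp: eq)
    then show "a = b" using vec_cong_eq[of n "\<beta> + t" n'] ab x by (auto simp: eq)
  qed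
  moreover have "h ` ?E = ?X \<times> ?Z"
  proof (intro equalityI subsetI)
    fix w assume "w \<in> h ` ?E"
    then show "w \<in> ?X \<times> ?Z" by (force simp: h_def PiE_def Pi_def)
  next
    fix w assume "w \<in> ?X \<times> ?Z"
    then obtain x \<nu> where w: "w = (x, \<nu>)" "x \<in> ?X" "\<nu> \<in> ?Z" by auto
    have lin: "lin_form (\<tau> \<sigma>) x \<nu> \<in> Fq" if "\<sigma> < NT" for \<sigma>
      unfolding lin_form_def
    proof (intro Fq_sum Fq_mult Fq_power)
      show "(if m < A then x m else \<nu> (m - A)) \<in> Fq" if "m \<in> {..<A + \<beta>}" for m
        using w F_subset_Fq that by (cases "m < A") (auto simp: PiE_def Pi_def)
      show "\<tau> \<sigma> \<in> Fq" using \<tau> that F_subset_Fq by auto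
    qed
    have "\<exists>y\<in>F. poly_val c \<tau> x \<nu> i - y \<in> I" if "i < t" for i
    proof (rule Fq_representative)
      show "poly_val c \<tau> x \<nu> i \<in> Fq"
        unfolding poly_val_def using c that F_subset_Fq lin by (intro Fq_sum Fq_mult Fq_power) auto
    qed
    then have "\<forall>i. \<exists>y. i < t \<longrightarrow> y \<in> F \<and> poly_val c \<tau> x \<nu> i - y \<in> I" by blast
    from choice[OF this] obtain \<eta> where \<eta>: "\<And>i. i < t \<Longrightarrow> \<eta> i \<in> F \<and> poly_val c \<tau> x \<nu> i - \<eta> i \<in> I" by blast
    define n where "n = restrict (\<lambda>m. if m < \<beta> then \<nu> m else \<eta> (m - \<beta>)) {..<\<beta> + t}"
    have "n \<in> ?Y" using w \<eta> by (auto simp: n_def PiE_def Pi_def)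
    moreover have "adjacent I c \<tau> x n"
    proof -
      have "lin_form s x n = lin_form s x \<nu>" for s by (rule lin_form_cong) (auto simp: n_def)
      then have "poly_val c \<tau> x n = poly_val c \<tau> x \<nu>" by (simp add: poly_val_def fun_eq_iff)
      then show ?thesis using \<eta> by (auto simp: adjacent_def n_def)
    qed
    ultimately have xn: "(x, n) \<in> ?E" using w by simp
    have "w = h (x, n)"
      using w(1,3) by (auto simp: h_def n_def fun_eq_iff PiE_def extensional_def)
    then show "w \<in> h ` ?E" using xn by (rule image_eqI)
  qed
  ultimately have "card ?E = card (?X \<times> ?Z)" using card_image[of h ?E] by simp
  also have "\<dots> = q ^ (A + \<beta>)" using F_card by (simp add: card_cartesian_product card_PiE power_add)
  finally show ?thesis .
qed

end

text \<open>There are two encodings because \<open>X\<close> and \<open>Y\<close> may overlap: both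
  are sets of vectors, and they coincide when A = \<beta> + t.\<close>

definition relation_graph ::
  "('v \<Rightarrow> nat) \<Rightarrow> ('v \<Rightarrow> nat) \<Rightarrow> 'v set \<Rightarrow> 'v set \<Rightarrow> ('v \<Rightarrow> 'v \<Rightarrow> bool) \<Rightarrow> nat ugraph" where
  "relation_graph g1 g2 X Y E = (g1 ` X \<union> g2 ` Y, {{g1 x, g2 y} | x y. x \<in> X \<and> y \<in> Y \<and> E x y})"

text \<open>The sides alternate along a path, so the side of the source, recorded in
  \<open>p\<close>, and the parity of a position determine whether it is pulled back through
  \<open>g1\<close> or through \<open>g2\<close>.\<close>

lemma bipartite_theta_paths:
  fixes X Y :: "'v set" and g1 g2 :: "'v \<Rightarrow> nat"
  assumes inj: "inj_on g1 X" "inj_on g2 Y" and disj: "g1 ` X \<inter> g2 ` Y = {}"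
    and copy: "contains_copy (relation_graph g1 g2 X Y E) (theta_graph s (2 * k))"
    and k: "k \<ge> 1"
  shows "\<exists>p W. (\<forall>l<s. W l 0 = W 0 0 \<and> W l (2 * k) = W 0 (2 * k) \<and>
      (\<forall>j\<le>2 * k. W l j \<in> (if even j = p then X else Y)) \<and>
      (\<forall>j<2 * k. if even j = p then E (W l j) (W l (Suc j)) else E (W l (Suc j)) (W l j)) \<and>
      (\<forall>j\<le>2 * k. \<forall>j'\<le>2 * k. j \<noteq> j' \<and> even j = even j' \<longrightarrow> W l j \<noteq> W l j')) \<and>
    (\<forall>l<s. \<forall>l'<s. l \<noteq> l' \<longrightarrow> W l 1 \<noteq> W l' 1)"
proof -
  let ?\<Theta> = "theta_graph s (2 * k)"
  obtain f where f: "inj_on f (verts ?\<Theta>)" "f ` verts ?\<Theta> \<subseteq> g1 ` X \<union> g2 ` Y"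
    and edges: "\<And>e. e \<in> edges ?\<Theta> \<Longrightarrow> \<exists>x y. f ` e = {g1 x, g2 y} \<and> x \<in> X \<and> y \<in> Y \<and> E x y"
    using copy by (auto simp: contains_copy_def relation_graph_def)
  define v where "v = theta_path_vertex (2 * k)"
  define P where "P = (\<lambda>l j. f (v l j))"
  have v_in: "v l j \<in> verts ?\<Theta>" if "l < s" "j \<le> 2 * k" for l j
    using that by (auto simp: v_def theta_path_vertex_def theta_graph_def)
  have edge: "\<exists>x y. {P l j, P l (Suc j)} = {g1 x, g2 y} \<and> x \<in> X \<and> y \<in> Y \<and> E x y" if "l < s" "j < 2 * k" for l j
    using edges[of "{v l j, v l (Suc j)}"] that by (auto simp: v_def P_def theta_graph_def)
  have P_inj: "P l j = P l' j' \<longleftrightarrow> v l j = v l' j'" if "l < s" "j \<le> 2 * k" "l' < s" "j' \<le> 2 * k" for l j l' j'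
    unfolding P_def using inj_on_eq_iff[OF f(1) v_in v_in] that by blast
  define p where "p \<longleftrightarrow> f Source \<in> g1 ` X"
  have side: "P l j \<in> (if even j = p then g1 ` X else g2 ` Y)" if lj: "l < s" "j \<le> 2 * k" for l j
    using lj(2)
  proof (induction j)
    case 0
    have "P l 0 = f Source" by (simp add: P_def v_def theta_path_vertex_def)
    moreover have "P l 0 \<in> g1 ` X \<union> g2 ` Y" using f(2) v_in[OF lj(1), of 0] by (auto simp: P_def)
    ultimately show ?case by (auto simp: p_def)
  next
    case (Suc j)
    obtain x y where xy: "{P l j, P l (Suc j)} = {g1 x, g2 y}" "x \<in> X" "y \<in> Y"
      using edge[OF lj(1), of j] Suc.prems by auto
    have "P l j \<in> (if even j = p then g1 ` X else g2 ` Y)" using Suc by simp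
    then show ?case using xy disj by (auto simp: doubleton_eq_iff split: if_splits)
  qed
  define W where "W = (\<lambda>l j. if even j = p then inv_into X g1 (P l j) else inv_into Y g2 (P l j))"
  have W: "W l j \<in> (if even j = p then X else Y)" "P l j = (if even j = p then g1 (W l j) else g2 (W l j))"
    if "l < s" "j \<le> 2 * k" for l j
    using side[OF that] by (auto simp: W_def inv_into_into f_inv_into_f split: if_splits)
  have W_eq: "v l j = v l' j'" if "l < s" "j \<le> 2 * k" "l' < s" "j' \<le> 2 * k" "even j = even j'" "W l j = W l' j'" for l j l' j'
  proof -
    have "P l j = P l' j'" unfolding W(2)[OF that(1,2)] W(2)[OF that(3,4)] that(5,6) ..
    then show ?thesis using P_inj[OF that(1-4)] by simp
  qed
  have v_inj: "j = j'" if "v l j = v l j'" "j \<le> 2 * k" "j' \<le> 2 * k" for l j j'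
    using that k by (auto simp: v_def theta_path_vertex_def split: if_splits)
  have "if even j = p then E (W l j) (W l (Suc j)) else E (W l (Suc j)) (W l j)" if lj: "l < s" "j < 2 * k" for l j
  proof -
    obtain x y where xy: "{P l j, P l (Suc j)} = {g1 x, g2 y}" "x \<in> X" "y \<in> Y" "E x y"
      using edge[OF lj] by blast
    have 1: "W l j \<in> (if even j = p then X else Y)" "P l j = (if even j = p then g1 (W l j) else g2 (W l j))"
      using W[OF lj(1), of j] lj(2) by auto
    have 2: "W l (Suc j) \<in> (if even j = p then Y else X)" "P l (Suc j) = (if even j = p then g2 (W l (Suc j)) else g1 (W l (Suc j)))"
      using W[OF lj(1), of "Suc j"] lj(2) by (auto split: if_splits)
    show ?thesis
    proof (cases "even j = p")
      case True
      then have m: "W l j \<in> X" "P l j = g1 (W l j)" "W l (Suc j) \<in> Y" "P l (Suc j) = g2 (W l (Suc j))" using 1 2 by auto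
      then have "P l j = g1 x" "P l (Suc j) = g2 y" using xy disj by (auto simp: doubleton_eq_iff)
      then have "W l j = x" "W l (Suc j) = y" using m xy inj by (auto simp: inj_on_eq_iff)
      then show ?thesis using True xy by simp
    next
      case False
      then have m: "W l j \<in> Y" "P l j = g2 (W l j)" "W l (Suc j) \<in> X" "P l (Suc j) = g1 (W l (Suc j))" using 1 2 by auto
      then have "P l j = g2 y" "P l (Suc j) = g1 x" using xy disj by (auto simp: doubleton_eq_iff)
      then have "W l j = y" "W l (Suc j) = x" using m xy inj by (auto simp: inj_on_eq_iff)
      then show ?thesis using False xy by simp
    qed
  qed
  moreover have "W l 0 = W 0 0" "W l (2 * k) = W 0 (2 * k)" for l
    by (auto simp: W_def P_def v_def theta_path_vertex_def)
  moreover have "W l j \<noteq> W l j'" if "l < s" "j \<le> 2 * k" "j' \<le> 2 * k" "j \<noteq> j'" "even j = even j'" for l j j'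
    using W_eq[of l j l j'] v_inj[of l j j'] that by blast
  moreover have "W l 1 \<noteq> W l' 1" if "l < s" "l' < s" "l \<noteq> l'" for l l'
  proof
    assume "W l 1 = W l' 1"
    then have "v l 1 = v l' 1" using W_eq[of l 1 l' 1] that k by simp
    then show False using that k by (auto simp: v_def theta_path_vertex_def split: if_splits)
  qed
  ultimately show ?thesis using W(1) by (intro exI[of _ p] exI[of _ W]) blast
qed

lemma bipartite_relation_graph:
  fixes X Y :: "'v set"
  assumes fin: "finite X" "finite Y"
  obtains g1 g2 :: "'v \<Rightarrow> nat" where "inj_on g1 X" "inj_on g2 Y" "g1 ` X \<inter> g2 ` Y = {}"
    "\<And>E. bipartite_with_parts (relation_graph g1 g2 X Y E) (g1 ` X) (g2 ` Y)"
    "\<And>E. card (edges (relation_graph g1 g2 X Y E)) = card {(x, y) \<in> X \<times> Y. E x y}"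
proof -
  obtain h1 :: "'v \<Rightarrow> nat" where h1: "inj_on h1 X" using finite_imp_inj_to_nat_seg[OF fin(1)] by blast
  obtain h2 :: "'v \<Rightarrow> nat" where h2: "inj_on h2 Y" using finite_imp_inj_to_nat_seg[OF fin(2)] by blast
  define g1 where "g1 = (\<lambda>x. 2 * h1 x)"
  define g2 where "g2 = (\<lambda>x. Suc (2 * h2 x))"
  have ne: "g1 x \<noteq> g2 y" for x y unfolding g1_def g2_def by presburger
  have inj: "inj_on g1 X" "inj_on g2 Y" using h1 h2 by (auto simp: g1_def g2_def inj_on_def)
  have disj: "g1 ` X \<inter> g2 ` Y = {}" using ne by auto
  show ?thesis
  proof (rule that[OF inj disj])
    fix E
    show "bipartite_with_parts (relation_graph g1 g2 X Y E) (g1 ` X) (g2 ` Y)"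
      unfolding bipartite_with_parts_def simple_graph_def relation_graph_def using fin disj ne by auto
    have "edges (relation_graph g1 g2 X Y E) = (\<lambda>(x, y). {g1 x, g2 y}) ` {(x, y) \<in> X \<times> Y. E x y}"
      by (auto simp: relation_graph_def)
    moreover have "inj_on (\<lambda>(x, y). {g1 x, g2 y}) {(x, y) \<in> X \<times> Y. E x y}"
      using inj ne by (auto simp: inj_on_def doubleton_eq_iff)
    ultimately show "card (edges (relation_graph g1 g2 X Y E)) = card {(x, y) \<in> X \<times> Y. E x y}"
      by (simp add: card_image)
  qed
qed

theorem theta_free_bipartite_graph:
  fixes k A \<beta> t :: nat
  assumes k: "k \<ge> 1" and t: "t \<le> A" "t > 0"
    and dims: "k * (\<beta> + t) + (k - 1) * A \<le> 2 * k * t" "k * A + (k - 1) * (\<beta> + t) \<le> 2 * k * t"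
  shows "\<exists>s0 q0 :: nat. \<forall>s\<ge>s0. \<forall>q::nat. primepow q \<and> q \<ge> q0 \<longrightarrow>
    (\<exists>(G :: nat ugraph) M N. bipartite_with_parts G M N \<and> card M = q ^ A \<and> card N = q ^ (\<beta> + t) \<and>
       free_of G (theta_graph s (2 * k)) \<and> card (edges G) = q ^ (A + \<beta>))"
proof -
  \<comment> \<open>The number of edges on 2n + 1 paths of length 2k, where n = A + \<beta> + t; it
    bounds the number of interpolation points.\<close>
  define R where "R = (2 * (A + (\<beta> + t)) + 1) * (2 * k)"
  define NT where "NT = R * R * (A + \<beta>) + 1"
  interpret path_system k A \<beta> t NT R by unfold_locales (use k t in auto)
  obtain s0 q0 where good: "\<forall>(I :: algint set) F q. finite_subfield I F q \<longrightarrow> q \<ge> q0 \<longrightarrow>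
    (\<exists>c \<tau>. (\<forall>i<t. \<forall>\<sigma><NT. \<forall>d<R. c i \<sigma> d \<in> F) \<and> (\<forall>\<sigma><NT. \<tau> \<sigma> \<in> F) \<and>
      (\<forall>s\<ge>s0. \<forall>p W. \<not> path_bundle I F c \<tau> s p W))"
    using good_coefficients[OF t(2) dims R_def NT_def, where 'a = algint] by blast
  show ?thesis
  proof (rule exI[of _ s0], rule exI[of _ q0], intro allI impI, elim conjE)
    fix s q :: nat assume s: "s \<ge> s0" and q: "primepow q" "q \<ge> q0"
    obtain I :: "algint set" and F where fs: "finite_subfield I F q"
      using exists_finite_subfield[OF q(1)] by blast
    interpret fs: finite_subfield I F q by fact
    interpret pf: path_field k A \<beta> t NT R I F q
      by (intro path_field.intro path_field_axioms.intro path_system_axioms fs dims)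
    obtain c \<tau> where c: "\<forall>i<t. \<forall>\<sigma><NT. \<forall>d<R. c i \<sigma> d \<in> F" and \<tau>: "\<forall>\<sigma><NT. \<tau> \<sigma> \<in> F"
      and free: "\<And>p W. \<not> path_bundle I F c \<tau> s p W"
      using good[rule_format, OF fs q(2)] s by blast
    define X where "X = {..<A} \<rightarrow>\<^sub>E F"
    define Y where "Y = {..<\<beta> + t} \<rightarrow>\<^sub>E F"
    have fin: "finite X" "finite Y" unfolding X_def Y_def using fs.F_finite by (auto intro!: finite_PiE)
    have card: "card X = q ^ A" "card Y = q ^ (\<beta> + t)"
      unfolding X_def Y_def using fs.F_card by (simp_all add: card_PiE)
    obtain g1 g2 :: "(nat \<Rightarrow> algint) \<Rightarrow> nat" where inj: "inj_on g1 X" "inj_on g2 Y" and disj: "g1 ` X \<inter> g2 ` Y = {}"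
      and bip: "\<And>E. bipartite_with_parts (relation_graph g1 g2 X Y E) (g1 ` X) (g2 ` Y)"
      and card_E: "\<And>E. card (edges (relation_graph g1 g2 X Y E)) = card {(x, y) \<in> X \<times> Y. E x y}"
      using bipartite_relation_graph[OF fin] by blast
    define G where "G = relation_graph g1 g2 X Y (adjacent I c \<tau>)"
    have "free_of G (theta_graph s (2 * k))"
      unfolding free_of_def
    proof
      assume "contains_copy G (theta_graph s (2 * k))"
      from bipartite_theta_paths[OF inj disj this[unfolded G_def] k] obtain p W where
        W: "\<forall>l<s. W l 0 = W 0 0 \<and> W l (2 * k) = W 0 (2 * k) \<and>
          (\<forall>j\<le>2 * k. W l j \<in> (if even j = p then X else Y)) \<and>
          (\<forall>j<2 * k. if even j = p then adjacent I c \<tau> (W l j) (W l (Suc j)) else adjacent I c \<tau> (W l (Suc j)) (W l j)) \<and>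
          (\<forall>j\<le>2 * k. \<forall>j'\<le>2 * k. j \<noteq> j' \<and> even j = even j' \<longrightarrow> W l j \<noteq> W l j')"
        and W1: "\<forall>l<s. \<forall>l'<s. l \<noteq> l' \<longrightarrow> W l 1 \<noteq> W l' 1"
        by (elim exE conjE)
      have "path_bundle I F c \<tau> s p W"
        unfolding path_bundle_def
      proof (intro conjI allI impI)
        fix l assume l: "l < s"
        note Wl = W[rule_format, OF l]
        show "W l 0 = W 0 0" "W l (2 * k) = W 0 (2 * k)" using Wl by blast+
        have vtx: "W l j \<in> {..<vdim p j} \<rightarrow>\<^sub>E F" if "j \<le> 2 * k" for j
          using conjunct1[OF conjunct2[OF conjunct2[OF Wl]], rule_format, OF that]
          by (auto simp: X_def Y_def vdim_def split: if_splits)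
        then show "\<And>j. j \<le> 2 * k \<Longrightarrow> W l j \<in> {..<vdim p j} \<rightarrow>\<^sub>E F" .
        show "is_path I c \<tau> p (W l)"
          unfolding is_path_def
        proof (intro conjI allI impI)
          fix j assume "j < 2 * k"
          then have "if even j = p then adjacent I c \<tau> (W l j) (W l (Suc j)) else adjacent I c \<tau> (W l (Suc j)) (W l j)"
            using Wl by blast
          then show "adjacent I c \<tau> (W l (xpos p j)) (W l (npos p j))"
            by (auto simp: xpos_def npos_def split: if_splits)
        next
          fix j j' assume j: "j \<le> 2 * k" "j' \<le> 2 * k" "j \<noteq> j' \<and> even j = even j'"
          then have "W l j \<noteq> W l j'" using Wl by blast
          moreover have "vdim p j' = vdim p j" using j by (simp add: vdim_def)
          ultimately show "\<not> vec_cong I (vdim p j) (W l j) (W l j')"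
            using pf.vec_cong_eq[OF vtx[OF j(1)], of "W l j'"] vtx[OF j(2)] by simp
        qed
      qed (use W1 in blast)
      then show False using free by blast
    qed
    moreover have "card (edges G) = q ^ (A + \<beta>)"
      using pf.card_edges[OF c \<tau>] card_E by (simp add: G_def X_def Y_def)
    moreover have "bipartite_with_parts G (g1 ` X) (g2 ` Y)" unfolding G_def by (rule bip)
    moreover have "card (g1 ` X) = q ^ A" "card (g2 ` Y) = q ^ (\<beta> + t)"
      using card inj by (simp_all add: card_image)
    ultimately show "\<exists>(G :: nat ugraph) M N. bipartite_with_parts G M N \<and> card M = q ^ A \<and> card N = q ^ (\<beta> + t) \<and>
       free_of G (theta_graph s (2 * k)) \<and> card (edges G) = q ^ (A + \<beta>)" by blast
  qed
qed

text \<open>Here b = l / (2k) and a = \<alpha> b; the last two inequalities express the bounds 1 and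
  k / (k + 1) on \<alpha>.\<close>

lemma least_multiple:
  fixes k l :: nat and \<alpha> :: real
  assumes k: "k \<ge> 1" and \<alpha>: "\<alpha> \<in> \<rat>" "\<alpha> \<in> {real k / (real k + 1)..1}"
    and l: "l = (LEAST m::nat. m > 0 \<and> real m / (2 * real k) \<in> \<int> \<and> \<alpha> * real m / (2 * real k) \<in> \<int>)"
  obtains a b :: nat where "b > 0" "l = 2 * k * b" "\<alpha> * real l = real (2 * k * a)" "a \<le> b" "k * b \<le> (k + 1) * a"
proof -
  from \<alpha>(1) obtain i n where "n > 0" and "\<alpha> = of_int i / of_int n" by (rule Rats_cases')
  then have in': "n \<noteq> 0" "\<alpha> = of_int i / of_int n" by simp_all
  let ?P = "\<lambda>m::nat. m > 0 \<and> real m / (2 * real k) \<in> \<int> \<and> \<alpha> * real m / (2 * real k) \<in> \<int>"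
  \<comment> \<open>A denominator of \<alpha> provides an admissible multiple, so the least one
    exists and is admissible.\<close>
  have "?P (2 * k * nat \<bar>n\<bar>)"
  proof (intro conjI)
    show "0 < 2 * k * nat \<bar>n\<bar>" using k in' by simp
    have "real (2 * k * nat \<bar>n\<bar>) / (2 * real k) = of_int \<bar>n\<bar>" using k by simp
    then show "real (2 * k * nat \<bar>n\<bar>) / (2 * real k) \<in> \<int>" by simp
    have "\<alpha> * real (2 * k * nat \<bar>n\<bar>) / (2 * real k) = of_int (i * sgn n)"
      using k in' by (auto simp: abs_if sgn_if field_simps)
    then show "\<alpha> * real (2 * k * nat \<bar>n\<bar>) / (2 * real k) \<in> \<int>" by (metis Ints_of_int)
  qed
  then have Pl: "?P l" unfolding l by (rule LeastI)
  have \<alpha>_pos: "\<alpha> > 0" using \<alpha>(2) k by (auto intro: less_le_trans[of 0 "real k / (real k + 1)"])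
  obtain b where b: "real l / (2 * real k) = real b"
    using Pl by (metis Ints_cases nonneg_int_cases of_int_0_le_iff of_int_of_nat_eq divide_nonneg_nonneg of_nat_0_le_iff mult_nonneg_nonneg zero_le_numeral)
  obtain a where a: "\<alpha> * real l / (2 * real k) = real a"
  proof -
    have "0 \<le> \<alpha> * real l / (2 * real k)" using \<alpha>_pos by simp
    then show ?thesis using Pl that
      by (metis Ints_cases nonneg_int_cases of_int_0_le_iff of_int_of_nat_eq)
  qed
  have l_eq: "real l = real (2 * k * b)" using b k by (simp add: field_simps)
  then have l_eq': "l = 2 * k * b" by (simp only: of_nat_eq_iff)
  have b_pos: "b > 0" using Pl l_eq' by (cases b) auto
  have al: "\<alpha> * real l = real (2 * k * a)" using a k by (simp add: field_simps)
  then have ab: "\<alpha> * real b = real a" using l_eq k by (simp add: field_simps)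
  have "real a \<le> real b" using ab \<alpha>(2) b_pos by (metis atLeastAtMost_iff mult_left_le_one_le of_nat_0_le_iff \<alpha>_pos less_imp_le)
  moreover have "real (k * b) \<le> real ((k + 1) * a)"
  proof -
    have "real k \<le> \<alpha> * (real k + 1)" using \<alpha>(2) by (simp add: field_simps)
    then have "real k * real b \<le> \<alpha> * (real k + 1) * real b" by (intro mult_right_mono) auto
    also have "\<dots> = (real k + 1) * real a" using ab by (simp add: mult.commute mult.left_commute)
    finally show ?thesis by (simp add: algebra_simps)
  qed
  ultimately show ?thesis using that[of b a] b_pos l_eq' al by (simp only: of_nat_le_iff)
qed

theorem theorem5p7:
  fixes k l :: nat and \<alpha> :: real
  assumes "k \<ge> 1"
    and "\<alpha> \<in> \<rat>"
    and "\<alpha> \<in> {real k / (real k + 1)..1}"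
    and "l = (LEAST m::nat. m > 0 \<and> real m / (2 * real k) \<in> \<int> \<and> \<alpha> * real m / (2 * real k) \<in> \<int>)"
  shows "\<exists>s0 q0 :: nat. \<forall>s\<ge>s0. \<forall>q::nat. primepow q \<and> q \<ge> q0 \<longrightarrow>
    (\<exists>(G :: nat ugraph) M N.
       bipartite_with_parts G M N \<and>
       real (card M) = real q powr (\<alpha> * real l) \<and>
       card N = q ^ l \<and>
       free_of G (theta_graph s (2 * k)) \<and>
       real (card (edges G)) \<ge>
         1/2 * real (card M) powr (1/2 + 1 / (2 * real k)) * real (card N) powr (1/2))"
proof -
  obtain a b where b: "b > 0" and l: "l = 2 * k * b" and al: "\<alpha> * real l = real (2 * k * a)"
    and ab: "a \<le> b" "k * b \<le> (k + 1) * a"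
    using least_multiple[OF assms] by blast
  obtain m where m: "k = Suc m" using assms(1) by (cases k) auto
  define A where "A = 2 * k * a"
  \<comment> \<open>With \<beta> + t = l, this value turns the inequality for endpoints in M into an
    equality. The one for endpoints in N then amounts to a \<le> b, and t \<le> A to k b \<le> (k +
    1) a.\<close>
  define t where "t = k * b + m * a"
  define \<beta> where "\<beta> = k * b - m * a"
  have "m * a \<le> k * b" using ab(1) m by (intro mult_le_mono) auto
  then have \<beta>t: "\<beta> + t = 2 * k * b" and A\<beta>: "A + \<beta> = (k + 1) * a + k * b"
    by (simp_all add: \<beta>_def t_def A_def m)
  have "t \<le> A" using ab(2) by (simp add: t_def A_def m algebra_simps)
  moreover have "t > 0" using b m by (simp add: t_def)
  moreover have "k * (\<beta> + t) + (k - 1) * A \<le> 2 * k * t"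
    unfolding \<beta>t by (simp add: A_def t_def m algebra_simps)
  moreover have "k * A + (k - 1) * (\<beta> + t) \<le> 2 * k * t"
  proof -
    have "k * (k * a + m * b) \<le> k * (k * b + m * a)" using ab(1) by (intro mult_le_mono2) (simp add: m)
    then show ?thesis unfolding \<beta>t by (simp add: A_def t_def m algebra_simps)
  qed
  ultimately obtain s0 q0 where main: "\<forall>s\<ge>s0. \<forall>q::nat. primepow q \<and> q \<ge> q0 \<longrightarrow>
    (\<exists>(G :: nat ugraph) M N. bipartite_with_parts G M N \<and> card M = q ^ A \<and> card N = q ^ (\<beta> + t) \<and>
       free_of G (theta_graph s (2 * k)) \<and> card (edges G) = q ^ (A + \<beta>))"
    using theta_free_bipartite_graph[OF assms(1)] by blast
  show ?thesis
  proof (rule exI[of _ s0], rule exI[of _ q0], intro allI impI, goal_cases)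
    case (1 s q)
    note s = 1(1) and q = 1(2)
    obtain G :: "nat ugraph" and M N where G: "bipartite_with_parts G M N" "card M = q ^ A" "card N = q ^ (\<beta> + t)"
      "free_of G (theta_graph s (2 * k))" "card (edges G) = q ^ (A + \<beta>)"
      using main[rule_format, OF s q] by blast
    have q_pos: "real q > 0" using q primepow_gt_0_nat[of q] by simp
    have M: "real (card M) = real q powr (\<alpha> * real l)"
      using G(2) q_pos unfolding al A_def by (simp add: powr_realpow[symmetric])
    have N: "card N = q ^ l" using G(3) by (simp add: \<beta>t l)
    have "real (card M) powr (1/2 + 1 / (2 * real k)) * real (card N) powr (1/2)
       = real q powr (\<alpha> * real l * (1/2 + 1 / (2 * real k)) + real l * (1/2))"
    proof -
      have "real (card N) = real q powr real l" using q_pos by (simp add: N powr_realpow)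
      then show ?thesis unfolding M by (simp only: powr_powr powr_add[symmetric])
    qed
    \<comment> \<open>Both sides are k a + a + k b, so the product of the two powers is exactly the
      number of edges.\<close>
    also have "\<alpha> * real l * (1/2 + 1 / (2 * real k)) + real l * (1/2) = real (A + \<beta>)"
      unfolding al unfolding l A\<beta> using assms(1) by (simp add: field_simps)
    also have "real q powr real (A + \<beta>) = real (card (edges G))"
      using powr_realpow[OF q_pos, of "A + \<beta>"] G(5) by simp
    finally have "real (card M) powr (1/2 + 1 / (2 * real k)) * real (card N) powr (1/2) = real (card (edges G))" .
    then have "1/2 * real (card M) powr (1/2 + 1 / (2 * real k)) * real (card N) powr (1/2) \<le> real (card (edges G))"
      by simp
    with G M N show ?case by blast
  qed
qed

end
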